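(* Let $N=3$ and let $\mathrm{Per}$ be the classical perimeter. The regular rhombic dodecahedron is not a solution of the isoperimetric problem $$\inf_{G\in\mathcal{G}_m}\ \inf_{D\in\mathcal{D}_G^m}\mathrm{Per}(D);$$ that is, for every $m>0$, no set similar to the regular rhombic dodecahedron is a solution of this problem.
   Context: A lattice is a discrete subgroup $G$ of $(\mathbb{R}^3,+)$ of rank $3$; its inradius is $\rho_G=\frac12\min\{|g|:g\in G\setminus\{0\}\}$. A fundamental domain of $G$ is a measurable set $D\subseteq\mathbb{R}^3$ with $|(D+g)\cap D|=0$ for all $g\in G\setminus\{0\}$ and $|\mathbb{R}^3\setminus(D+G)|=0$, where $D+G=\bigcup_{g\in G}(D+g)$; $\mathcal{D}_G$ is the set of fundamental domains of $G$. For $m>0$: $\mathcal{G}_m=\{G\text{ lattice in }\mathbb{R}^3:\rho_G=m\}$ and, for $G\in\mathcal{G}_m$, $\mathcal{D}_G^m=\{D\in\mathcal{D}_G:\exists x\in D,\ |B_m(x)\setminus D|=0\}$. The classical perimeter is $\mathrm{Per}(E)=\mathcal{H}^{2}(\partial^*E)$, where $\partial^*E$ is the reduced boundary ($+\infty$ if $E$ does not have finite perimeter). A set $D$ is a solution of the problem with parameter $m$ if $D\in\mathcal{D}_G^m$ for some $G\in\mathcal{G}_m$ and $\mathrm{Per}(D)=\inf_{G'\in\mathcal{G}_m}\inf_{D'\in\mathcal{D}_{G'}^m}\mathrm{Per}(D')$. The regular rhombic dodecahedron is, up to similarity, the convex hull of the $6$ points obtained by permuting the coordinates of $(\pm1,0,0)$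 and the $8$ points $(\pm\frac12,\pm\frac12,\pm\frac12)$; it is the Voronoi cell of the face-centered cubic lattice $\{z\in\mathbb{Z}^3:z_1+z_2+z_3\text{ even}\}$. *)

theory Defs
  imports "HOL-Analysis.Analysis"
begin

section \<open>Lattices and fundamental domains\<close>

text \<open>For a discrete subgroup the rank as an abelian group is the maximal number of linearly
  independent elements, i.e. \<^term>\<open>dim G\<close>.\<close>

definition lattice3 :: "(real^3) set \<Rightarrow> bool" where
  "lattice3 G \<longleftrightarrow>
     0 \<in> G \<and> (\<forall>x\<in>G. \<forall>y\<in>G. x + y \<in> G) \<and> (\<forall>x\<in>G. - x \<in> G) \<and> discrete G \<and> dim G = 3"

text \<open>On a lattice the infimum is attained.\<close>

definition inradius :: "(real^3) set \<Rightarrow> real" where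
  "inradius G = (INF g \<in> G - {0}. norm g) / 2"

definition fundamental_domains :: "(real^3) set \<Rightarrow> (real^3) set set" where
  "fundamental_domains G =
     {D \<in> sets lebesgue.
        (\<forall>g \<in> G - {0}. (\<lambda>x. x + g) ` D \<inter> D \<in> null_sets lebesgue) \<and>
        UNIV - (\<Union>g\<in>G. (\<lambda>x. x + g) ` D) \<in> null_sets lebesgue}"

definition lattices_of_inradius :: "real \<Rightarrow> (real^3) set set" where
  "lattices_of_inradius m = {G. lattice3 G \<and> inradius G = m}"

definition ball_fundamental_domains :: "real \<Rightarrow> (real^3) set \<Rightarrow> (real^3) set set" where
  "ball_fundamental_domains m G =
     {D \<in> fundamental_domains G. \<exists>x\<in>D. ball x m - D \<in> null_sets lebesgue}"

section \<open>The classical perimeter\<close>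

text \<open>The two-dimensional Hausdorff (outer) measure, normalised so that it agrees with area on
  planes: a set of diameter \<open>d\<close> contributes the area of a disc of diameter \<open>d\<close>. Boundedness is
  required because \<^const>\<open>diameter\<close> has no meaning for unbounded sets.\<close>

definition hausdorff2_pre :: "real \<Rightarrow> 'a::metric_space set \<Rightarrow> ennreal" where
  "hausdorff2_pre \<delta> A =
     (INF C \<in> {C :: nat \<Rightarrow> 'a set. A \<subseteq> (\<Union>i. C i) \<and> (\<forall>i. bounded (C i) \<and> diameter (C i) \<le> \<delta>)}.
        \<Sum>i. ennreal (pi * (diameter (C i) / 2)\<^sup>2))"

definition hausdorff2 :: "'a::metric_space set \<Rightarrow> ennreal" where
  "hausdorff2 A = (SUP \<delta> \<in> {0<..}. hausdorff2_pre \<delta> A)"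

text \<open>The vector fields of class \<open>C\<^sub>c\<^sup>1\<close> on the whole space.\<close>

definition test_field :: "(real^3 \<Rightarrow> real^3) \<Rightarrow> bool" where
  "test_field T \<longleftrightarrow>
     (\<forall>x. T differentiable (at x)) \<and> continuous_on UNIV (\<lambda>x. jacobian T (at x)) \<and>
     compact (closure {x. T x \<noteq> 0})"

definition divergence :: "(real^3 \<Rightarrow> real^3) \<Rightarrow> real^3 \<Rightarrow> real" where
  "divergence T x = trace (jacobian T (at x))"

definition finite_perimeter :: "(real^3) set \<Rightarrow> bool" where
  "finite_perimeter E \<longleftrightarrow>
     E \<in> sets lebesgue \<and>
     bdd_above {set_lebesgue_integral lebesgue E (divergence T) |T.
                  test_field T \<and> (\<forall>x. norm (T x) \<le> 1)}"

text \<open>The Gauss--Green measure \<open>\<mu>\<^sub>E\<close> (up to sign the distributional derivative of the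
  indicator function of \<open>E\<close>), given by its polar decomposition: \<open>M = |\<mu>\<^sub>E|\<close> and
  \<open>\<mu>\<^sub>E = \<nu> M\<close> with \<open>|\<nu>| = 1\<close> almost everywhere. By Riesz representation such a pair exists
  whenever \<open>E\<close> has finite perimeter; \<open>M\<close> is unique and \<open>\<nu>\<close> is unique almost everywhere.\<close>

definition gauss_green :: "(real^3) set \<Rightarrow> (real^3) measure \<Rightarrow> (real^3 \<Rightarrow> real^3) \<Rightarrow> bool" where
  "gauss_green E M \<nu> \<longleftrightarrow>
     sets M = sets borel \<and> finite_measure M \<and>
     \<nu> \<in> borel_measurable M \<and> (AE x in M. norm (\<nu> x) = 1) \<and>
     (\<forall>T. test_field T \<longrightarrow>
        set_lebesgue_integral lebesgue E (divergence T) = (\<integral>x. T x \<bullet> \<nu> x \<partial>M))"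

text \<open>The points \<open>x\<close> of the support of \<open>|\<mu>\<^sub>E|\<close> at which the quotients
  \<open>\<mu>\<^sub>E(B\<^sub>r(x)) / |\<mu>\<^sub>E|(B\<^sub>r(x))\<close> converge, as \<open>r\<close> tends to \<open>0\<close>, to a unit vector.\<close>

definition reduced_boundary :: "(real^3) set \<Rightarrow> (real^3) set" where
  "reduced_boundary E =
     {x. \<exists>M \<nu>. gauss_green E M \<nu> \<and> (\<forall>r>0. measure M (ball x r) > 0) \<and>
        (\<exists>u. norm u = 1 \<and>
           ((\<lambda>r. set_lebesgue_integral M (ball x r) \<nu> /\<^sub>R measure M (ball x r)) \<longlongrightarrow> u) (at_right 0))}"

definition Per :: "(real^3) set \<Rightarrow> ennreal" where
  "Per E = (if finite_perimeter E then hausdorff2 (reduced_boundary E) else \<infinity>)"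

section \<open>The isoperimetric problem\<close>

definition isoperimetric_solution :: "real \<Rightarrow> (real^3) set \<Rightarrow> bool" where
  "isoperimetric_solution m D \<longleftrightarrow>
     (\<exists>G \<in> lattices_of_inradius m. D \<in> ball_fundamental_domains m G) \<and>
     Per D = (INF G \<in> lattices_of_inradius m. INF D' \<in> ball_fundamental_domains m G. Per D')"

section \<open>The rhombic dodecahedron\<close>

definition rhombic_dodecahedron :: "(real^3) set" where
  "rhombic_dodecahedron =
     convex hull ({axis i s |i s. s \<in> {1, -1}} \<union> {x. \<forall>i. x $ i \<in> {1/2, -1/2}})"

definition similar_sets :: "(real^3) set \<Rightarrow> (real^3) set \<Rightarrow> bool" where
  "similar_sets A B \<longleftrightarrow>
     (\<exists>f c. c > 0 \<and> (\<forall>x y. dist (f x) (f y) = c * dist x y) \<and> B = f ` A)"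

end

theory Submission
  imports Defs
begin

text \<open>At the vertices where six rhombic dodecahedra of the face-centered cubic tiling meet, the cell
  boundaries form the cone over the edges of a cube. This cone is a critical point of the area but
  not a minimum: replacing its apex by a small square strictly decreases the area (to second order).
  Carrying this out at all these vertices, away from the inscribed balls, gives another fundamental
  domain of the same lattice, which is admissible and has smaller perimeter.

  The upper bound for the competitor uses only that the reduced boundary lies in the topological
  boundary. The lower bound for the dodecahedron needs the facets to lie in the reduced boundary;
  since all facets have the same distance from the centre, the Gauss--Green measure is, up to a
  constant, the image of Lebesgue measure under the radial projection. Planar areas enter only up
  to the common factor \<open>hausdorff2_square\<close>, whose value is irrelevant as long as it is positive
  and finite.\<close>

section \<open>Two-dimensional Hausdorff measure\<close>

text \<open>Scale the cube around a vertex of degree four to half-side 1. The cone over its edges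
  has area 12 sqrt 2. A square of half-side h in place of the apex turns eight of the triangles into
  trapezoids of slant height sqrt (1 + (1 - h)^2) and shortens the other four to height sqrt 2 * (1
  - h). The total is 4 h^2 + 8 (1 + h) sqrt (1 + (1 - h)^2) + 4 sqrt 2 (1 - h) = 12 sqrt 2 + (4 - 3
  sqrt 2) h^2 + O(h^3). The linear terms cancel, so the gain is only quadratic, and the cubic term
  is positive: h has to be small, and the final comparison is decided by a narrow margin in exact
  arithmetic. The cube has to avoid the inscribed ball of radius 1 / sqrt 2, which half-side 1/4
  does since 3/4 > 1 / sqrt 2. One competitor per \<open>m\<close> suffices, but the dodecahedron
  may be any similar copy, tiling by any lattice. Containing a ball of radius \<open>m\<close>
  forces it to be at least as large as the Voronoi cell of the face-centered cubic lattice of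
  inradius \<open>m\<close>, and that cell is the one modified.\<close>

abbreviation disc_weight :: "'a::metric_space set \<Rightarrow> ennreal" where
  "disc_weight C \<equiv> ennreal (pi * (diameter C / 2)\<^sup>2)"

definition fine_covers :: "real \<Rightarrow> 'a::metric_space set \<Rightarrow> (nat \<Rightarrow> 'a set) set" where
  "fine_covers r A = {C. A \<subseteq> (\<Union>i. C i) \<and> (\<forall>i. bounded (C i) \<and> diameter (C i) \<le> r)}"

lemma hausdorff2_pre_eq: "hausdorff2_pre r A = (INF C \<in> fine_covers r A. \<Sum>i. disc_weight (C i))"
  by (simp add: hausdorff2_pre_def fine_covers_def)

lemma hausdorff2_pre_le: "C \<in> fine_covers r A \<Longrightarrow> hausdorff2_pre r A \<le> (\<Sum>i. disc_weight (C i))"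
  unfolding hausdorff2_pre_eq by (rule INF_lower)

lemma hausdorff2_pre_le_hausdorff2: "r > 0 \<Longrightarrow> hausdorff2_pre r A \<le> hausdorff2 A"
  unfolding hausdorff2_def by (rule SUP_upper) auto

lemma hausdorff2_pre_mono: "A \<subseteq> B \<Longrightarrow> hausdorff2_pre r A \<le> hausdorff2_pre r B"
  unfolding hausdorff2_pre_eq fine_covers_def by (rule INF_superset_mono) auto

lemma hausdorff2_pre_antimono: "r \<le> s \<Longrightarrow> hausdorff2_pre s A \<le> hausdorff2_pre r A"
  unfolding hausdorff2_pre_eq fine_covers_def by (rule INF_superset_mono) (auto intro: order_trans)

lemma hausdorff2_mono: "A \<subseteq> B \<Longrightarrow> hausdorff2 A \<le> hausdorff2 B"
  unfolding hausdorff2_def by (rule SUP_mono') (rule hausdorff2_pre_mono)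

lemma hausdorff2_pre_empty: "r > 0 \<Longrightarrow> hausdorff2_pre r {} = 0"
  using hausdorff2_pre_le[of "\<lambda>_. {}" r "{}"] by (simp add: fine_covers_def)

lemma hausdorff2_empty [simp]: "hausdorff2 {} = 0"
proof -
  have "hausdorff2 ({} :: 'a set) \<le> 0"
    unfolding hausdorff2_def by (intro SUP_least) (simp add: hausdorff2_pre_empty)
  then show ?thesis by simp
qed

lemma hausdorff2_pre_UN_le:
  fixes A :: "nat \<Rightarrow> 'a::metric_space set"
  assumes "r > 0"
  shows "hausdorff2_pre r (\<Union>i. A i) \<le> (\<Sum>i. hausdorff2_pre r (A i))"
proof (cases "(\<Sum>i. hausdorff2_pre r (A i)) = \<infinity>")
  case False
  then have fin: "hausdorff2_pre r (A i) < \<infinity>" for i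
    using ennreal_suminf_lessD[of "\<lambda>i. hausdorff2_pre r (A i)" \<infinity>] by (simp add: less_top)
  show ?thesis
  proof (rule ennreal_le_epsilon)
    fix e :: real assume "e > 0"
    have "\<exists>C \<in> fine_covers r (A i). (\<Sum>j. disc_weight (C j))
            < hausdorff2_pre r (A i) + ennreal (e * (1/2)^Suc i)" for i
    proof -
      have "hausdorff2_pre r (A i) < hausdorff2_pre r (A i) + ennreal (e * (1/2)^Suc i)"
        using \<open>e > 0\<close> fin[of i]
        by (cases "hausdorff2_pre r (A i)") (auto simp: ennreal_less_iff simp flip: ennreal_plus)
      then show ?thesis
        by (subst (asm) hausdorff2_pre_eq) (simp only: INF_less_iff)
    qed
    then obtain C where C: "\<And>i. C i \<in> fine_covers r (A i)"
      and le: "\<And>i. (\<Sum>j. disc_weight (C i j)) < hausdorff2_pre r (A i) + ennreal (e * (1/2)^Suc i)"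
      by metis
    define C' where "C' n = case_prod C (prod_decode n)" for n
    have "x \<in> (\<Union>n. C' n)" if "x \<in> (\<Union>i. A i)" for x
    proof -
      from that obtain i where "x \<in> A i" by auto
      then obtain j where "x \<in> C i j" using C[of i] by (auto simp: fine_covers_def)
      then have "x \<in> C' (prod_encode (i, j))" by (simp add: C'_def)
      then show ?thesis by blast
    qed
    moreover have "bounded (C' n) \<and> diameter (C' n) \<le> r" for n
      using C by (auto simp: fine_covers_def C'_def split: prod.split)
    ultimately have "C' \<in> fine_covers r (\<Union>i. A i)"
      unfolding fine_covers_def by blast
    then have "hausdorff2_pre r (\<Union>i. A i) \<le> (\<Sum>n. disc_weight (C' n))"
      by (rule hausdorff2_pre_le)
    also have "\<dots> = (\<Sum>i. \<Sum>j. disc_weight (C i j))"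
      unfolding C'_def
      by (subst suminf_ennreal_2dimen[where f = "\<lambda>p. disc_weight (case_prod C p)", symmetric]) auto
    also have "\<dots> \<le> (\<Sum>i. hausdorff2_pre r (A i) + ennreal (e * (1/2)^Suc i))"
      by (intro suminf_le less_imp_le le) auto
    also have "\<dots> = (\<Sum>i. hausdorff2_pre r (A i)) + (\<Sum>i. ennreal (e * (1/2)^Suc i))"
      by (rule suminf_add[symmetric]) auto
    also have "(\<Sum>i. ennreal (e * (1/2)^Suc i)) = ennreal e"
    proof (rule suminf_ennreal_eq)
      show "(\<lambda>i. e * (1/2)^Suc i) sums e"
        using sums_mult[OF power_half_series, of e] by simp
    qed (use \<open>e > 0\<close> in auto)
    finally show "hausdorff2_pre r (\<Union>i. A i) \<le> (\<Sum>i. hausdorff2_pre r (A i)) + ennreal e" .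
  qed
qed simp

lemma hausdorff2_UN_le:
  fixes A :: "nat \<Rightarrow> 'a::metric_space set"
  shows "hausdorff2 (\<Union>i. A i) \<le> (\<Sum>i. hausdorff2 (A i))"
proof -
  have "hausdorff2_pre r (\<Union>i. A i) \<le> (\<Sum>i. hausdorff2 (A i))" if "r > 0" for r
  proof -
    have "hausdorff2_pre r (\<Union>i. A i) \<le> (\<Sum>i. hausdorff2_pre r (A i))"
      using that by (rule hausdorff2_pre_UN_le)
    also have "\<dots> \<le> (\<Sum>i. hausdorff2 (A i))"
      by (intro suminf_le hausdorff2_pre_le_hausdorff2 that) auto
    finally show ?thesis .
  qed
  then show ?thesis
    unfolding hausdorff2_def[of "\<Union>i. A i"] by (intro SUP_least) auto
qed

lemma hausdorff2_Un_le: "hausdorff2 (A \<union> B) \<le> hausdorff2 A + hausdorff2 B"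
proof -
  let ?f = "\<lambda>i::nat. if i = 0 then A else if i = 1 then B else {}"
  have "A \<union> B = (\<Union>i. ?f i)"
    by (auto split: if_splits)
  then have "hausdorff2 (A \<union> B) \<le> (\<Sum>i. hausdorff2 (?f i))"
    using hausdorff2_UN_le[of ?f] by simp
  also have "\<dots> = (\<Sum>i<2. hausdorff2 (?f i))"
    by (rule suminf_finite) auto
  also have "\<dots> = hausdorff2 A + hausdorff2 B" by (simp add: lessThan_Suc numeral_2_eq_2)
  finally show ?thesis .
qed

lemma hausdorff2_finite_UN_le:
  "finite I \<Longrightarrow> hausdorff2 (\<Union>i\<in>I. A i) \<le> (\<Sum>i\<in>I. hausdorff2 (A i))"
proof (induction I rule: finite_induct)
  case (insert i I)
  then show ?case
    by (auto intro!: order_trans[OF hausdorff2_Un_le] add_left_mono)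
qed simp

text \<open>A set of diameter at most \<open>r < d\<close> cannot meet both \<open>A\<close> and
  \<open>B\<close>, so a cover of the union splits into covers of the two sets that share no
  weight.\<close>

lemma hausdorff2_pre_separated:
  assumes "d > 0" "\<And>x y. x \<in> A \<Longrightarrow> y \<in> B \<Longrightarrow> dist x y \<ge> d" "0 < r" "r < d"
  shows "hausdorff2_pre r A + hausdorff2_pre r B \<le> hausdorff2_pre r (A \<union> B)"
  unfolding hausdorff2_pre_eq[of r "A \<union> B"]
proof (rule INF_greatest)
  fix C assume C: "C \<in> fine_covers r (A \<union> B)"
  \<comment> \<open>Sets that miss \<open>S\<close> are replaced by the empty set, whose diameter
    and hence weight is 0.\<close>
  define P where "P S i = (if C i \<inter> S = {} then {} else C i)" for S i
  have cov: "P S \<in> fine_covers r S" if "S \<subseteq> A \<union> B" for S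
    using C that \<open>r > 0\<close> unfolding fine_covers_def P_def by fastforce
  have "disc_weight (P A i) + disc_weight (P B i) \<le> disc_weight (C i)" for i
  proof -
    have "C i \<inter> A = {} \<or> C i \<inter> B = {}"
    proof (rule ccontr)
      assume "\<not> ?thesis"
      then obtain x y where "x \<in> C i" "x \<in> A" "y \<in> C i" "y \<in> B" by auto
      moreover have "bounded (C i)" "diameter (C i) \<le> r" using C by (auto simp: fine_covers_def)
      ultimately have "dist x y \<le> r" "dist x y \<ge> d"
        using diameter_bounded_bound[of "C i" x y] assms(2) by auto
      then show False using assms(4) by simp
    qed
    then show ?thesis by (auto simp: P_def)
  qed
  then have "(\<Sum>i. disc_weight (P A i)) + (\<Sum>i. disc_weight (P B i)) \<le> (\<Sum>i. disc_weight (C i))"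
    by (subst suminf_add) (auto intro!: suminf_le)
  moreover have "hausdorff2_pre r A \<le> (\<Sum>i. disc_weight (P A i))"
    "hausdorff2_pre r B \<le> (\<Sum>i. disc_weight (P B i))"
    by (intro hausdorff2_pre_le cov; simp)+
  ultimately show "hausdorff2_pre r A + hausdorff2_pre r B \<le> (\<Sum>i. disc_weight (C i))"
    using add_mono order_trans by blast
qed

text \<open>This is the defining property of a metric outer measure, from which the measurability of
  closed sets follows. The scales \<open>r\<close> and \<open>s\<close> come from two independent
  suprema; both are refined to a common \<open>t < d\<close>.\<close>

lemma hausdorff2_separated:
  assumes "d > 0" "\<And>x y. x \<in> A \<Longrightarrow> y \<in> B \<Longrightarrow> dist x y \<ge> d"
  shows "hausdorff2 (A \<union> B) = hausdorff2 A + hausdorff2 B"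
proof (rule antisym[OF hausdorff2_Un_le])
  have "hausdorff2_pre r A + hausdorff2_pre s B \<le> hausdorff2 (A \<union> B)" if "r > 0" "s > 0" for r s
  proof -
    define t where "t = min (min r s) (d/2)"
    have t: "0 < t" "t < d" "t \<le> r" "t \<le> s" using that assms(1) by (auto simp: t_def)
    have "hausdorff2_pre r A + hausdorff2_pre s B \<le> hausdorff2_pre t A + hausdorff2_pre t B"
      by (intro add_mono hausdorff2_pre_antimono t)
    also have "\<dots> \<le> hausdorff2_pre t (A \<union> B)"
      by (rule hausdorff2_pre_separated[OF assms]) (use t in auto)
    also have "\<dots> \<le> hausdorff2 (A \<union> B)" by (rule hausdorff2_pre_le_hausdorff2) (rule t)
    finally show ?thesis .
  qed
  then have *: "(SUP r\<in>{0<..}. hausdorff2_pre r A + hausdorff2_pre s B) \<le> hausdorff2 (A \<union> B)"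
    if "s > 0" for s
    using that by (intro SUP_least) auto
  have "hausdorff2 A + hausdorff2_pre s B \<le> hausdorff2 (A \<union> B)" if "s > 0" for s
    using *[OF that] unfolding hausdorff2_def[of A] by (subst ennreal_SUP_add_left[symmetric]) auto
  then have "(SUP s\<in>{0<..}. hausdorff2 A + hausdorff2_pre s B) \<le> hausdorff2 (A \<union> B)"
    by (intro SUP_least) auto
  then show "hausdorff2 A + hausdorff2 B \<le> hausdorff2 (A \<union> B)"
    unfolding hausdorff2_def[of B] by (subst ennreal_SUP_add_right) auto
qed

text \<open>\<open>f\<close> need not be onto, so a cover of the image is pulled back by preimages.
  Since \<open>f\<close> maps these into the original sets, their diameters are at most 1 / c times
  the original ones.\<close>

lemma hausdorff2_similar_image:
  fixes f :: "'a::metric_space \<Rightarrow> 'b::metric_space"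
  assumes "c > 0" "\<And>x y. dist (f x) (f y) = c * dist x y"
  shows "hausdorff2 (f ` A) = ennreal (c\<^sup>2) * hausdorff2 A"
proof -
  have diam: "bounded (f ` S)" "diameter (f ` S) = c * diameter S" if "bounded S" for S
  proof -
    from that obtain x e where "\<forall>y\<in>S. dist x y \<le> e" unfolding bounded_def by auto
    then show bd: "bounded (f ` S)" unfolding bounded_def
      by (intro exI[of _ "f x"] exI[of _ "c * e"]) (use assms in auto)
    show "diameter (f ` S) = c * diameter S"
    proof (cases "S = {}")
      case False
      show ?thesis
      proof (rule antisym)
        show "diameter (f ` S) \<le> c * diameter S"
          unfolding diameter_def[of "f ` S"] using False assms diameter_bounded_bound[OF that]
          by (auto intro!: cSUP_least)
        have "diameter S \<le> diameter (f ` S) / c"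
        proof -
          have "dist x y \<le> diameter (f ` S) / c" if "x \<in> S" "y \<in> S" for x y
            using diameter_bounded_bound[OF bd, of "f x" "f y"] that assms by (simp add: field_simps)
          then show ?thesis
            unfolding diameter_def[of S] using False by (auto intro!: cSUP_least)
        qed
        then show "c * diameter S \<le> diameter (f ` S)" using assms(1) by (simp add: field_simps)
      qed
    qed simp
  qed
  have inj: "inj f"
    using assms by (metis dist_eq_0_iff injI mult_eq_0_iff less_irrefl)
  have weight: "disc_weight (f ` S) = ennreal (c\<^sup>2) * disc_weight S" if "bounded S" for S
    using assms(1) by (simp add: diam[OF that] power_mult_distrib power_divide field_simps flip: ennreal_mult)
  have pre: "hausdorff2_pre (c * r) (f ` A) = ennreal (c\<^sup>2) * hausdorff2_pre r A" if "r > 0" for r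
  proof (rule antisym)
    have c2: "ennreal (c\<^sup>2) \<noteq> 0" "ennreal (c\<^sup>2) \<noteq> \<infinity>" using assms(1) by auto
    have *: "hausdorff2_pre (c * r) (f ` A) \<le> ennreal (c\<^sup>2) * (\<Sum>i. disc_weight (C i))"
      if C: "C \<in> fine_covers r A" for C
    proof -
      have b: "bounded (C i)" "diameter (C i) \<le> r" "A \<subseteq> (\<Union>i. C i)" for i
        using C by (auto simp: fine_covers_def)
      have "(\<lambda>i. f ` C i) \<in> fine_covers (c * r) (f ` A)"
        unfolding fine_covers_def mem_Collect_eq
      proof (intro conjI allI)
        show "f ` A \<subseteq> (\<Union>i. f ` C i)" using b(3) by (simp add: image_mono flip: image_UN)
        show "diameter (f ` C i) \<le> c * r" for i
          unfolding diam(2)[OF b(1)] using b(2)[of i] assms(1) by simp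
      qed (rule diam(1)[OF b(1)])
      then have "hausdorff2_pre (c * r) (f ` A) \<le> (\<Sum>i. disc_weight (f ` C i))"
        by (rule hausdorff2_pre_le)
      also have "\<dots> = ennreal (c\<^sup>2) * (\<Sum>i. disc_weight (C i))"
        by (subst weight[OF b(1)]) (simp add: ennreal_suminf_cmult)
      finally show ?thesis .
    qed
    have "hausdorff2_pre (c * r) (f ` A) / ennreal (c\<^sup>2) \<le> hausdorff2_pre r A"
      unfolding hausdorff2_pre_eq[of r A]
      using assms(1) by (intro INF_greatest divide_le_posI_ennreal *) auto
    then have "ennreal (c\<^sup>2) * (hausdorff2_pre (c * r) (f ` A) / ennreal (c\<^sup>2)) \<le> ennreal (c\<^sup>2) * hausdorff2_pre r A"
      by (rule mult_left_mono) auto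
    moreover have "ennreal (c\<^sup>2) * (y / ennreal (c\<^sup>2)) = y" for y
      using ennreal_mult_divide_eq[OF c2(1), of y] c2(2)
      by (simp add: ennreal_times_divide mult.commute)
    ultimately show "hausdorff2_pre (c * r) (f ` A) \<le> ennreal (c\<^sup>2) * hausdorff2_pre r A"
      by simp
    show "ennreal (c\<^sup>2) * hausdorff2_pre r A \<le> hausdorff2_pre (c * r) (f ` A)"
      unfolding hausdorff2_pre_eq[of "c * r" "f ` A"]
    proof (rule INF_greatest)
      fix C assume C: "C \<in> fine_covers (c * r) (f ` A)"
      define C' where "C' i = f -` C i" for i
      have b: "bounded (C i)" "diameter (C i) \<le> c * r" for i
        using C by (auto simp: fine_covers_def)
      have fC': "f ` C' i \<subseteq> C i" for i by (auto simp: C'_def)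
      have b': "bounded (C' i)" for i
      proof -
        obtain e where "\<forall>x\<in>C i. \<forall>y\<in>C i. dist x y \<le> e"
          using b(1)[of i] by (metis bounded_two_points)
        then have "c * dist x y \<le> e" if "x \<in> C' i" "y \<in> C' i" for x y
          using that assms(2)[of x y] by (fastforce simp: C'_def)
        then show ?thesis unfolding bounded_two_points
          by (intro exI[of _ "e / c"]) (use assms(1) in \<open>auto simp: field_simps\<close>)
      qed
      have d: "c * diameter (C' i) \<le> diameter (C i)" for i
        using diameter_subset[OF fC' b(1)] diam(2)[OF b'] by simp
      have "C' \<in> fine_covers r A"
        unfolding fine_covers_def mem_Collect_eq
      proof (intro conjI allI)
        show "A \<subseteq> (\<Union>i. C' i)" using C unfolding fine_covers_def C'_def by blast
        show "diameter (C' i) \<le> r" for i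
          using order_trans[OF d b(2)] assms(1) by simp
      qed (rule b')
      then have "ennreal (c\<^sup>2) * hausdorff2_pre r A \<le> ennreal (c\<^sup>2) * (\<Sum>i. disc_weight (C' i))"
        by (intro mult_left_mono hausdorff2_pre_le) auto
      also have "\<dots> = (\<Sum>i. disc_weight (f ` C' i))"
        by (simp add: weight[OF b'] ennreal_suminf_cmult)
      also have "\<dots> \<le> (\<Sum>i. disc_weight (C i))"
        using diameter_subset[OF fC' b(1)] diameter_ge_0[OF diam(1)[OF b']]
        by (intro suminf_le) (auto intro!: ennreal_leI power_mono)
      finally show "ennreal (c\<^sup>2) * hausdorff2_pre r A \<le> (\<Sum>i. disc_weight (C i))" .
    qed
  qed
  have "hausdorff2 (f ` A) = (SUP r\<in>{0<..}. hausdorff2_pre (c * r) (f ` A))"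
  proof -
    have "{0<..} = (*) c ` {0<..}"
    proof -
      have "x \<in> (*) c ` {0<..}" if "x > 0" for x
        using that assms(1) by (intro image_eqI[of _ _ "x / c"]) auto
      then show ?thesis using assms(1) by auto
    qed
    then show ?thesis unfolding hausdorff2_def by (metis (no_types, lifting) SUP_image comp_apply SUP_cong)
  qed
  also have "\<dots> = (SUP r\<in>{0<..}. ennreal (c\<^sup>2) * hausdorff2_pre r A)"
    by (intro SUP_cong) (auto simp: pre)
  also have "\<dots> = ennreal (c\<^sup>2) * hausdorff2 A"
    unfolding hausdorff2_def by (rule SUP_mult_left_ennreal[symmetric])
  finally show ?thesis .
qed

section \<open>Measurability of Borel sets\<close>

text \<open>Caratheodory's criterion for metric outer measures. The points \<open>T n\<close> of
  \<open>S\<close> at distance at least 1 / (n + 1) from \<open>F\<close> are separated from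
  \<open>F\<close>, so the inequality holds with \<open>T n\<close> in place of
  \<open>S - F\<close>. The layers \<open>R\<close> between consecutive \<open>T n\<close> have a
  convergent sum of measures, so the part of \<open>S - F\<close> missed by \<open>T n\<close> tends
  to measure 0.\<close>

lemma hausdorff2_caratheodory_closed:
  fixes F S :: "'a::metric_space set"
  assumes "closed F"
  shows "hausdorff2 (F \<inter> S) + hausdorff2 (S - F) \<le> hausdorff2 S"
\<comment> \<open>The empty \<open>F\<close> is split off because \<open>infdist\<close> to it is 0
  by convention, which would make every \<open>T n\<close> empty.\<close>
proof (cases "hausdorff2 S = \<infinity> \<or> F = {}")
  case False
  then have fin: "hausdorff2 S < \<infinity>" and "F \<noteq> {}" by (auto simp: less_top)
  define T where "T n = {x \<in> S. infdist x F \<ge> 1 / real (Suc n)}" for n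
  define R where "R n = T (Suc n) - T n" for n
  have Tmono: "T n \<subseteq> T m" if "n \<le> m" for n m
  proof -
    have "1 / real (Suc m) \<le> 1 / real (Suc n)" using that by (simp add: frac_le)
    then show ?thesis by (auto simp: T_def)
  qed
  have T: "hausdorff2 (F \<inter> S) + hausdorff2 (T n) \<le> hausdorff2 S" for n
  proof -
    have "hausdorff2 (F \<inter> S \<union> T n) = hausdorff2 (F \<inter> S) + hausdorff2 (T n)"
    proof (rule hausdorff2_separated[of "1 / real (Suc n)"])
      fix x y assume "x \<in> F \<inter> S" "y \<in> T n"
      then show "1 / real (Suc n) \<le> dist x y"
        using infdist_le[of x F y] by (simp add: T_def dist_commute)
    qed simp
    then show ?thesis by (metis T_def hausdorff2_mono Int_lower2 Un_least mem_Collect_eq subsetI)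
  qed
  have sep: "hausdorff2 (T n \<union> R (Suc n)) = hausdorff2 (T n) + hausdorff2 (R (Suc n))" for n
  proof (rule hausdorff2_separated[of "1 / real (Suc n) - 1 / real (Suc (Suc n))"])
    show "0 < 1 / real (Suc n) - 1 / real (Suc (Suc n))" by (simp add: frac_less2)
    fix x y assume "x \<in> T n" "y \<in> R (Suc n)"
    then have "infdist x F \<ge> 1 / real (Suc n)" "infdist y F < 1 / real (Suc (Suc n))"
      by (auto simp: T_def R_def)
    then show "1 / real (Suc n) - 1 / real (Suc (Suc n)) \<le> dist x y"
      using infdist_triangle[of x F y] by linarith
  qed
  have RT: "R n \<subseteq> T (Suc n)" for n by (auto simp: R_def)
  \<comment> \<open>Adjacent layers need not be separated, but layers two apart are. Summing even
    and odd indices separately (\<open>k\<close> = 0 and 1) bounds each sum by the measure of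
    \<open>S\<close>.\<close>
  have alt: "(\<Sum>i<n. hausdorff2 (R (Suc (2 * i + k)))) \<le> hausdorff2 (T (2 * n + k))" for n k
  proof (induction n)
    case (Suc n)
    have "(\<Sum>i<Suc n. hausdorff2 (R (Suc (2 * i + k)))) \<le> hausdorff2 (T (2 * n + k)) + hausdorff2 (R (Suc (2 * n + k)))"
      using Suc by (simp add: add_right_mono)
    also have "\<dots> = hausdorff2 (T (2 * n + k) \<union> R (Suc (2 * n + k)))" by (rule sep[symmetric])
    also have "\<dots> \<le> hausdorff2 (T (2 * Suc n + k))"
      using RT[of "Suc (2 * n + k)"] Tmono[of "2 * n + k" "2 * Suc n + k"]
      by (intro hausdorff2_mono) auto
    finally show ?case .
  qed simp
  define f where "f i = hausdorff2 (R (Suc i))" for i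
  have TS: "hausdorff2 (T n) \<le> hausdorff2 S" for n by (rule hausdorff2_mono) (auto simp: T_def)
  have dbl: "(\<Sum>i<2 * n. f i) = (\<Sum>i<n. f (2 * i)) + (\<Sum>i<n. f (2 * i + 1))" for n
    by (induction n) (auto simp: ac_simps)
  have "(\<Sum>i<n. f i) \<le> hausdorff2 S + hausdorff2 S" for n
  proof -
    have "(\<Sum>i<n. f i) \<le> (\<Sum>i<2 * n. f i)" by (rule sum_mono2) auto
    also have "\<dots> \<le> hausdorff2 S + hausdorff2 S" unfolding dbl
      using order_trans[OF alt[where n = n and k = 0] TS] order_trans[OF alt[where n = n and k = 1] TS]
      by (intro add_mono) (auto simp: f_def)
    finally show ?thesis .
  qed
  then have "suminf f \<le> hausdorff2 S + hausdorff2 S" by (intro suminf_le_const) auto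
  then have sumfin: "suminf f < top" using fin by (simp add: le_less_trans)
  define r where "r i = enn2real (f i)" for i
  have fr: "f i = ennreal (r i)" and r0: "r i \<ge> 0" for i
    using ennreal_suminf_lessD[OF sumfin, of i] by (auto simp: r_def)
  have summ: "summable r"
    using sumfin r0 unfolding fr by (intro summable_suminf_not_top) auto
  have SF: "hausdorff2 (S - F) \<le> hausdorff2 (T (Suc n)) + (\<Sum>i. f (i + n))" for n
  proof -
    have "S - F \<subseteq> T (Suc n) \<union> (\<Union>i. R (Suc (i + n)))"
    proof
      fix x assume x: "x \<in> S - F"
      then have "infdist x F > 0"
        using assms \<open>F \<noteq> {}\<close> in_closed_iff_infdist_zero[of F x] infdist_nonneg[of x F] by force
      then obtain N where "1 / real (Suc N) < infdist x F" using nat_approx_posE by blast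
      then have "x \<in> T N" using x by (simp add: T_def)
      define N' where "N' = (LEAST N. x \<in> T N)"
      have N': "x \<in> T N'" "\<And>i. i < N' \<Longrightarrow> x \<notin> T i"
        unfolding N'_def using \<open>x \<in> T N\<close> by (auto intro: LeastI dest: not_less_Least)
      show "x \<in> T (Suc n) \<union> (\<Union>i. R (Suc (i + n)))"
      proof (cases "N' \<le> Suc n")
        case True
        then show ?thesis using N'(1) Tmono[OF True] by auto
      next
        case False
        then obtain j where j: "N' = Suc (Suc (j + n))"
          by (metis add.commute less_natE not_less_eq_eq not_le add_Suc)
        then have "x \<in> R (Suc (j + n))" using N' by (simp add: R_def)
        then show ?thesis by blast
      qed
    qed
    then have "hausdorff2 (S - F) \<le> hausdorff2 (T (Suc n)) + hausdorff2 (\<Union>i. R (Suc (i + n)))"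
      by (rule order_trans[OF hausdorff2_mono hausdorff2_Un_le])
    also have "\<dots> \<le> hausdorff2 (T (Suc n)) + (\<Sum>i. f (i + n))"
      unfolding f_def by (intro add_left_mono hausdorff2_UN_le)
    finally show ?thesis .
  qed
  show ?thesis
  proof (rule ennreal_le_epsilon)
    fix e :: real assume "e > 0"
    from suminf_exist_split[OF this summ] obtain n where n: "norm (\<Sum>i. r (i + n)) < e" by blast
    have "(\<Sum>i. f (i + n)) = ennreal (\<Sum>i. r (i + n))"
      unfolding fr using r0 summ by (intro suminf_ennreal2) (auto simp: summable_iff_shift)
    also have "\<dots> \<le> ennreal e" using n by (intro ennreal_leI) auto
    finally have "hausdorff2 (F \<inter> S) + hausdorff2 (S - F)
        \<le> hausdorff2 (F \<inter> S) + (hausdorff2 (T (Suc n)) + ennreal e)"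
      using SF[of n] by (intro add_left_mono) (meson add_left_mono order_trans)
    also have "\<dots> \<le> hausdorff2 S + ennreal e"
      using add_right_mono[OF T[of "Suc n"], of "ennreal e"] by (simp add: ac_simps)
    finally show "hausdorff2 (F \<inter> S) + hausdorff2 (S - F) \<le> hausdorff2 S + ennreal e" .
  qed
qed auto

definition hausdorff2_measure :: "'a::metric_space measure" where
  "hausdorff2_measure = measure_of UNIV (sets borel) hausdorff2"

lemma space_hausdorff2_measure [simp]: "space hausdorff2_measure = UNIV"
  by (simp add: hausdorff2_measure_def space_measure_of_conv)

lemma sets_hausdorff2_measure [simp, measurable_cong]: "sets hausdorff2_measure = sets borel"
  unfolding hausdorff2_measure_def using sets.sigma_sets_eq[of borel] by simp

text \<open>\<open>measure_of\<close> gives value 0 everywhere unless its set function is countably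
  additive on the sigma algebra; Caratheodory's construction supplies this, on a system that
  contains the closed sets.\<close>

lemma emeasure_hausdorff2_measure:
  fixes A :: "'a::metric_space set"
  assumes "A \<in> sets borel"
  shows "emeasure hausdorff2_measure A = hausdorff2 A"
proof -
  define L where "L = lambda_system UNIV (Pow UNIV) (hausdorff2 :: 'a set \<Rightarrow> ennreal)"
  have oms: "outer_measure_space (Pow UNIV) (hausdorff2 :: 'a set \<Rightarrow> ennreal)"
    unfolding outer_measure_space_def positive_def increasing_def countably_subadditive_def
    by (auto intro: hausdorff2_mono hausdorff2_UN_le)
  have L: "measure_space UNIV L hausdorff2"
    unfolding L_def by (rule sigma_algebra.caratheodory_lemma[OF sigma_algebra_Pow oms])
  have "F \<in> L" if "closed F" for F
  proof -
    have "hausdorff2 (F \<inter> S) + hausdorff2 (S - F) = hausdorff2 S" for S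
    proof (rule antisym[OF hausdorff2_caratheodory_closed[OF that]])
      show "hausdorff2 S \<le> hausdorff2 (F \<inter> S) + hausdorff2 (S - F)"
        using hausdorff2_Un_le[of "F \<inter> S" "S - F"] by (metis Int_Diff_Un Int_commute)
    qed
    then show ?thesis
      unfolding L_def lambda_system_def by (auto simp: Diff_eq Int_commute)
  qed
  then have "sets borel \<subseteq> L"
    unfolding borel_eq_closed using L
    by (simp add: sets_measure_of_conv measure_space_def) (metis mem_Collect_eq sigma_algebra.sigma_sets_subset subsetI)
  then have "measure_space UNIV (sets borel) (hausdorff2 :: 'a set \<Rightarrow> ennreal)"
    using L sets.sigma_algebra_axioms[of borel]
    unfolding measure_space_def positive_def countably_additive_def by auto
  then show ?thesis
    unfolding hausdorff2_measure_def using assms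
    by (intro emeasure_measure_of_sigma) (auto simp: measure_space_def)
qed

section \<open>Comparison with planar Lebesgue measure\<close>

abbreviation unit_square :: "(real \<times> real) set" where
  "unit_square \<equiv> {0..1} \<times> {0..1}"

definition hausdorff2_square :: ennreal where
  "hausdorff2_square = hausdorff2 unit_square"

lemma hausdorff2_translation:
  fixes A :: "'a::real_normed_vector set"
  shows "hausdorff2 ((+) t ` A) = hausdorff2 A"
  using hausdorff2_similar_image[of 1 "(+) t" A] by simp

text \<open>Cover by a grid of n^2 squares of side 1 / n. The crude diameter bound 2 / n from the
  sum norm already gives total weight \<open>pi\<close> at every scale.\<close>

lemma hausdorff2_square_finite: "hausdorff2_square < top"
proof -
  have "hausdorff2_pre r unit_square \<le> ennreal pi" if "r > 0" for r
  proof -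
    obtain n0 where n0: "1 / real (Suc n0) < r / 2" using nat_approx_posE[of "r/2"] \<open>r > 0\<close> by auto
    define n where "n = Suc n0"
    have n: "n > 0" "2 / real n \<le> r" using n0 by (auto simp: n_def field_simps)
    define I where "I k = {real k / n .. (real k + 1) / n}" for k :: nat
    define C where "C k = (if k < n * n then I (k div n) \<times> I (k mod n) else {})" for k
    have dist: "dist x y \<le> 2 / n" if "x \<in> I i \<times> I j" "y \<in> I i \<times> I j" for i j x y
    proof -
      have "\<bar>fst x - fst y\<bar> \<le> 1 / n" "\<bar>snd x - snd y\<bar> \<le> 1 / n"
        using that by (auto simp: I_def add_divide_distrib abs_le_iff)
      then show ?thesis
        using sqrt_sum_squares_le_sum_abs[of "fst x - fst y" "snd x - snd y"]
        by (simp add: dist_prod_def dist_real_def)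
    qed
    have C: "bounded (C k)" "diameter (C k) \<le> 2 / n" for k
    proof -
      show "bounded (C k)" by (auto simp: C_def I_def intro!: bounded_Times)
      show "diameter (C k) \<le> 2 / n"
        using dist[of _ "k div n" "k mod n"]
        by (intro diameter_le) (auto simp: C_def dist_norm split: if_splits)
    qed
    have I: "\<exists>i<n. t \<in> I i" if "0 \<le> t" "t \<le> 1" for t :: real
    proof (cases "t = 1")
      case True
      then show ?thesis using n by (intro exI[of _ n0]) (auto simp: I_def n_def field_simps)
    next
      case False
      define i where "i = nat \<lfloor>t * n\<rfloor>"
      have i: "real i \<le> t * n" "t * n < real i + 1"
        using that n(1) by (auto simp: i_def)
      have "t * n < n" using that False n(1) by simp
      then have "i < n" using i by (simp flip: of_nat_less_iff)
      then show ?thesis using i n(1) by (intro exI[of _ i]) (auto simp: I_def field_simps)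
    qed
    have cover: "{0..1} \<times> {0..1} \<subseteq> (\<Union>k. C k)"
    proof
      fix x :: "real \<times> real" assume "x \<in> {0..1} \<times> {0..1}"
      then obtain i j where ij: "i < n" "j < n" "fst x \<in> I i" "snd x \<in> I j"
        using I[of "fst x"] I[of "snd x"] by (auto simp: mem_Times_iff)
      have "i * n + j < n * n"
      proof -
        have "i * n + j < Suc i * n" using ij by simp
        also have "\<dots> \<le> n * n" using ij by (intro mult_right_mono) auto
        finally show ?thesis .
      qed
      then have "x \<in> C (i * n + j)" using ij by (simp add: C_def mem_Times_iff)
      then show "x \<in> (\<Union>k. C k)" by blast
    qed
    have "C \<in> fine_covers r unit_square"
      using cover C order_trans[OF C(2) n(2)] by (simp add: fine_covers_def)
    then have "hausdorff2_pre r unit_square \<le> (\<Sum>k. disc_weight (C k))"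
      by (rule hausdorff2_pre_le)
    also have "\<dots> = (\<Sum>k<n * n. disc_weight (C k))"
      by (rule suminf_finite) (auto simp: C_def)
    also have "\<dots> \<le> (\<Sum>k<n * n. ennreal (pi / (n * n)))"
    proof (rule sum_mono)
      fix k
      have "(diameter (C k) / 2)\<^sup>2 \<le> (1 / n)\<^sup>2"
        using C(2)[of k] diameter_ge_0[OF C(1)] by (intro power_mono) auto
      then have "pi * (diameter (C k) / 2)\<^sup>2 \<le> pi * (1 / n)\<^sup>2" by (rule mult_left_mono) simp
      then have "pi * (diameter (C k) / 2)\<^sup>2 \<le> pi / (n * n)" by (simp add: power2_eq_square)
      then show "disc_weight (C k) \<le> ennreal (pi / (n * n))" by (rule ennreal_leI)
    qed
    also have "\<dots> = ennreal pi"
      using n by (simp add: ennreal_of_nat_eq_real_of_nat flip: ennreal_mult)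
    finally show ?thesis .
  qed
  then have "hausdorff2_square \<le> ennreal pi"
    unfolding hausdorff2_square_def hausdorff2_def by (intro SUP_least) auto
  then show ?thesis by (simp add: le_less_trans)
qed

text \<open>A set of diameter d lies in a square of side 2 d around any of its points, and 4 d^2 is
  16 / pi times its disc weight. Countable subadditivity of Lebesgue measure then bounds the weight
  of every cover from below.\<close>

lemma hausdorff2_square_pos: "hausdorff2_square > 0"
proof -
  let ?Q = "{0..1} \<times> {0..1} :: (real \<times> real) set"
  have "ennreal (pi / 16) \<le> hausdorff2_pre 1 ?Q"
    unfolding hausdorff2_pre_eq
  proof (rule INF_greatest)
    fix C assume C: "C \<in> fine_covers 1 ?Q"
    then have b: "bounded (C i)" for i by (auto simp: fine_covers_def)
    define d where "d i = diameter (C i)" for i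
    have d0: "d i \<ge> 0" for i unfolding d_def by (rule diameter_ge_0[OF b])
    define J where "J t i = {t - d i..t + d i}" for t :: real and i
    define B where "B i = (if C i = {} then {} else
        let z = (SOME x. x \<in> C i) in J (fst z) i \<times> J (snd z) i)" for i
    have CB: "C i \<subseteq> B i" for i
    proof
      fix x assume x: "x \<in> C i"
      define z where "z = (SOME x. x \<in> C i)"
      have "z \<in> C i" unfolding z_def using x by (rule someI)
      then have "dist x z \<le> d i" unfolding d_def using b x by (intro diameter_bounded_bound) auto
      then have "dist (fst x) (fst z) \<le> d i" "dist (snd x) (snd z) \<le> d i"
        using dist_fst_le[of x z] dist_snd_le[of x z] by auto
      then have "x \<in> J (fst z) i \<times> J (snd z) i"
        by (auto simp: J_def dist_real_def mem_Times_iff abs_le_iff)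
      then show "x \<in> B i" using x by (auto simp: B_def z_def Let_def)
    qed
    have Bm: "B i \<in> sets lborel" for i
      unfolding sets_lborel by (auto simp: B_def J_def Let_def intro!: borel_closed closed_Times)
    have Ble: "emeasure lborel (B i) \<le> ennreal (16 / pi) * disc_weight (C i)" for i
    proof -
      have "emeasure lborel (B i) \<le> ennreal (2 * d i) * ennreal (2 * d i)"
        using d0[of i] unfolding lborel_prod[symmetric]
        by (auto simp: B_def J_def Let_def lborel.emeasure_pair_measure_Times)
      also have "\<dots> = ennreal (16 / pi) * disc_weight (C i)"
        using d0[of i] by (simp add: d_def power2_eq_square flip: ennreal_mult)
      finally show ?thesis .
    qed
    have "?Q \<subseteq> (\<Union>i. B i)" using C CB unfolding fine_covers_def by blast
    then have "emeasure lborel ?Q \<le> emeasure lborel (\<Union>i. B i)"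
      using Bm by (intro emeasure_mono) auto
    also have "\<dots> \<le> (\<Sum>i. emeasure lborel (B i))"
      using Bm by (intro emeasure_subadditive_countably) auto
    also have "\<dots> \<le> (\<Sum>i. ennreal (16 / pi) * disc_weight (C i))"
      by (intro suminf_le Ble) auto
    also have "\<dots> = ennreal (16 / pi) * (\<Sum>i. disc_weight (C i))" by (simp add: ennreal_suminf_cmult)
    finally have "1 \<le> ennreal (16 / pi) * (\<Sum>i. disc_weight (C i))"
      by (simp add: lborel.emeasure_pair_measure_Times flip: lborel_prod)
    then have "ennreal (pi / 16) * 1 \<le> ennreal (pi / 16) * (ennreal (16 / pi) * (\<Sum>i. disc_weight (C i)))"
      by (rule mult_left_mono) auto
    also have "\<dots> = (\<Sum>i. disc_weight (C i))"
      by (simp flip: ennreal_mult mult.assoc)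
    finally show "ennreal (pi / 16) \<le> (\<Sum>i. disc_weight (C i))" by simp
  qed
  also have "\<dots> \<le> hausdorff2_square"
    unfolding hausdorff2_square_def by (rule hausdorff2_pre_le_hausdorff2) simp
  finally show ?thesis
    using pi_gt_zero by (metis ennreal_less_zero_iff divide_pos_pos less_le_trans zero_less_numeral)
qed

text \<open>Uniqueness of translation invariant measures: integrating \<open>indicator A x * indicator Q (x + y)\<close>
  with respect to the two measures in either order gives \<open>\<mu>(A) \<lambda>(Q) = \<lambda>(A) \<mu>(Q)\<close>. No knowledge
  of the constant, hence no isodiametric inequality, is needed.\<close>

lemma hausdorff2_eq_lborel:
  fixes A :: "(real \<times> real) set"
  assumes A [measurable]: "A \<in> sets borel"
  shows "hausdorff2 A = hausdorff2_square * emeasure lborel A"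
proof -
  let ?H = "hausdorff2_measure :: (real \<times> real) measure"
  define Q where "Q = unit_square"
  have Q [measurable]: "Q \<in> sets borel" unfolding Q_def by (intro borel_closed closed_Times) auto
  have HQ: "emeasure ?H ((+) t ` Q) = hausdorff2_square" for t
  proof -
    have "(+) t ` Q \<in> sets borel"
      unfolding Q_def by (intro borel_closed closed_translation closed_Times) auto
    then show ?thesis
      by (simp add: emeasure_hausdorff2_measure hausdorff2_translation) (simp add: hausdorff2_square_def Q_def)
  qed
  \<comment> \<open>Fubini requires sigma-finiteness; the integer translates of the unit square
    provide it.\<close>
  interpret H: sigma_finite_measure ?H
  proof
    let ?\<A> = "range (\<lambda>(i::int, j::int). (+) (real_of_int i, real_of_int j) ` Q)"
    have "x \<in> \<Union>?\<A>" for x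
    proof -
      let ?i = "\<lfloor>fst x\<rfloor>" and ?j = "\<lfloor>snd x\<rfloor>"
      have "(fst x - ?i, snd x - ?j) \<in> Q" by (auto simp: Q_def) linarith+
      moreover have "x = (real_of_int ?i, real_of_int ?j) + (fst x - ?i, snd x - ?j)"
        by (auto simp: prod_eq_iff)
      ultimately have "x \<in> (+) (real_of_int ?i, real_of_int ?j) ` Q" by blast
      then show ?thesis
        by (intro UnionI[where X = "(+) (real_of_int ?i, real_of_int ?j) ` Q"] range_eqI[of _ _ "(?i, ?j)"]) simp_all
    qed
    moreover have "(+) t ` Q \<in> sets borel" for t
      unfolding Q_def by (intro borel_closed closed_translation closed_Times) auto
    ultimately show "\<exists>\<A>. countable \<A> \<and> \<A> \<subseteq> sets ?H \<and> \<Union>\<A> = space ?H \<and> (\<forall>a\<in>\<A>. emeasure ?H a \<noteq> \<infinity>)"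
      using hausdorff2_square_finite
      by (intro exI[of _ ?\<A>]) (auto simp: HQ less_top[symmetric])
  qed
  interpret P: pair_sigma_finite ?H "lborel :: (real \<times> real) measure" ..
  define f where "f x y = indicator A x * (indicator Q (x + y) :: ennreal)" for x y :: "real \<times> real"
  have "(\<integral>\<^sup>+y. \<integral>\<^sup>+x. f x y \<partial>?H \<partial>lborel) = (\<integral>\<^sup>+x. \<integral>\<^sup>+y. f x y \<partial>lborel \<partial>?H)"
    unfolding f_def by (rule P.Fubini') measurable
  also have "\<dots> = (\<integral>\<^sup>+x. indicator A x * 1 \<partial>?H)"
  proof (rule nn_integral_cong)
    fix x :: "real \<times> real"
    have "(\<integral>\<^sup>+y. indicator Q (x + y) \<partial>lborel) = (\<integral>\<^sup>+y. indicator Q y \<partial>(distr lborel borel ((+) x)))"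
      by (subst nn_integral_distr) auto
    also have "\<dots> = emeasure lborel Q" by (simp add: lborel_distr_plus)
    also have "\<dots> = 1"
      by (simp add: Q_def lborel.emeasure_pair_measure_Times flip: lborel_prod)
    finally show "(\<integral>\<^sup>+y. f x y \<partial>lborel) = indicator A x * 1"
      unfolding f_def by (subst nn_integral_cmult) auto
  qed
  also have "\<dots> = hausdorff2 A" by (simp add: emeasure_hausdorff2_measure)
  finally have 1: "(\<integral>\<^sup>+y. \<integral>\<^sup>+x. f x y \<partial>?H \<partial>lborel) = hausdorff2 A" .
  \<comment> \<open>\<open>g x y\<close> is \<open>f (x - y) y\<close>. For fixed \<open>y\<close>
    this shift of \<open>x\<close> does not change the integral with respect to \<open>?H\<close>;
    afterwards the inner \<open>lborel\<close> integral sees a reflected translate of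
    \<open>A\<close>.\<close>
  define g where "g x y = indicator Q x * (indicator A (x - y) :: ennreal)" for x y :: "real \<times> real"
  have fg: "(\<integral>\<^sup>+x. f x y \<partial>?H) = (\<integral>\<^sup>+x. g x y \<partial>?H)" for y
  proof -
    define B where "B = {x. x \<in> A \<and> x + y \<in> Q}"
    have B [measurable]: "B \<in> sets borel" unfolding B_def by measurable
    have B': "(+) y ` B = {x. x \<in> Q \<and> x - y \<in> A}" unfolding B_def
      by (force simp: image_iff algebra_simps)
    have "(+) y ` B \<in> sets borel" unfolding B' by measurable
    then have "(\<integral>\<^sup>+x. indicator ((+) y ` B) x \<partial>?H) = (\<integral>\<^sup>+x. indicator B x \<partial>?H)"
      by (simp add: emeasure_hausdorff2_measure hausdorff2_translation)
    moreover have "f x y = indicator B x" "g x y = indicator ((+) y ` B) x" for x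
      unfolding B' by (auto simp: f_def g_def B_def indicator_def)
    ultimately show ?thesis by simp
  qed
  have "(\<integral>\<^sup>+y. \<integral>\<^sup>+x. g x y \<partial>?H \<partial>lborel) = (\<integral>\<^sup>+x. \<integral>\<^sup>+y. g x y \<partial>lborel \<partial>?H)"
    unfolding g_def by (rule P.Fubini') measurable
  also have "\<dots> = (\<integral>\<^sup>+x. indicator Q x * emeasure lborel A \<partial>?H)"
  proof (rule nn_integral_cong)
    fix x :: "real \<times> real"
    have "lborel = distr lborel borel (\<lambda>y. x - y)"
      using lborel_affine[of "-1" x] by (simp add: density_1)
    then have "emeasure lborel A = (\<integral>\<^sup>+y. indicator A y \<partial>distr lborel borel (\<lambda>y. x - y))" by simp
    also have "\<dots> = (\<integral>\<^sup>+y. indicator A (x - y) \<partial>lborel)" by (rule nn_integral_distr) auto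
    finally have "(\<integral>\<^sup>+y. indicator A (x - y) \<partial>lborel) = emeasure lborel A" by simp
    then show "(\<integral>\<^sup>+y. g x y \<partial>lborel) = indicator Q x * emeasure lborel A"
      unfolding g_def by (subst nn_integral_cmult) auto
  qed
  also have "\<dots> = hausdorff2_square * emeasure lborel A"
    using HQ[of 0] by (simp add: nn_integral_multc)
  finally show ?thesis using 1 by (simp add: fg)
qed

section \<open>Difference quotients of test fields\<close>

text \<open>An approximation of the divergence by forward differences. Integration by parts for it
  is a mere shift of the variable, so the other factor can be any bounded Borel function, such as
  the indicator of a set.\<close>

definition diff_quot :: "(real^3 \<Rightarrow> real^3) \<Rightarrow> real \<Rightarrow> real^3 \<Rightarrow> real" where
  "diff_quot T h x = (\<Sum>i\<in>UNIV. (T (x + h *\<^sub>R axis i 1) $ i - T x $ i) / h)"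

lemma borel_measurable_vec_nth [measurable (raw)]:
  fixes f :: "'a \<Rightarrow> real^'n"
  shows "f \<in> borel_measurable M \<Longrightarrow> (\<lambda>x. f x $ i) \<in> borel_measurable M"
  by (rule measurable_compose[OF _ borel_measurable_continuous_onI]) (auto intro: continuous_intros)

lemma test_field_continuous: "test_field T \<Longrightarrow> continuous_on UNIV T"
  unfolding test_field_def
  by (metis continuous_at_imp_continuous_on differentiable_imp_continuous_within)

lemma test_field_measurable [measurable_dest]: "test_field T \<Longrightarrow> T \<in> borel_measurable borel"
  by (intro borel_measurable_continuous_onI test_field_continuous)

lemma test_field_has_derivative:
  "test_field T \<Longrightarrow> (T has_derivative (\<lambda>h. jacobian T (at x) *v h)) (at x)"
  unfolding test_field_def using jacobian_works[of T "at x"] by blast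

lemma test_field_support:
  assumes "test_field T"
  obtains r where "r > 0" "\<And>x. norm x > r \<Longrightarrow> T x = 0"
proof -
  have "bounded {x. T x \<noteq> 0}"
    using assms unfolding test_field_def by (meson bounded_subset closure_subset compact_imp_bounded)
  then obtain r where "r > 0" "\<And>x. x \<in> {x. T x \<noteq> 0} \<Longrightarrow> norm x \<le> r" by (metis bounded_pos)
  then show ?thesis by (intro that[of r]) force+
qed

text \<open>Continuity gives a bound on a closed ball that contains the support; outside of it the
  field vanishes in a neighbourhood, so the Jacobian is 0.\<close>

lemma test_field_jacobian_bounded:
  assumes T: "test_field T"
  obtains B where "\<And>x i j. \<bar>jacobian T (at x) $ i $ j\<bar> \<le> B"
proof -
  obtain r where r: "r > 0" "\<And>x. norm x > r \<Longrightarrow> T x = 0" using test_field_support[OF T] by blast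
  have "continuous_on UNIV (\<lambda>x. jacobian T (at x))" using T by (simp add: test_field_def)
  then have "continuous_on (cball 0 r) (\<lambda>x. jacobian T (at x))" by (rule continuous_on_subset) simp
  then have "compact ((\<lambda>x. jacobian T (at x)) ` cball 0 r)" by (rule compact_continuous_image) simp
  then have "bounded ((\<lambda>x. jacobian T (at x)) ` cball 0 r)" by (rule compact_imp_bounded)
  then obtain B where B: "\<And>x. x \<in> cball 0 r \<Longrightarrow> norm (jacobian T (at x)) \<le> B"
    unfolding bounded_iff by blast
  have "\<bar>jacobian T (at x) $ i $ j\<bar> \<le> max B 0" for x i j
  proof (cases "norm x \<le> r")
    case True
    have "\<bar>jacobian T (at x) $ i $ j\<bar> \<le> norm (jacobian T (at x) $ i)" by (rule component_le_norm_cart)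
    also have "\<dots> \<le> norm (jacobian T (at x))" by (rule Finite_Cartesian_Product.norm_nth_le)
    finally show ?thesis using B[of x] True by simp
  next
    case False
    have "open {y. norm y > r}"
      by (intro open_Collect_less continuous_intros)
    then have "((\<lambda>_. 0) has_derivative (\<lambda>h. jacobian T (at x) *v h)) (at x)"
      using False r(2) by (intro has_derivative_transform_within_open[OF test_field_has_derivative[OF T]]) auto
    then have "(\<lambda>h. jacobian T (at x) *v h) = (\<lambda>_. 0)"
      using has_derivative_unique[OF _ has_derivative_const] by blast
    then have "jacobian T (at x) *v axis j 1 = 0" by metis
    then have "column j (jacobian T (at x)) = 0" by (simp add: matrix_vector_mult_basis)
    then show ?thesis by (simp add: column_def vec_eq_iff)
  qed
  then show ?thesis by (rule that)
qed

lemma test_field_lipschitz: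
  assumes T: "test_field T"
  obtains L where "L \<ge> 0" "\<And>x y. norm (T x - T y) \<le> L * norm (x - y)"
proof -
  obtain B where B: "\<And>x i j. \<bar>jacobian T (at x) $ i $ j\<bar> \<le> B" using test_field_jacobian_bounded[OF T] by blast
  have B0: "B \<ge> 0" using B[of 0 1 1] by simp
  \<comment> \<open>The operator norm is at most the number 9 of matrix entries times their
    bound.\<close>
  have "norm (T x - T y) \<le> (9 * B) * norm (x - y)" for x y
  proof (rule differentiable_bound[of UNIV T "\<lambda>x h. jacobian T (at x) *v h"])
    show "onorm (\<lambda>h. jacobian T (at x) *v h) \<le> 9 * B" for x
      using onorm_le_matrix_component[of "jacobian T (at x)" B] B by simp
  qed (auto intro: test_field_has_derivative[OF T])
  then show ?thesis using B0 by (intro that[of "9 * B"]) auto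
qed

lemma test_field_bounded:
  assumes T: "test_field T"
  obtains K where "K \<ge> 0" "\<And>x. norm (T x) \<le> K"
proof -
  obtain L where L: "L \<ge> 0" "\<And>x y. norm (T x - T y) \<le> L * norm (x - y)" using test_field_lipschitz[OF T] by blast
  obtain r where r: "r > 0" "\<And>x. norm x > r \<Longrightarrow> T x = 0" using test_field_support[OF T] by blast
  have "norm (T x) \<le> norm (T 0) + L * r" for x
  proof (cases "norm x \<le> r")
    case True
    have "norm (T x) \<le> norm (T 0) + norm (T x - T 0)" by (metis add_diff_cancel_left' diff_add_cancel norm_triangle_ineq)
    also have "\<dots> \<le> norm (T 0) + L * norm x" using L(2)[of x 0] by simp
    also have "\<dots> \<le> norm (T 0) + L * r" using L(1) True by (simp add: mult_left_mono)
    finally show ?thesis .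
  qed (use r L in auto)
  then show ?thesis using that order_trans[OF norm_ge_zero] by blast
qed

lemma continuous_divergence: "test_field T \<Longrightarrow> continuous_on UNIV (divergence T)"
  unfolding test_field_def divergence_def trace_def by (intro continuous_intros) auto

lemma divergence_measurable: "test_field T \<Longrightarrow> divergence T \<in> borel_measurable borel"
  by (intro borel_measurable_continuous_onI continuous_divergence)

lemma diff_quot_tendsto_divergence:
  assumes "test_field T"
  shows "(\<lambda>n. diff_quot T (1 / real (Suc n)) x) \<longlonglongrightarrow> divergence T x"
  unfolding diff_quot_def divergence_def trace_def
proof (rule tendsto_sum)
  fix i
  have "((\<lambda>h. x + h *\<^sub>R axis i 1) has_derivative (\<lambda>h. h *\<^sub>R axis i 1)) (at (0::real))"
    by (auto intro!: derivative_eq_intros)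
  moreover have "(T has_derivative (\<lambda>h. jacobian T (at x) *v h)) (at (x + 0 *\<^sub>R axis i 1))"
    using test_field_has_derivative[OF assms, of x] by simp
  ultimately have "((\<lambda>h. T (x + h *\<^sub>R axis i 1)) has_derivative (\<lambda>h. jacobian T (at x) *v (h *\<^sub>R axis i 1))) (at (0::real))"
    by (rule has_derivative_compose)
  then have "((\<lambda>h. T (x + h *\<^sub>R axis i 1) $ i) has_derivative (\<lambda>h. (jacobian T (at x) *v (h *\<^sub>R axis i 1)) $ i)) (at (0::real))"
    by (rule bounded_linear.has_derivative[OF bounded_linear_vec_nth])
  then have "((\<lambda>h. T (x + h *\<^sub>R axis i 1) $ i) has_field_derivative jacobian T (at x) $ i $ i) (at 0)"
    unfolding has_field_derivative_def
    by (rule has_derivative_eq_rhs) (auto simp: matrix_vector_mult_scaleR matrix_vector_mult_basis column_def)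
  then have "((\<lambda>h. (T (x + h *\<^sub>R axis i 1) $ i - T x $ i) / h) \<longlongrightarrow> jacobian T (at x) $ i $ i) (at 0)"
    by (simp add: DERIV_def)
  moreover have "filterlim (\<lambda>n. 1 / real (Suc n)) (at 0) sequentially"
    using LIMSEQ_Suc[OF lim_1_over_n] by (auto simp: filterlim_at)
  ultimately show "(\<lambda>n. (T (x + (1 / real (Suc n)) *\<^sub>R axis i 1) $ i - T x $ i) / (1 / real (Suc n)))
     \<longlonglongrightarrow> jacobian T (at x) $ i $ i"
    by (rule filterlim_compose)
qed

text \<open>The dominating function for the limit as \<open>h\<close> tends to 0: the Lipschitz
  constant bounds the quotients uniformly, and for \<open>h \<le> 1\<close> the support grows by at
  most 1.\<close>

lemma diff_quot_bounded:
  assumes T: "test_field T"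
  obtains K r where "K \<ge> 0" "\<And>h x. 0 < h \<Longrightarrow> h \<le> 1 \<Longrightarrow> \<bar>diff_quot T h x\<bar> \<le> K * indicator (cball 0 r) x"
proof -
  obtain L where L: "L \<ge> 0" "\<And>x y. norm (T x - T y) \<le> L * norm (x - y)" using test_field_lipschitz[OF T] by blast
  obtain r where r: "r > 0" "\<And>x. norm x > r \<Longrightarrow> T x = 0" using test_field_support[OF T] by blast
  have "\<bar>diff_quot T h x\<bar> \<le> 3 * L * indicator (cball 0 (r + 1)) x" if h: "0 < h" "h \<le> 1" for h x
  proof (cases "norm x \<le> r + 1")
    case True
    have "\<bar>(T (x + h *\<^sub>R axis i 1) $ i - T x $ i) / h\<bar> \<le> L" for i
    proof -
      have "\<bar>T (x + h *\<^sub>R axis i 1) $ i - T x $ i\<bar> \<le> norm (T (x + h *\<^sub>R axis i 1) - T x)"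
        using component_le_norm_cart[of "T (x + h *\<^sub>R axis i 1) - T x" i] by simp
      also have "\<dots> \<le> L * h" using L(2)[of "x + h *\<^sub>R axis i 1" x] h by simp
      finally show ?thesis using h by (simp add: field_simps)
    qed
    then have "\<bar>diff_quot T h x\<bar> \<le> (\<Sum>i\<in>(UNIV :: 3 set). L)"
      unfolding diff_quot_def by (intro order_trans[OF sum_abs] sum_mono) auto
    then show ?thesis using True by simp
  next
    case False
    have "norm (x + h *\<^sub>R axis i 1) > r" for i
      using norm_triangle_ineq2[of x "- (h *\<^sub>R axis i (1::real))"] False h by simp
    then have "diff_quot T h x = 0" unfolding diff_quot_def using r(2) False by simp
    then show ?thesis by (simp add: L)
  qed
  then show ?thesis using L(1) by (intro that[of "3 * L" "r + 1"]) auto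
qed

lemma diff_quot_integral_tendsto:
  assumes T: "test_field T" and u: "u \<in> borel_measurable borel" "\<And>x. \<bar>u x\<bar> \<le> U"
  shows "(\<lambda>n. LBINT x. u x * diff_quot T (1 / real (Suc n)) x) \<longlonglongrightarrow> (LBINT x. u x * divergence T x)"
    and "integrable lborel (\<lambda>x. u x * divergence T x)"
proof -
  obtain K r where K: "K \<ge> 0"
    and le: "\<And>h x. 0 < h \<Longrightarrow> h \<le> 1 \<Longrightarrow> \<bar>diff_quot T h x\<bar> \<le> K * indicator (cball 0 r) x"
    using diff_quot_bounded[OF T] by metis
  have [measurable]: "T \<in> borel_measurable borel" "divergence T \<in> borel_measurable borel"
    using test_field_measurable[OF T] divergence_measurable[OF T] .
  note [measurable] = u(1)
  have U: "U \<ge> 0" using u(2)[of 0] by simp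
  have *: "integrable lborel (\<lambda>x. U * (K * indicator (cball 0 r) x :: real))"
    by (intro integrable_mult_right integrable_real_indicator emeasure_lborel_cball_finite) auto
  have lim: "AE x in lborel. (\<lambda>n. u x * diff_quot T (1 / real (Suc n)) x) \<longlonglongrightarrow> u x * divergence T x"
    by (intro AE_I2 tendsto_mult_left diff_quot_tendsto_divergence T)
  have bd: "AE x in lborel. norm (u x * diff_quot T (1 / real (Suc n)) x) \<le> U * (K * indicator (cball 0 r) x)" for n
    using le[of "1 / real (Suc n)"] u(2) U by (intro AE_I2) (auto simp: abs_mult intro!: mult_mono)
  have m1: "(\<lambda>x. u x * divergence T x) \<in> borel_measurable lborel" by measurable
  have m2: "(\<lambda>x. u x * diff_quot T (1 / real (Suc n)) x) \<in> borel_measurable lborel" for n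
    unfolding diff_quot_def by measurable
  show "(\<lambda>n. LBINT x. u x * diff_quot T (1 / real (Suc n)) x) \<longlonglongrightarrow> (LBINT x. u x * divergence T x)"
    by (rule integral_dominated_convergence[OF m1 m2 * lim bd])
  show "integrable lborel (\<lambda>x. u x * divergence T x)"
    by (rule integrable_dominated_convergence[OF m1 m2 * lim bd])
qed

lemma integrable_bounded_mult_test_field:
  assumes T: "test_field T" and u: "u \<in> borel_measurable borel" "\<And>x. \<bar>u x\<bar> \<le> U"
  shows "integrable lborel (\<lambda>x. u x * T (x + v) $ i)"
proof -
  obtain K where K: "K \<ge> 0" "\<And>x. norm (T x) \<le> K" using test_field_bounded[OF T] by blast
  obtain r where r: "r > 0" "\<And>x. norm x > r \<Longrightarrow> T x = 0" using test_field_support[OF T] by blast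
  have [measurable]: "T \<in> borel_measurable borel" using test_field_measurable[OF T] .
  note [measurable] = u(1)
  have U: "U \<ge> 0" using u(2)[of 0] by simp
  have *: "integrable lborel (\<lambda>x. U * (K * indicator (cball (- v) r) x :: real))"
    by (intro integrable_mult_right integrable_real_indicator emeasure_lborel_cball_finite) auto
  show ?thesis
  proof (rule Bochner_Integration.integrable_bound[OF *])
    have "\<bar>u x * T (x + v) $ i\<bar> \<le> U * (K * indicator (cball (- v) r) x)" for x
    proof (cases "x \<in> cball (- v) r")
      case True
      have "\<bar>T (x + v) $ i\<bar> \<le> K" using component_le_norm_cart[of "T (x + v)" i] K(2)[of "x + v"] by simp
      then show ?thesis using True u(2)[of x] U K by (auto simp: abs_mult intro!: mult_mono)
    next
      case False
      then have "T (x + v) = 0" by (intro r) (simp add: dist_norm norm_minus_commute)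
      then show ?thesis using U K by simp
    qed
    then show "AE x in lborel. norm (u x * T (x + v) $ i) \<le> norm (U * (K * indicator (cball (- v) r) x :: real))"
      by (intro AE_I2) (metis abs_ge_self order_trans real_norm_def)
  qed measurable
qed

text \<open>Discrete integration by parts: translation invariance turns the forward difference of
  \<open>T\<close> into minus the backward difference of \<open>u\<close>.\<close>

lemma integral_mult_diff_quot:
  assumes T: "test_field T" and u: "u \<in> borel_measurable borel" "\<And>x. \<bar>u x\<bar> \<le> U"
  shows "(LBINT x. u x * diff_quot T h x) =
         - (\<Sum>i\<in>UNIV. LBINT x. (u x - u (x - h *\<^sub>R axis i 1)) / h * T x $ i)"
proof -
  note [measurable] = u(1)
  have [measurable]: "T \<in> borel_measurable borel" by (rule test_field_measurable[OF T])
  let ?v = "\<lambda>i. h *\<^sub>R axis i (1::real) :: real^3"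
  have shift: "(LBINT x. u x * T (x + ?v i) $ i) = (LBINT x. u (x - ?v i) * T x $ i)" for i
  proof -
    have m: "(\<lambda>x. u (x - ?v i) * T x $ i) \<in> borel_measurable borel" by measurable
    have "(LBINT x. u (x - ?v i) * T x $ i)
      = (\<integral>x. u (x - ?v i) * T x $ i \<partial>(distr lborel borel ((+) (?v i))))"
      by (simp add: lborel_distr_plus)
    also have "\<dots> = (LBINT x. u x * T (x + ?v i) $ i)"
      by (subst integral_distr) (use m in \<open>auto simp: add.commute\<close>)
    finally show ?thesis by simp
  qed
  have i0: "integrable lborel (\<lambda>x. u x * T (x + v) $ i)" for v i
    by (rule integrable_bounded_mult_test_field[OF T u])
  have i1: "integrable lborel (\<lambda>x. u (x - v) * T x $ i)" for v i
    using integrable_bounded_mult_test_field[OF T, of "\<lambda>x. u (x - v)" U 0 i] u(2) by simp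
  have "(LBINT x. u x * diff_quot T h x)
     = (LBINT x. (\<Sum>i\<in>UNIV. (u x * T (x + ?v i) $ i - u x * T x $ i) / h))"
    by (simp add: diff_quot_def sum_distrib_left algebra_simps)
  also have "\<dots> = (\<Sum>i\<in>UNIV. ((LBINT x. u x * T (x + ?v i) $ i) - (LBINT x. u x * T x $ i)) / h)"
    using i0 i0[where v = 0] by (subst Bochner_Integration.integral_sum) auto
  also have "\<dots> = (\<Sum>i\<in>UNIV. - (LBINT x. (u x - u (x - ?v i)) / h * T x $ i))"
  proof (rule sum.cong[OF refl])
    fix i
    have "(LBINT x. (u x - u (x - ?v i)) / h * T x $ i)
      = (LBINT x. (u x * T x $ i - u (x - ?v i) * T x $ i) / h)"
      by (intro Bochner_Integration.integral_cong) (auto simp: algebra_simps)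
    also have "\<dots> = ((LBINT x. u x * T x $ i) - (LBINT x. u (x - ?v i) * T x $ i)) / h"
      using i0[where v = 0] i1 by simp
    finally show "((LBINT x. u x * T (x + ?v i) $ i) - (LBINT x. u x * T x $ i)) / h
      = - (LBINT x. (u x - u (x - ?v i)) / h * T x $ i)"
      by (simp add: shift diff_divide_distrib)
  qed
  finally show ?thesis by (simp add: sum_negf)
qed

lemma integral_divergence_eq_0:
  assumes T: "test_field T"
  shows "(LBINT x. divergence T x) = 0"
  using LIMSEQ_unique[OF diff_quot_integral_tendsto(1)[OF T, of "\<lambda>_. 1" 1]] 
  integral_mult_diff_quot[OF T, of "\<lambda>_. 1" 1] by simp

lemma set_integral_divergence:
  assumes "test_field T" "E \<in> sets borel"
  shows "set_lebesgue_integral lebesgue E (divergence T) = (LBINT x. indicator E x * divergence T x)"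
  unfolding set_lebesgue_integral_def
  using assms divergence_measurable[OF assms(1)]
  by (subst integral_completion) auto

section \<open>The reduced boundary lies in the topological boundary\<close>

text \<open>A C^1 function that vanishes exactly on a half-line. It yields the cutoffs below and
  later the derivative of \<open>t * \<bar>t\<bar>\<close>.\<close>

lemma DERIV_max_0_power2: "((\<lambda>s::real. (max 0 s)\<^sup>2) has_field_derivative 2 * max 0 s) (at s)"
proof (cases s "0::real" rule: linorder_cases)
  case less
  have "((\<lambda>s::real. 0) has_field_derivative 0) (at s)" by simp
  then have "((\<lambda>s::real. (max 0 s)\<^sup>2) has_field_derivative 0) (at s)"
    by (rule has_field_derivative_transform_within_open[of _ _ _ "{..<0}"]) (use less in auto)
  then show ?thesis using less by simp
next
  case equal
  have "((\<lambda>h::real. (max 0 h)\<^sup>2 / h) \<longlongrightarrow> 0) (at 0)"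
  proof (rule Lim_null_comparison)
    show "\<forall>\<^sub>F h in at 0. norm ((max 0 h)\<^sup>2 / h) \<le> \<bar>h\<bar>"
      by (intro always_eventually) (auto simp: max_def power2_eq_square)
    show "((\<lambda>h::real. \<bar>h\<bar>) \<longlongrightarrow> 0) (at 0)" by (intro tendsto_eq_intros) auto
  qed
  then show ?thesis using equal by (simp add: DERIV_def)
next
  case greater
  have "((\<lambda>s::real. s\<^sup>2) has_field_derivative 2 * s) (at s)"
    by (auto intro!: derivative_eq_intros)
  then have "((\<lambda>s::real. (max 0 s)\<^sup>2) has_field_derivative 2 * s) (at s)"
    by (rule has_field_derivative_transform_within_open[of _ _ _ "{0<..}"]) (use greater in auto)
  then show ?thesis using greater by simp
qed

text \<open>Of class C^1, zero on the nonpositive reals, with values in [0, 1), and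
  \<open>cutoff (n * s)\<close> tends to 1 for every \<open>s > 0\<close>. This is enough to
  approximate indicators of open balls by test fields.\<close>

definition cutoff :: "real \<Rightarrow> real" where
  "cutoff s = (max 0 s)\<^sup>2 / (1 + (max 0 s)\<^sup>2)"

lemma cutoff_nonpos: "s \<le> 0 \<Longrightarrow> cutoff s = 0"
  by (simp add: cutoff_def max_def)

lemma cutoff_le_1: "\<bar>cutoff s\<bar> \<le> 1"
  by (simp add: cutoff_def abs_le_iff divide_le_eq add_pos_nonneg)

lemma DERIV_cutoff:
  "(cutoff has_field_derivative 2 * max 0 s / (1 + (max 0 s)\<^sup>2)\<^sup>2) (at s)"
proof -
  have pos: "1 + (max 0 s)\<^sup>2 \<noteq> 0" for s :: real by (metis add_pos_nonneg less_irrefl zero_le_power2 zero_less_one)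
  have "((\<lambda>s. (max 0 s)\<^sup>2 / (1 + (max 0 s)\<^sup>2)) has_field_derivative
     ((2 * max 0 s) * (1 + (max 0 s)\<^sup>2) - (max 0 s)\<^sup>2 * (0 + 2 * max 0 s)) / ((1 + (max 0 s)\<^sup>2) * (1 + (max 0 s)\<^sup>2))) (at s)"
    by (intro DERIV_divide DERIV_max_0_power2 DERIV_add DERIV_const pos)
  then show ?thesis
    unfolding cutoff_def[abs_def] by (rule DERIV_cong) (simp add: algebra_simps power2_eq_square)
qed

lemma cutoff_tendsto_1:
  assumes "s > 0"
  shows "(\<lambda>n. cutoff (real n * s)) \<longlonglongrightarrow> 1"
proof -
  have "cutoff (real n * s) = 1 - 1 / (1 + (real n * s)\<^sup>2)" for n
    using assms by (simp add: cutoff_def max_def field_simps add_nonneg_eq_0_iff)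
  moreover have "(\<lambda>n. 1 - 1 / (1 + (real n * s)\<^sup>2)) \<longlonglongrightarrow> 1 - 0"
  proof (intro tendsto_diff tendsto_const tendsto_divide_0[OF tendsto_const] filterlim_at_top_imp_at_infinity)
    have "filterlim (\<lambda>n. real n * s) at_top sequentially"
      by (rule filterlim_at_top_mult_tendsto_pos[OF tendsto_const assms filterlim_real_sequentially])
    then show "filterlim (\<lambda>n. 1 + (real n * s)\<^sup>2) at_top sequentially"
      by (intro filterlim_tendsto_add_at_top[OF tendsto_const] filterlim_pow_at_top) auto
  qed
  ultimately show ?thesis by simp
qed

text \<open>The squared distance keeps the composition differentiable at the centre. As
  \<open>n\<close> grows, the fields tend to \<open>u\<close> on the open ball, and they are 0
  outside of it.\<close>

definition ball_field :: "real^3 \<Rightarrow> real \<Rightarrow> real^3 \<Rightarrow> nat \<Rightarrow> real^3 \<Rightarrow> real^3" where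
  "ball_field x \<rho> u n y = cutoff (real n * (\<rho>\<^sup>2 - (y - x) \<bullet> (y - x))) *\<^sub>R u"

lemma ball_field_outside:
  assumes "\<rho> > 0" "y \<notin> ball x \<rho>"
  shows "\<rho>\<^sup>2 - (y - x) \<bullet> (y - x) \<le> 0"
proof -
  have "\<rho>\<^sup>2 \<le> (norm (y - x))\<^sup>2" using assms by (intro power_mono) (auto simp: dist_norm norm_minus_commute)
  then show ?thesis by (simp add: power2_norm_eq_inner)
qed

lemma ball_field:
  fixes x u :: "real^3"
  assumes "\<rho> > 0"
  shows test_field_ball_field: "test_field (ball_field x \<rho> u n)"
    and divergence_ball_field: "y \<notin> ball x \<rho> \<Longrightarrow> divergence (ball_field x \<rho> u n) y = 0"
proof -
  define s where "s y = real n * (\<rho>\<^sup>2 - (y - x) \<bullet> (y - x))" for y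
  define c where "c y = 2 * max 0 (s y) / (1 + (max 0 (s y))\<^sup>2)\<^sup>2" for y
  have der: "(ball_field x \<rho> u n has_derivative (\<lambda>h. (c y * (- 2 * real n * ((y - x) \<bullet> h))) *\<^sub>R u)) (at y)" for y
  proof -
    have "(s has_derivative (\<lambda>h. - 2 * real n * ((y - x) \<bullet> h))) (at y)"
      unfolding s_def by (auto intro!: derivative_eq_intros simp: inner_commute algebra_simps)
    from has_derivative_compose[OF this DERIV_cutoff[of "s y", unfolded has_field_derivative_def]]
    have "((\<lambda>y. cutoff (s y)) has_derivative (\<lambda>h. c y * (- 2 * real n * ((y - x) \<bullet> h)))) (at y)"
      by (simp add: c_def)
    then show ?thesis
      unfolding ball_field_def s_def by (rule has_derivative_scaleR_left)
  qed
  have jac: "jacobian (ball_field x \<rho> u n) (at y) = (\<chi> i j. (c y * (- 2 * real n * ((y - x) $ j))) * u $ i)" for y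
    unfolding jacobian_def frechet_derivative_at[OF der, symmetric]
    by (simp add: matrix_def vec_eq_iff inner_axis)
  have pos: "1 + (max 0 t)\<^sup>2 \<noteq> 0" for t :: real by (metis add_pos_nonneg less_irrefl zero_le_power2 zero_less_one)
  have "continuous_on UNIV c"
    unfolding c_def s_def using pos by (intro continuous_intros ballI) auto
  then have cont: "continuous_on UNIV (\<lambda>y. jacobian (ball_field x \<rho> u n) (at y))"
    unfolding jac by (intro continuous_intros)
  have "{y. ball_field x \<rho> u n y \<noteq> 0} \<subseteq> cball x \<rho>"
  proof
    fix y assume "y \<in> {y. ball_field x \<rho> u n y \<noteq> 0}"
    then have "\<not> real n * (\<rho>\<^sup>2 - (y - x) \<bullet> (y - x)) \<le> 0" using cutoff_nonpos by (auto simp: ball_field_def)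
    then have "\<not> \<rho>\<^sup>2 - (y - x) \<bullet> (y - x) \<le> 0" by (meson mult_nonneg_nonpos of_nat_0_le_iff)
    then have "y \<in> ball x \<rho>" using ball_field_outside[OF assms, of y x] by blast
    then show "y \<in> cball x \<rho>" by simp
  qed
  then have "compact (closure {y. ball_field x \<rho> u n y \<noteq> 0})"
    by (meson bounded_cball bounded_subset compact_closure)
  then show "test_field (ball_field x \<rho> u n)"
    unfolding test_field_def using der cont by (auto simp: differentiable_def)
  show "divergence (ball_field x \<rho> u n) y = 0" if "y \<notin> ball x \<rho>"
  proof -
    have "s y \<le> 0" unfolding s_def using ball_field_outside[OF assms that] by (simp add: mult_nonneg_nonpos)
    then have "c y = 0" by (simp add: c_def)
    then show ?thesis by (simp add: divergence_def trace_def jac)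
  qed
qed

text \<open>Off the frontier, \<open>E\<close> is full or empty in some ball, so fields supported in
  smaller concentric balls have vanishing divergence integral over \<open>E\<close>. Fields that
  tend to the constant \<open>u\<close>, the supposed limit normal, on such a ball then show that
  the Gauss-Green measure of the ball is orthogonal to \<open>u\<close>. Hence the quotients stay at
  distance at least 1 from \<open>u\<close>.\<close>

lemma reduced_boundary_subset_frontier:
  assumes E: "E \<in> sets borel"
  shows "reduced_boundary E \<subseteq> frontier E"
proof
  fix x assume "x \<in> reduced_boundary E"
  then obtain M \<nu> u where gg: "gauss_green E M \<nu>" and M: "\<And>r. r > 0 \<Longrightarrow> measure M (ball x r) > 0"
    and u: "norm u = 1"
    and lim: "((\<lambda>r. set_lebesgue_integral M (ball x r) \<nu> /\<^sub>R measure M (ball x r)) \<longlongrightarrow> u) (at_right 0)"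
    unfolding reduced_boundary_def by blast
  let ?q = "\<lambda>r. set_lebesgue_integral M (ball x r) \<nu> /\<^sub>R measure M (ball x r)"
  show "x \<in> frontier E"
  proof (rule ccontr)
    assume "x \<notin> frontier E"
    then have "x \<in> interior E \<or> x \<in> interior (- E)"
      by (auto simp: frontier_def interior_closure)
    then obtain r where r: "r > 0" "ball x r \<subseteq> E \<or> ball x r \<subseteq> - E" by (meson mem_interior)
    have "\<forall>\<^sub>F \<rho> in at_right 0. dist (?q \<rho>) u < 1"
      using tendstoD[OF lim, of 1] by simp
    moreover have "\<forall>\<^sub>F \<rho> in at_right 0. \<rho> \<in> {0<..<r}"
      using r(1) by (rule eventually_at_right_real)
    ultimately have "\<forall>\<^sub>F \<rho> in at_right (0::real). \<rho> \<in> {0<..<r} \<and>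
        dist (?q \<rho>) u < 1"
      by (rule eventually_conj[rotated])
    from eventually_happens'[OF _ this] obtain \<rho> where \<rho>: "0 < \<rho>" "\<rho> < r"
      and d: "dist (?q \<rho>) u < 1"
      by auto
    interpret finite_measure M using gg by (simp add: gauss_green_def)
    have [measurable_cong]: "sets M = sets borel" using gg by (simp add: gauss_green_def)
    have [measurable]: "\<nu> \<in> borel_measurable M" using gg by (simp add: gauss_green_def)
    have \<nu>1: "AE x in M. norm (\<nu> x) = 1" using gg by (simp add: gauss_green_def)
    have zero: "(\<integral>y. ball_field x \<rho> u n y \<bullet> \<nu> y \<partial>M) = 0" for n
    proof -
      let ?T = "ball_field x \<rho> u n"
      have T: "test_field ?T" by (rule test_field_ball_field[OF \<rho>(1)])
      have "(\<integral>y. ?T y \<bullet> \<nu> y \<partial>M) = set_lebesgue_integral lebesgue E (divergence ?T)"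
        using gg T by (simp add: gauss_green_def)
      also have "\<dots> = (LBINT y. indicator E y * divergence ?T y)"
        by (rule set_integral_divergence[OF T E])
      also have "\<dots> = 0"
      proof -
        have sub: "ball x \<rho> \<subseteq> ball x r" using \<rho> by auto
        from r(2) show ?thesis
        proof
          assume "ball x r \<subseteq> E"
          then have "indicator E y * divergence ?T y = divergence ?T y" for y
            using divergence_ball_field[OF \<rho>(1), of y x u n] sub by (cases "y \<in> ball x \<rho>") (auto simp: indicator_def)
          then have "(\<lambda>y. indicator E y * divergence ?T y) = divergence ?T" by blast
          then show ?thesis using integral_divergence_eq_0[OF T] by simp
        next
          assume "ball x r \<subseteq> - E"
          then have "indicator E y * divergence ?T y = 0" for y
            using divergence_ball_field[OF \<rho>(1), of y x u n] sub by (cases "y \<in> ball x \<rho>") (auto simp: indicator_def)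
          then have "(\<lambda>y. indicator E y * divergence ?T y) = (\<lambda>_. 0)" by blast
          then show ?thesis by simp
        qed
      qed
      finally show ?thesis .
    qed
    \<comment> \<open>Dominated convergence on the finite measure \<open>M\<close> replaces the
      cutoffs by the indicator of the ball.\<close>
    have "(\<lambda>n. \<integral>y. ball_field x \<rho> u n y \<bullet> \<nu> y \<partial>M) \<longlonglongrightarrow> (\<integral>y. indicator (ball x \<rho>) y *\<^sub>R (u \<bullet> \<nu> y) \<partial>M)"
    proof (rule integral_dominated_convergence[where w = "\<lambda>_. 1"])
      show "(\<lambda>y. ball_field x \<rho> u n y \<bullet> \<nu> y) \<in> borel_measurable M" for n
        using test_field_measurable[OF test_field_ball_field[OF \<rho>(1), of x u n]] by measurable
      show "AE y in M. (\<lambda>n. ball_field x \<rho> u n y \<bullet> \<nu> y) \<longlonglongrightarrow> indicator (ball x \<rho>) y *\<^sub>R (u \<bullet> \<nu> y)"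
      proof (intro AE_I2)
        fix y
        show "(\<lambda>n. ball_field x \<rho> u n y \<bullet> \<nu> y) \<longlonglongrightarrow> indicator (ball x \<rho>) y *\<^sub>R (u \<bullet> \<nu> y)"
        proof (cases "y \<in> ball x \<rho>")
          case True
          have "(norm (y - x))\<^sup>2 < \<rho>\<^sup>2" using True \<rho> by (intro power_strict_mono) (auto simp: dist_norm norm_minus_commute)
          then have "\<rho>\<^sup>2 - (y - x) \<bullet> (y - x) > 0" by (simp add: power2_norm_eq_inner)
          from tendsto_mult_right[OF cutoff_tendsto_1[OF this], of "u \<bullet> \<nu> y"] True
          show ?thesis by (simp add: ball_field_def)
        next
          case False
          then have "ball_field x \<rho> u n y = 0" for n
            using ball_field_outside[OF \<rho>(1) False]
            by (simp add: ball_field_def cutoff_nonpos mult_nonneg_nonpos)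
          then show ?thesis using False by simp
        qed
      qed
      show "AE y in M. norm (ball_field x \<rho> u n y \<bullet> \<nu> y) \<le> 1" for n
        using \<nu>1
      proof eventually_elim
        case (elim y)
        have "norm (ball_field x \<rho> u n y) \<le> 1"
          using u cutoff_le_1 by (simp add: ball_field_def)
        then show ?case using Cauchy_Schwarz_ineq2[of "ball_field x \<rho> u n y" "\<nu> y"] elim by simp
      qed
      show "(\<lambda>y. indicator (ball x \<rho>) y *\<^sub>R (u \<bullet> \<nu> y)) \<in> borel_measurable M"
      proof -
        have [measurable]: "ball x \<rho> \<in> sets borel" by simp
        show ?thesis by (intro borel_measurable_scaleR borel_measurable_inner; measurable)
      qed
      show "integrable M (\<lambda>_. 1::real)" by simp
    qed
    then have "(\<integral>y. indicator (ball x \<rho>) y *\<^sub>R (u \<bullet> \<nu> y) \<partial>M) = 0"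
      unfolding zero by (rule LIMSEQ_unique[OF tendsto_const, symmetric])
    moreover have "integrable M (\<lambda>y. indicator (ball x \<rho>) y *\<^sub>R \<nu> y)"
      using \<nu>1 by (intro integrable_const_bound[where B = 1]) (auto simp: indicator_def elim!: eventually_mono)
    then have "u \<bullet> set_lebesgue_integral M (ball x \<rho>) \<nu> = (\<integral>y. indicator (ball x \<rho>) y *\<^sub>R (u \<bullet> \<nu> y) \<partial>M)"
      unfolding set_lebesgue_integral_def by (subst integral_inner_right[symmetric]) auto
    ultimately have "u \<bullet> (?q \<rho>) = 0"
      by simp
    then have "1 = u \<bullet> (u - ?q \<rho>)"
      using u by (simp add: inner_diff_right dot_square_norm)
    also have "\<dots> \<le> norm u * norm (u - ?q \<rho>)"
      by (rule norm_cauchy_schwarz)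
    also have "\<dots> < 1" using u d by (simp add: dist_norm norm_minus_commute)
    finally show False by simp
  qed
qed

section \<open>A criterion for finite perimeter\<close>

text \<open>The translation criterion for finite perimeter: translates depend on \<open>v\<close> in
  a Lipschitz way in L^1. Only one half of the symmetric difference of \<open>E\<close> and its
  translate is measured; the other half comes from \<open>- v\<close>.\<close>

definition lipschitz_shift :: "(real^3) set \<Rightarrow> bool" where
  "lipschitz_shift E \<longleftrightarrow> E \<in> sets borel \<and> bounded E \<and>
     (\<exists>C. \<forall>v. measure lborel {x \<in> E. x + v \<notin> E} \<le> C * norm v)"

lemma lipschitz_shift_set:
  assumes "E \<in> sets borel" "bounded E"
  shows "{x \<in> E. x + v \<notin> E} \<in> sets borel" "emeasure lborel {x \<in> E. x + v \<notin> E} < \<infinity>"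
proof -
  note [measurable] = assms(1)
  show "{x \<in> E. x + v \<notin> E} \<in> sets borel" by measurable
  show "emeasure lborel {x \<in> E. x + v \<notin> E} < \<infinity>"
    using assms(2) by (intro emeasure_bounded_finite) (auto intro: bounded_subset)
qed

text \<open>After discrete integration by parts each coordinate contributes at most the measure of
  the symmetric difference of \<open>E\<close> and its translate, divided by \<open>h\<close>, which
  is at most 2 C. Three coordinates make 6 C, independently of \<open>T\<close>.\<close>

lemma lipschitz_shift_finite_perimeter:
  assumes "lipschitz_shift E"
  shows "finite_perimeter E"
proof -
  obtain C where C: "\<And>v. measure lborel {x \<in> E. x + v \<notin> E} \<le> C * norm v"
    using assms(1) by (auto simp: lipschitz_shift_def)
  have E [measurable]: "E \<in> sets borel" and bE: "bounded E"
    using assms by (auto simp: lipschitz_shift_def)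
  let ?u = "indicator E :: real^3 \<Rightarrow> real"
  have C0: "C \<ge> 0" using order_trans[OF measure_nonneg C[of "axis 1 1"]] by simp
  let ?D = "\<lambda>v. {x \<in> E. x + v \<notin> E}"
  have Dm [measurable]: "?D v \<in> sets borel" for v by (rule lipschitz_shift_set[OF E bE])
  have Df: "emeasure lborel (?D v) < \<infinity>" for v by (rule lipschitz_shift_set[OF E bE])
  have "set_lebesgue_integral lebesgue E (divergence T) \<le> 6 * C"
    if T: "test_field T" and T1: "\<And>x. norm (T x) \<le> 1" for T
  proof -
    have u1: "\<bar>?u x\<bar> \<le> 1" for x by (simp add: indicator_def)
    have bd: "\<bar>LBINT x. (?u x - ?u (x - h *\<^sub>R axis i 1)) / h * T x $ i\<bar> \<le> 2 * C" if h: "h > 0" for h i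
    proof -
      let ?v = "h *\<^sub>R axis i (1::real) :: real^3"
      have int: "integrable lborel (\<lambda>x. indicator (?D (- ?v)) x :: real)" "integrable lborel (\<lambda>x. indicator (?D ?v) (x - ?v) :: real)"
      proof -
        show "integrable lborel (\<lambda>x. indicator (?D (- ?v)) x :: real)"
          using Dm Df[of "- ?v"] by (intro integrable_real_indicator) auto
        have "integrable (distr lborel borel ((+) (- ?v))) (\<lambda>x. indicator (?D ?v) x :: real)"
          unfolding lborel_distr_plus using Dm Df[of ?v] by (intro integrable_real_indicator) auto
        then show "integrable lborel (\<lambda>x. indicator (?D ?v) (x - ?v) :: real)"
          by (subst (asm) integrable_distr_eq) (auto simp: add.commute)
      qed
      have eq: "(LBINT x. indicator (?D ?v) (x - ?v)) = measure lborel (?D ?v)"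
      proof -
        have "measure lborel (?D ?v) = (\<integral>x. indicator (?D ?v) x \<partial>(distr lborel borel ((+) (- ?v))))"
          by (simp add: lborel_distr_plus)
        also have "\<dots> = (LBINT x. indicator (?D ?v) (x - ?v))"
          by (subst integral_distr) (auto simp: add.commute)
        finally show ?thesis by simp
      qed
      have "\<bar>LBINT x. (?u x - ?u (x - ?v)) / h * T x $ i\<bar>
        \<le> (LBINT x. (indicator (?D (- ?v)) x + indicator (?D ?v) (x - ?v)) / h)"
        unfolding real_norm_def[symmetric]
      proof (rule Bochner_Integration.integral_norm_bound_integral)
        show "integrable lborel (\<lambda>x. (?u x - ?u (x - ?v)) / h * T x $ i)"
          using integrable_bounded_mult_test_field[OF T, of "\<lambda>x. (?u x - ?u (x - ?v)) / h" "1 / h" 0 i] h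
          by (simp add: indicator_def divide_right_mono)
        show "integrable lborel (\<lambda>x. (indicator (?D (- ?v)) x + indicator (?D ?v) (x - ?v)) / h :: real)"
          by (intro integrable_divide Bochner_Integration.integrable_add int)
        fix x
        have "\<bar>?u x - ?u (x - ?v)\<bar> \<le> indicator (?D (- ?v)) x + indicator (?D ?v) (x - ?v)"
          by (auto simp: indicator_def)
        moreover have "\<bar>T x $ i\<bar> \<le> 1" using component_le_norm_cart[of "T x" i] T1[of x] by linarith
        ultimately have "\<bar>?u x - ?u (x - ?v)\<bar> * \<bar>T x $ i\<bar> \<le> (indicator (?D (- ?v)) x + indicator (?D ?v) (x - ?v)) * 1"
          by (intro mult_mono) auto
        then show "norm ((?u x - ?u (x - ?v)) / h * T x $ i) \<le> (indicator (?D (- ?v)) x + indicator (?D ?v) (x - ?v)) / h"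
          unfolding real_norm_def abs_mult abs_divide times_divide_eq_left
          using h by (simp only: abs_of_pos mult_1_right) (rule divide_right_mono, auto)
      qed
      also have "\<dots> = (measure lborel (?D (- ?v)) + measure lborel (?D ?v)) / h"
        using int eq by simp
      also have "\<dots> \<le> 2 * C"
        using C[of ?v] C[of "- ?v"] h by (simp add: field_simps)
      finally show ?thesis .
    qed
    have *: "- (LBINT x. (?u x - ?u (x - h *\<^sub>R axis i 1)) / h * T x $ i) \<le> 2 * C" if "h > 0" for h i
      by (rule abs_le_D2[OF bd[OF that]])
    have "(LBINT x. ?u x * diff_quot T (1 / real (Suc n)) x) \<le> (\<Sum>i\<in>(UNIV :: 3 set). 2 * C)" for n
      unfolding integral_mult_diff_quot[OF T borel_measurable_indicator[OF E] u1] sum_negf[symmetric]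
      by (intro sum_mono *) simp
    then have "(LBINT x. ?u x * diff_quot T (1 / real (Suc n)) x) \<le> 6 * C" for n by simp
    then have "(LBINT x. ?u x * divergence T x) \<le> 6 * C"
      by (intro LIMSEQ_le_const2[OF diff_quot_integral_tendsto(1)[OF T borel_measurable_indicator[OF E] u1]]) blast
    then show ?thesis using set_integral_divergence[OF T E] by simp
  qed
  then show ?thesis using E
    unfolding finite_perimeter_def by (auto intro!: bdd_aboveI[of _ "6 * C"])
qed

text \<open>If \<open>E\<close> is star-shaped with respect to all points of a ball of radius \<open>r\<close> around the origin,
  then its translate by \<open>v\<close> lies in the dilate of \<open>E\<close> by the factor \<open>1 + norm v / r\<close>.\<close>

lemma lipschitz_shift_starlike:
  assumes "compact E" "r > 0"
    and star: "\<And>x w t. x \<in> E \<Longrightarrow> norm w \<le> r \<Longrightarrow> 0 \<le> t \<Longrightarrow> t \<le> 1 \<Longrightarrow> (1 - t) *\<^sub>R x + t *\<^sub>R w \<in> E"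
  shows "lipschitz_shift E"
proof -
  have E [measurable]: "E \<in> sets borel" and bE: "bounded E"
    using assms(1) by (auto simp: borel_compact compact_imp_bounded)
  have lE: "E \<in> lmeasurable" using assms(1) by (rule lmeasurable_compact)
  let ?m = "measure lebesgue E"
  have "measure lborel {x \<in> E. x + v \<notin> E} \<le> (7 * ?m / r) * norm v" for v
  proof -
    define e where "e = norm v / r"
    have e0: "e \<ge> 0" using assms(2) by (simp add: e_def)
    let ?D = "{x \<in> E. x + v \<notin> E}"
    have Dm: "?D \<in> sets borel" by (rule lipschitz_shift_set[OF E bE])
    have leb: "measure lborel ?D = measure lebesgue ?D" using Dm by (simp add: measure_completion)
    have DE: "measure lebesgue ?D \<le> ?m"
      using Dm lE by (intro measure_mono_fmeasurable) auto
    have "measure lebesgue ?D \<le> 7 * e * ?m"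
    proof (cases "e \<le> 1")
      case False
      then have "?m \<le> e * ?m" by (intro mult_le_cancel_right1[THEN iffD2]) auto
      moreover have "0 \<le> 6 * e * ?m" using e0 by simp
      ultimately show ?thesis using DE by linarith
    next
      case True
      let ?f = "\<lambda>x. (1 + e) *\<^sub>R x + 0"
      let ?E = "?f ` E"
      have scaled: "x + e *\<^sub>R w \<in> ?E" if "x \<in> E" "norm w \<le> r" for x w
      proof -
        \<comment> \<open>The identity behind the scaling is x + e w = (1 + e) ((1 - t) x + t w) for
          t = e / (1 + e).\<close>
        have "(1 - e / (1 + e)) *\<^sub>R x + (e / (1 + e)) *\<^sub>R w \<in> E"
          using e0 by (intro star that) auto
        moreover have "1 - e / (1 + e) = 1 / (1 + e)" using e0 by (simp add: field_simps)
        then have "?f ((1 - e / (1 + e)) *\<^sub>R x + (e / (1 + e)) *\<^sub>R w) = x + e *\<^sub>R w"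
          using e0 by (simp add: scaleR_add_right)
        ultimately show ?thesis by (metis imageI)
      qed
      have "E \<subseteq> ?E" using scaled[of _ 0] assms(2) by auto
      have shift: "x + v \<in> ?E" if "x \<in> E" for x
        using scaled[OF that, of "(1 / e) *\<^sub>R v"] scaled[OF that, of 0] assms(2)
        by (cases "v = 0") (auto simp: e_def)
      have lE': "?E \<in> lmeasurable"
        using assms(1) by (intro lmeasurable_compact compact_continuous_image continuous_intros)
      have mE': "measure lebesgue ?E = (1 + e) ^ 3 * ?m"
      proof -
        have "measure lebesgue ?E = \<bar>1 + e\<bar> ^ DIM(real^3) * ?m" by (rule measure_lebesgue_affine)
        also have "\<bar>1 + e\<bar> ^ DIM(real^3) = (1 + e) ^ 3" using e0 by simp
        finally show ?thesis .
      qed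
      \<comment> \<open>The shifted points that leave \<open>E\<close> lie in the shell between
        \<open>E\<close> and its dilate. Its volume is (3 e + 3 e^2 + e^3) times that of
        \<open>E\<close>, at most 7 e times for \<open>e \<le> 1\<close>.\<close>
      have "(+) v ` ?D \<subseteq> ?E - E" using shift by (auto simp: add.commute)
      then have "measure lebesgue ((+) v ` ?D) \<le> measure lebesgue (?E - E)"
        using Dm lE lE' by (intro measure_mono_fmeasurable) (auto intro: lebesgue_sets_translation)
      also have "\<dots> = measure lebesgue ?E - ?m"
        using lE lE' \<open>E \<subseteq> ?E\<close> by (intro measurable_measure_Diff) auto
      also have "\<dots> = ((1 + e) ^ 3 - 1) * ?m" unfolding mE' by (simp only: left_diff_distrib mult_1_left)
      also have "\<dots> \<le> (7 * e) * ?m"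
      proof (rule mult_right_mono)
        have "e * e \<le> e" using True e0 by (intro mult_left_le)
        moreover from this have "e * (e * e) \<le> e" using True e0 by (intro mult_left_le) auto
        ultimately show "(1 + e) ^ 3 - 1 \<le> 7 * e" by (simp add: power3_eq_cube algebra_simps)
      qed simp
      finally show ?thesis by (simp add: measure_translation)
    qed
    also have "7 * e * ?m = (7 * ?m / r) * norm v" by (simp add: e_def)
    finally show ?thesis unfolding leb .
  qed
  then have "\<forall>v. measure lborel {x \<in> E. x + v \<notin> E} \<le> (7 * ?m / r) * norm v" by (rule allI)
  then show ?thesis using E bE unfolding lipschitz_shift_def by (intro conjI exI)
qed

section \<open>The Gauss--Green measure of an equidistant polytope\<close>

lemma AE_lborel_not_hyperplane:
  fixes c :: "'a::euclidean_space"
  assumes "c \<noteq> 0"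
  shows "AE x in lborel. c \<bullet> x \<noteq> t"
proof -
  have "{x. c \<bullet> x = t} \<in> null_sets lebesgue"
    using negligible_hyperplane[of c t] assms by (simp add: negligible_iff_null_sets)
  then have "AE x in lebesgue. x \<notin> {x. c \<bullet> x = t}" by (rule AE_not_in)
  then show ?thesis by (simp add: AE_completion_iff)
qed

lemma emeasure_lborel_open_pos:
  fixes U :: "'a::euclidean_space set"
  assumes "open U" "U \<noteq> {}"
  shows "emeasure lborel U > 0"
proof -
  obtain z s where z: "s > 0" "ball z s \<subseteq> U" using assms by (meson ex_in_conv openE)
  have "0 < emeasure lborel (ball z s)"
    using content_ball_pos[OF z(1), of z] emeasure_lborel_ball_finite[of z s]
    by (simp add: emeasure_eq_ennreal_measure less_top[symmetric])
  also have "\<dots> \<le> emeasure lborel U"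
    using z assms(1) by (intro emeasure_mono) auto
  finally show ?thesis .
qed

text \<open>\<open>J\<close> holds outer normals scaled so that the facets lie in
  \<open>a \<bullet> (x - p) = 1\<close>. Their common length \<open>A\<close> puts all facets at
  distance 1 / A from \<open>p\<close>, which makes the area of a facet proportional to the volume
  of the cone over it.\<close>

locale equidistant_polytope =
  fixes J :: "(real^3) set" and p :: "real^3" and A :: real
  assumes fin: "finite J" and ne: "J \<noteq> {}" and A: "A > 0"
    and norm_J: "\<And>a. a \<in> J \<Longrightarrow> norm a = A"
    and bounded_E: "bounded {x. \<forall>a\<in>J. a \<bullet> (x - p) \<le> 1}"
begin

definition E :: "(real^3) set" where "E = {x. \<forall>a\<in>J. a \<bullet> (x - p) \<le> 1}"

text \<open>The Minkowski functional of \<open>E\<close> with respect to \<open>p\<close>.\<close>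

definition pgauge :: "real^3 \<Rightarrow> real" where "pgauge x = Max ((\<lambda>a. a \<bullet> (x - p)) ` J)"

text \<open>Holds on the open cone from \<open>p\<close> over the relative interior of the facet
  with normal \<open>a\<close>. There \<open>grad\<close> is the gradient of \<open>pgauge\<close>;
  on the null set of ties it is 0.\<close>

definition active :: "real^3 \<Rightarrow> real^3 \<Rightarrow> bool" where
  "active a x \<longleftrightarrow> a \<in> J \<and> (\<forall>b\<in>J - {a}. b \<bullet> (x - p) < a \<bullet> (x - p))"

definition grad :: "real^3 \<Rightarrow> real^3" where
  "grad x = (\<Sum>a\<in>J. if active a x then a else 0)"

text \<open>Projection from \<open>p\<close> onto the boundary of \<open>E\<close>; at
  \<open>p\<close> itself division by zero makes the value \<open>p\<close>.\<close>

definition radial :: "real^3 \<Rightarrow> real^3" where "radial x = p + (1 / pgauge x) *\<^sub>R (x - p)"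

lemma gauge_ge: "a \<in> J \<Longrightarrow> a \<bullet> (x - p) \<le> pgauge x"
  using fin by (simp add: pgauge_def)

lemma gauge_attained: obtains a where "a \<in> J" "pgauge x = a \<bullet> (x - p)"
proof -
  have "pgauge x \<in> (\<lambda>a. a \<bullet> (x - p)) ` J"
    unfolding pgauge_def using fin ne by (intro Max_in) auto
  then show ?thesis using that by auto
qed

lemma gauge_le_iff: "pgauge x \<le> t \<longleftrightarrow> (\<forall>a\<in>J. a \<bullet> (x - p) \<le> t)"
  using fin ne by (simp add: pgauge_def)

lemma E_eq: "E = {x. pgauge x \<le> 1}"
  by (simp add: E_def gauge_le_iff)

lemma gauge_active: "active a x \<Longrightarrow> pgauge x = a \<bullet> (x - p)"
proof (rule antisym)
  assume "active a x"
  then show "a \<bullet> (x - p) \<le> pgauge x" by (intro gauge_ge) (simp add: active_def)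
  from \<open>active a x\<close> show "pgauge x \<le> a \<bullet> (x - p)"
    unfolding gauge_le_iff active_def by (metis Diff_iff empty_iff insert_iff less_imp_le order_refl)
qed

lemma grad_active: "active a x \<Longrightarrow> grad x = a"
proof -
  assume a: "active a x"
  then have "\<not> active b x" if "b \<in> J - {a}" for b
    using that unfolding active_def by (metis Diff_iff empty_iff insert_iff less_asym)
  then have "(\<Sum>b\<in>J - {a}. if active b x then b else 0) = 0" by simp
  then show ?thesis unfolding grad_def using a fin by (subst sum.remove[of J a]) (auto simp: active_def)
qed

lemma grad_not_active: "(\<And>a. \<not> active a x) \<Longrightarrow> grad x = 0"
  by (simp add: grad_def)

lemma norm_grad: "norm (grad x) \<le> A"
proof (cases "\<exists>a. active a x")
  case True
  then show ?thesis using grad_active norm_J by (force simp: active_def)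
qed (use A in \<open>simp add: grad_not_active\<close>)

lemma gauge_scale: "s \<ge> 0 \<Longrightarrow> pgauge (p + s *\<^sub>R (x - p)) = s * pgauge x"
proof (rule antisym)
  assume s: "s \<ge> 0"
  show "pgauge (p + s *\<^sub>R (x - p)) \<le> s * pgauge x"
    using s gauge_ge by (simp add: gauge_le_iff mult_left_mono)
  obtain a where "a \<in> J" "pgauge x = a \<bullet> (x - p)" by (rule gauge_attained)
  then show "s * pgauge x \<le> pgauge (p + s *\<^sub>R (x - p))"
    using gauge_ge[of a "p + s *\<^sub>R (x - p)"] by simp
qed

lemma active_scale: "s > 0 \<Longrightarrow> active a (p + s *\<^sub>R (x - p)) \<longleftrightarrow> active a x"
  by (simp add: active_def)

lemma grad_scale: "s > 0 \<Longrightarrow> grad (p + s *\<^sub>R (x - p)) = grad x"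
  by (simp add: grad_def active_scale)

lemma gauge_p: "pgauge p = 0"
  using ne by (simp add: pgauge_def image_constant_conv)

text \<open>If \<open>pgauge\<close> were nonpositive at some \<open>x\<close> other than
  \<open>p\<close>, the whole ray from \<open>p\<close> through \<open>x\<close> would lie in the
  bounded set \<open>E\<close>. Given positivity, scaling \<open>x\<close> onto the boundary bounds
  its distance from \<open>p\<close>.\<close>

lemma norm_le_gauge: obtains R where "R > 0" "\<And>x. norm (x - p) \<le> R * pgauge x"
  and "\<And>x. x \<noteq> p \<Longrightarrow> pgauge x > 0"
proof -
  have "bounded E" using bounded_E by (simp add: E_def)
  then obtain R0 where R0: "\<And>x. x \<in> E \<Longrightarrow> dist p x \<le> R0"
    by (auto simp: bounded_any_center[where a = p])
  have pos: "pgauge x > 0" if "x \<noteq> p" for x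
  proof (rule ccontr)
    assume "\<not> pgauge x > 0"
    then have "p + s *\<^sub>R (x - p) \<in> E" if "s \<ge> 0" for s
      using that by (simp add: E_eq gauge_scale) (smt (verit) mult_nonneg_nonpos)
    from R0[OF this] have "s * norm (x - p) \<le> R0" if "s \<ge> 0" for s
      using that by (simp add: dist_norm)
    from this[of "(\<bar>R0\<bar> + 1) / norm (x - p)"] that show False by simp
  qed
  have "norm (x - p) \<le> (\<bar>R0\<bar> + 1) * pgauge x" for x
  proof (cases "x = p")
    case False
    note g = pos[OF False]
    have "p + (1 / pgauge x) *\<^sub>R (x - p) \<in> E" using g by (simp add: E_eq gauge_scale)
    from R0[OF this] have "norm (x - p) / pgauge x \<le> \<bar>R0\<bar> + 1" using g by (simp add: dist_norm)
    then show ?thesis using g by (simp add: field_simps)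
  qed (simp add: gauge_p)
  then show ?thesis using pos by (intro that[of "\<bar>R0\<bar> + 1"]) auto
qed

lemma gauge_pos: "x \<noteq> p \<Longrightarrow> pgauge x > 0"
  using norm_le_gauge by metis

lemma gauge_lipschitz: "\<bar>pgauge x - pgauge y\<bar> \<le> A * norm (x - y)"
proof -
  have "pgauge x - pgauge y \<le> A * norm (x - y)" for x y
  proof -
    obtain a where a: "a \<in> J" "pgauge x = a \<bullet> (x - p)" by (rule gauge_attained)
    have "pgauge x = a \<bullet> (y - p) + a \<bullet> (x - y)" by (simp add: a inner_diff_right)
    also have "\<dots> \<le> pgauge y + norm a * norm (x - y)"
      by (intro add_mono gauge_ge a norm_cauchy_schwarz)
    finally show ?thesis using norm_J[OF a(1)] by simp
  qed
  from this[of x y] this[of y x] show ?thesis by (simp add: abs_le_iff norm_minus_commute)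
qed

lemma continuous_on_gauge: "continuous_on S pgauge"
proof (rule lipschitz_on_continuous_on)
  show "A-lipschitz_on S pgauge"
    using gauge_lipschitz A by (auto intro!: lipschitz_onI simp: dist_norm)
qed

lemma gauge_measurable [measurable]: "pgauge \<in> borel_measurable borel"
  by (intro borel_measurable_continuous_onI continuous_on_gauge)

lemma open_active: "open {x. active a x}"
proof (cases "a \<in> J")
  case True
  then have "{x. active a x} = (\<Inter>b\<in>J - {a}. {x. b \<bullet> (x - p) < a \<bullet> (x - p)})"
    by (auto simp: active_def)
  also have "open \<dots>"
    using fin by (intro open_INT ballI open_Collect_less continuous_intros) auto
  finally show ?thesis .
qed (simp add: active_def)

lemma grad_measurable [measurable]: "grad \<in> borel_measurable borel"
  unfolding grad_def[abs_def]
proof (rule borel_measurable_sum)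
  fix a
  have [measurable]: "{x. active a x} \<in> sets borel" by (intro borel_open open_active)
  have "(\<lambda>x. if x \<in> {x. active a x} then a else 0) \<in> borel_measurable borel" by measurable
  then show "(\<lambda>x. if active a x then a else 0) \<in> borel_measurable borel" by simp
qed

lemma radial_measurable [measurable]: "radial \<in> borel_measurable borel"
  unfolding radial_def[abs_def] by measurable

lemma E_measurable [measurable]: "E \<in> sets borel"
  unfolding E_eq by measurable

text \<open>A tie between two distinct normals puts \<open>x\<close> on one of finitely many
  hyperplanes.\<close>

lemma AE_active: "AE x in lborel. \<exists>a. active a x"
proof -
  have "AE x in lborel. \<forall>a\<in>J. \<forall>b\<in>J - {a}. (a - b) \<bullet> x \<noteq> (a - b) \<bullet> p"
    using fin by (intro AE_finite_allI finite_Diff AE_lborel_not_hyperplane) auto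
  then show ?thesis
  proof eventually_elim
    case (elim x)
    obtain a where a: "a \<in> J" "pgauge x = a \<bullet> (x - p)" by (rule gauge_attained)
    have "b \<bullet> (x - p) < a \<bullet> (x - p)" if "b \<in> J - {a}" for b
    proof -
      have "b \<bullet> (x - p) \<noteq> a \<bullet> (x - p)" using elim a(1) that by (force simp: inner_diff_left inner_diff_right)
      then show ?thesis using gauge_ge[of b x] that a(2) by auto
    qed
    then show ?case using a(1) by (auto simp: active_def)
  qed
qed

lemma AE_gauge_neq: "AE x in lborel. pgauge x \<noteq> t"
proof -
  have "AE x in lborel. \<forall>a\<in>J. a \<bullet> x \<noteq> t + a \<bullet> p"
    using fin norm_J A by (intro AE_finite_allI AE_lborel_not_hyperplane) force+
  then show ?thesis
  proof eventually_elim
    case (elim x)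
    obtain a where a: "a \<in> J" "pgauge x = a \<bullet> (x - p)" by (rule gauge_attained)
    then show ?case using elim by (force simp: inner_diff_right)
  qed
qed

section \<open>The divergence theorem by ramp approximation\<close>

text \<open>Composed with \<open>pgauge\<close>, this is 1 on \<open>E\<close>, 0 where
  \<open>pgauge\<close> is at least \<open>1 + e\<close>, and linear in between: a Lipschitz
  substitute for the indicator of \<open>E\<close>.\<close>

definition ramp :: "real \<Rightarrow> real \<Rightarrow> real" where
  "ramp e s = max 0 (min 1 (1 + (1 - s) / e))"

lemma ramp_bounds: "\<bar>ramp e s\<bar> \<le> 1"
  by (simp add: ramp_def)

lemma ramp_lipschitz: "e > 0 \<Longrightarrow> \<bar>ramp e s - ramp e t\<bar> \<le> \<bar>s - t\<bar> / e"
proof -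
  assume "e > 0"
  have "\<bar>ramp e s - ramp e t\<bar> \<le> \<bar>(1 - s) / e - (1 - t) / e\<bar>"
    unfolding ramp_def by linarith
  also have "\<dots> = \<bar>s - t\<bar> / e" using \<open>e > 0\<close> by (simp add: abs_minus_commute flip: diff_divide_distrib)
  finally show ?thesis .
qed

definition ramp_grad :: "real \<Rightarrow> real^3 \<Rightarrow> real^3" where
  "ramp_grad e x = - (indicator {x. 1 < pgauge x \<and> pgauge x \<le> 1 + e} x / e) *\<^sub>R grad x"

lemma ramp_grad_measurable [measurable]: "ramp_grad e \<in> borel_measurable borel"
  unfolding ramp_grad_def[abs_def] by measurable

lemma ramp_has_derivative:
  assumes "e > 0" "active a x" "pgauge x \<noteq> 1" "pgauge x \<noteq> 1 + e"
  shows "((\<lambda>y. ramp e (pgauge y)) has_derivative (\<lambda>v. ramp_grad e x \<bullet> v)) (at x)"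
proof -
  have ga: "pgauge x = a \<bullet> (x - p)" "grad x = a" using gauge_active grad_active assms(2) by auto
  consider "pgauge x < 1" | "1 < pgauge x" "pgauge x < 1 + e" | "1 + e < pgauge x"
    using assms(3,4) by linarith
  then show ?thesis
  proof cases
    case 1
    have o: "open {y. pgauge y < 1}" by (intro open_Collect_less continuous_on_gauge continuous_on_const)
    have "((\<lambda>_. 1) has_derivative (\<lambda>v. ramp_grad e x \<bullet> v)) (at x)"
      using 1 by (simp add: ramp_grad_def)
    then show ?thesis
      by (rule has_derivative_transform_within_open[OF _ o]) (use 1 assms(1) in \<open>auto simp: ramp_def\<close>)
  next
    case 2
    have o: "open ({y. active a y} \<inter> {y. 1 < pgauge y} \<inter> {y. pgauge y < 1 + e})"
      by (intro open_Int open_active open_Collect_less continuous_on_gauge continuous_on_const)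
    have "((\<lambda>y. 1 + (1 - a \<bullet> (y - p)) / e) has_derivative (\<lambda>v. ramp_grad e x \<bullet> v)) (at x)"
      using 2 ga assms(1) by (auto simp: ramp_grad_def intro!: derivative_eq_intros)
    then show ?thesis
      by (rule has_derivative_transform_within_open[OF _ o])
        (use 2 assms(1,2) in \<open>auto simp: ramp_def gauge_active field_simps\<close>)
  next
    case 3
    have o: "open {y. 1 + e < pgauge y}" by (intro open_Collect_less continuous_on_gauge continuous_on_const)
    have "((\<lambda>_. 0) has_derivative (\<lambda>v. ramp_grad e x \<bullet> v)) (at x)"
      using 3 by (simp add: ramp_grad_def)
    then show ?thesis
      by (rule has_derivative_transform_within_open[OF _ o]) (use 3 assms(1) in \<open>auto simp: ramp_def field_simps\<close>)
  qed
qed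

text \<open>The difference quotients of the ramp are bounded by \<open>A / e\<close> and converge to
  \<open>ramp_grad\<close> almost everywhere, so discrete integration by parts passes to the limit
  by dominated convergence.\<close>

lemma integral_ramp_divergence:
  assumes T: "test_field T" and e: "e > 0"
  shows "(LBINT x. ramp e (pgauge x) * divergence T x) =
         - (LBINT x. ramp_grad e x \<bullet> T x)"
    and "integrable lborel (\<lambda>x. ramp_grad e x \<bullet> T x)"
proof -
  let ?u = "\<lambda>x. ramp e (pgauge x)"
  have [measurable]: "T \<in> borel_measurable borel" by (rule test_field_measurable[OF T])
  have u [measurable]: "?u \<in> borel_measurable borel" unfolding ramp_def by measurable
  have u1: "\<bar>?u x\<bar> \<le> 1" for x by (rule ramp_bounds)
  let ?h = "\<lambda>n. 1 / real (Suc n)"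
  let ?q = "\<lambda>n i x. (?u x - ?u (x - ?h n *\<^sub>R axis i 1)) / ?h n"
  have lip: "\<bar>?q n i x\<bar> \<le> A / e" for n i x
  proof -
    let ?y = "x - ?h n *\<^sub>R axis i (1::real)"
    have "\<bar>?u x - ?u ?y\<bar> \<le> \<bar>pgauge x - pgauge ?y\<bar> / e" by (rule ramp_lipschitz[OF e])
    also have "\<dots> \<le> (A * norm (x - ?y)) / e" using e by (intro divide_right_mono gauge_lipschitz) auto
    also have "\<dots> = A / e * ?h n" by simp
    finally have "\<bar>?u x - ?u ?y\<bar> / ?h n \<le> A / e" by (subst pos_divide_le_eq) auto
    then show ?thesis by (simp only: abs_divide abs_of_nonneg[of "?h n"])
  qed
  have lim: "AE x in lborel. \<forall>i. (\<lambda>n. ?q n i x) \<longlonglongrightarrow> ramp_grad e x $ i"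
    using AE_active AE_gauge_neq[of 1] AE_gauge_neq[of "1 + e"]
  proof eventually_elim
    case (elim x)
    then obtain a where "active a x" by blast
    note der = ramp_has_derivative[OF e this elim(2,3)]
    show ?case
    proof
      fix i
      have "((\<lambda>h. x + h *\<^sub>R axis i 1) has_derivative (\<lambda>h. h *\<^sub>R axis i 1)) (at (0::real))"
        by (auto intro!: derivative_eq_intros)
      moreover have "(?u has_derivative (\<lambda>v. ramp_grad e x \<bullet> v)) (at (x + 0 *\<^sub>R axis i 1))"
        using der by simp
      ultimately have "((\<lambda>h. ?u (x + h *\<^sub>R axis i 1)) has_derivative (\<lambda>h. ramp_grad e x \<bullet> (h *\<^sub>R axis i 1))) (at (0::real))"
        by (rule has_derivative_compose)
      then have "((\<lambda>h. ?u (x + h *\<^sub>R axis i 1)) has_field_derivative ramp_grad e x $ i) (at 0)"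
        unfolding has_field_derivative_def
        by (rule has_derivative_eq_rhs) (auto simp: inner_axis)
      then have "((\<lambda>h. (?u (x + h *\<^sub>R axis i 1) - ?u x) / h) \<longlongrightarrow> ramp_grad e x $ i) (at 0)"
        by (simp add: DERIV_def)
      \<comment> \<open>The increments are negative because the discrete formula contains backward
        differences of the ramp.\<close>
      moreover have "filterlim (\<lambda>n. - ?h n) (at 0) sequentially"
        using tendsto_minus[OF LIMSEQ_Suc[OF lim_1_over_n]] by (auto simp: filterlim_at)
      ultimately have "(\<lambda>n. (?u (x + (- ?h n) *\<^sub>R axis i 1) - ?u x) / (- ?h n)) \<longlonglongrightarrow> ramp_grad e x $ i"
        by (rule filterlim_compose)
      moreover have "(?u (x + (- ?h n) *\<^sub>R axis i 1) - ?u x) / (- ?h n) = ?q n i x" for n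
        by (simp add: algebra_simps)
      ultimately show "(\<lambda>n. ?q n i x) \<longlonglongrightarrow> ramp_grad e x $ i" by simp
    qed
  qed
  have Ti: "integrable lborel (\<lambda>x. T x $ i)" for i
    using integrable_bounded_mult_test_field[OF T, of "\<lambda>_. 1" 1 0 i] by simp
  have dom: "integrable lborel (\<lambda>x. A / e * \<bar>T x $ i\<bar>)" for i
    using Ti by simp
  have bd: "AE x in lborel. norm (?q n i x * T x $ i) \<le> A / e * \<bar>T x $ i\<bar>" for n i
    unfolding real_norm_def abs_mult[of "?q n i _"] by (intro AE_I2 mult_right_mono lip) simp
  have lim': "AE x in lborel. (\<lambda>n. ?q n i x * T x $ i) \<longlonglongrightarrow> ramp_grad e x $ i * T x $ i" for i
    using lim by eventually_elim (auto intro: tendsto_mult_right)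
  have m1: "(\<lambda>x. ramp_grad e x $ i * T x $ i) \<in> borel_measurable lborel" for i by measurable
  have m2: "(\<lambda>x. ?q n i x * T x $ i) \<in> borel_measurable lborel" for i n by measurable
  have conv: "(\<lambda>n. LBINT x. ?q n i x * T x $ i) \<longlonglongrightarrow> (LBINT x. ramp_grad e x $ i * T x $ i)" for i
    by (rule integral_dominated_convergence[OF m1 m2 dom lim' bd])
  have int: "integrable lborel (\<lambda>x. ramp_grad e x $ i * T x $ i)" for i
    by (rule integrable_dominated_convergence[OF m1 m2 dom lim' bd])
  have "(\<lambda>n. - (\<Sum>i\<in>UNIV. LBINT x. ?q n i x * T x $ i)) \<longlonglongrightarrow> - (\<Sum>i\<in>UNIV. LBINT x. ramp_grad e x $ i * T x $ i)"
    by (intro tendsto_minus tendsto_sum conv)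
  moreover have "(\<lambda>n. - (\<Sum>i\<in>UNIV. LBINT x. ?q n i x * T x $ i)) \<longlonglongrightarrow> (LBINT x. ?u x * divergence T x)"
    using diff_quot_integral_tendsto(1)[OF T u u1] unfolding integral_mult_diff_quot[OF T u u1] .
  ultimately have "(LBINT x. ?u x * divergence T x) = - (\<Sum>i\<in>UNIV. LBINT x. ramp_grad e x $ i * T x $ i)"
    by (intro LIMSEQ_unique)
  also have "(\<Sum>i\<in>UNIV. LBINT x. ramp_grad e x $ i * T x $ i) = (LBINT x. ramp_grad e x \<bullet> T x)"
    using int by (simp add: inner_vec_def)
  finally show "(LBINT x. ?u x * divergence T x) = - (LBINT x. ramp_grad e x \<bullet> T x)" .
  show "integrable lborel (\<lambda>x. ramp_grad e x \<bullet> T x)"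
    using int by (simp add: inner_vec_def)
qed

text \<open>On the boundary this is \<open>A\<close> times the flux density of \<open>T\<close>; it
  is extended to be constant along rays from \<open>p\<close>.\<close>

definition homog :: "(real^3 \<Rightarrow> real^3) \<Rightarrow> real^3 \<Rightarrow> real" where
  "homog T x = T (radial x) \<bullet> grad x"

lemma bounded_sublevel: "bounded {x. pgauge x \<le> t}"
proof -
  obtain R where R: "R > 0" "\<And>x. norm (x - p) \<le> R * pgauge x" using norm_le_gauge by metis
  have "{x. pgauge x \<le> t} \<subseteq> cball p (R * t)"
  proof
    fix x assume "x \<in> {x. pgauge x \<le> t}"
    then have "R * pgauge x \<le> R * t" using R(1) by simp
    then show "x \<in> cball p (R * t)" using R(2)[of x] by (simp add: dist_norm norm_minus_commute)
  qed
  then show ?thesis by (rule bounded_subset[OF bounded_cball])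
qed

lemma sublevel_finite: "emeasure lborel {x. pgauge x \<le> t} < \<infinity>"
  by (rule emeasure_bounded_finite[OF bounded_sublevel])

lemma sublevel_measurable [measurable]: "{x. pgauge x \<le> t} \<in> sets borel"
  by measurable

lemma homog_measurable:
  assumes "test_field T"
  shows "homog T \<in> borel_measurable borel"
proof -
  have [measurable]: "T \<in> borel_measurable borel" by (rule test_field_measurable[OF assms])
  show ?thesis unfolding homog_def[abs_def] by measurable
qed

lemma homog_bounded:
  assumes "test_field T"
  obtains K where "K \<ge> 0" "\<And>x. \<bar>homog T x\<bar> \<le> K"
proof -
  obtain K where K: "K \<ge> 0" "\<And>x. norm (T x) \<le> K" using test_field_bounded[OF assms] by blast
  have "\<bar>homog T x\<bar> \<le> K * A" for x
    unfolding homog_def by (rule order_trans[OF Cauchy_Schwarz_ineq2 mult_mono]) (use K norm_grad in auto)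
  then show ?thesis using K A by (intro that[of "K * A"]) auto
qed

lemma radial_scale: "s > 0 \<Longrightarrow> radial (p + s *\<^sub>R (x - p)) = radial x"
  by (simp add: radial_def gauge_scale)

lemma homog_scale: "s > 0 \<Longrightarrow> homog T (p + s *\<^sub>R (x - p)) = homog T x"
  by (simp add: homog_def radial_scale grad_scale)

lemma integrable_sublevel_homog:
  assumes "test_field T"
  shows "integrable lborel (\<lambda>x. indicator {x. pgauge x \<le> t} x * homog T x)"
proof -
  obtain K where K: "K \<ge> 0" "\<And>x. \<bar>homog T x\<bar> \<le> K" using homog_bounded[OF assms] by blast
  have [measurable]: "homog T \<in> borel_measurable borel" by (rule homog_measurable[OF assms])
  have "integrable lborel (\<lambda>x. indicator {x. pgauge x \<le> t} x * K)"
    using sublevel_finite by (intro integrable_mult_left integrable_real_indicator) auto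
  then show ?thesis
    by (rule Bochner_Integration.integrable_bound) (use K in \<open>auto simp: indicator_def\<close>)
qed

text \<open>Dilation by \<open>s\<close> about \<open>p\<close> maps \<open>E\<close> onto the
  sublevel set with Jacobian s^3 and leaves \<open>f\<close> unchanged.\<close>

lemma integral_sublevel_scale:
  fixes f :: "real^3 \<Rightarrow> real"
  assumes [measurable]: "f \<in> borel_measurable borel" and f: "\<And>x. f (p + s *\<^sub>R (x - p)) = f x" and s: "s > 0"
  shows "(LBINT x. indicator {x. pgauge x \<le> s} x * f x) = s ^ 3 * (LBINT x. indicator E x * f x)"
proof -
  let ?F = "\<lambda>x. indicator {x. pgauge x \<le> s} x * f x :: real"
  have [measurable]: "?F \<in> borel_measurable borel" by measurable
  have *: "(p - s *\<^sub>R p) + s *\<^sub>R x = p + s *\<^sub>R (x - p)" for x by (simp add: algebra_simps)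
  have "integral\<^sup>L lborel ?F = (\<integral>x. s ^ 3 *\<^sub>R ?F x \<partial>distr lborel borel (\<lambda>x. (p - s *\<^sub>R p) + s *\<^sub>R x))"
    using s by (subst lborel_affine[of s "p - s *\<^sub>R p"]) (simp_all add: integral_density)
  also have "\<dots> = (LBINT x. s ^ 3 *\<^sub>R ?F ((p - s *\<^sub>R p) + s *\<^sub>R x))"
    by (rule integral_distr) auto
  also have "\<dots> = (LBINT x. s ^ 3 * (indicator E x * f x))"
    unfolding * using s by (intro Bochner_Integration.integral_cong refl) (auto simp: f E_eq indicator_def gauge_scale)
  finally show ?thesis by simp
qed

text \<open>The ramps turn the left side into integrals of \<open>T \<bullet> grad\<close> over thin
  shells, divided by the thickness e. Replacing \<open>T x\<close> by \<open>T (radial x)\<close>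
  changes the integrand by a bounded amount even after this division, so the error vanishes with the
  volume of the shell. What remains is constant along rays, and its shell integral is ((1 + e)^3 -
  1) times its integral over \<open>E\<close>; division by e gives 3 in the limit.\<close>

lemma divergence_theorem:
  assumes T: "test_field T"
  shows "(LBINT x. indicator E x * divergence T x) = 3 * (LBINT x. indicator E x * homog T x)"
proof -
  define e where "e n = 1 / real (Suc n)" for n
  have e: "e n > 0" "e n \<le> 1" for n by (auto simp: e_def)
  have e0: "e \<longlonglongrightarrow> 0" unfolding e_def using LIMSEQ_Suc[OF lim_1_over_n] by simp
  note [measurable] = homog_measurable[OF T] divergence_measurable[OF T]
  have [measurable]: "T \<in> borel_measurable borel" by (rule test_field_measurable[OF T])
  obtain R where R: "R > 0" "\<And>x. norm (x - p) \<le> R * pgauge x" using norm_le_gauge by metis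
  obtain L where L: "L \<ge> 0" "\<And>x y. norm (T x - T y) \<le> L * norm (x - y)"
    using test_field_lipschitz[OF T] by blast
  define S where "S n = {x. 1 < pgauge x \<and> pgauge x \<le> 1 + e n}" for n
  have Sm [measurable]: "S n \<in> sets borel" for n unfolding S_def by measurable
  have S_ind: "indicator (S n) x = indicator {x. pgauge x \<le> 1 + e n} x - (indicator E x :: real)" for n x
    using e(1)[of n] by (auto simp: S_def E_eq indicator_def)
  define m where "m = measure lborel E"
  define I where "I = (LBINT x. indicator E x * homog T x)"
  \<comment> \<open>Shell integral relative to the integral over \<open>E\<close>, per unit of
    thickness; the limit 3 is the derivative of s^3 at 1.\<close>
  define k where "k n = ((1 + e n) ^ 3 - 1) / e n" for n
  have k: "k n = 3 + 3 * e n + (e n)\<^sup>2" for n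
    using e(1)[of n] by (simp add: k_def field_simps power2_eq_square power3_eq_cube)
  have k3: "k \<longlonglongrightarrow> 3"
    unfolding k[abs_def] by (auto intro!: tendsto_eq_intros e0)
  have LHS: "(\<lambda>n. LBINT x. ramp (e n) (pgauge x) * divergence T x) \<longlonglongrightarrow> (LBINT x. indicator E x * divergence T x)"
  proof (rule integral_dominated_convergence)
    show "integrable lborel (\<lambda>x. \<bar>divergence T x\<bar>)"
      using diff_quot_integral_tendsto(2)[OF T, of "\<lambda>_. 1" 1] by simp
    show "AE x in lborel. norm (ramp (e n) (pgauge x) * divergence T x) \<le> \<bar>divergence T x\<bar>" for n
      using ramp_bounds by (intro AE_I2) (auto simp: abs_mult intro!: mult_left_le_one_le)
    show "AE x in lborel. (\<lambda>n. ramp (e n) (pgauge x) * divergence T x) \<longlonglongrightarrow> indicator E x * divergence T x"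
    proof (intro AE_I2 tendsto_mult_right)
      fix x
      show "(\<lambda>n. ramp (e n) (pgauge x)) \<longlonglongrightarrow> indicator E x"
      proof (cases "pgauge x \<le> 1")
        case True
        then have "ramp (e n) (pgauge x) = 1" for n using e(1)[of n] by (simp add: ramp_def)
        then show ?thesis using True by (simp add: E_eq)
      next
        case False
        then have "\<forall>\<^sub>F n in sequentially. e n < pgauge x - 1"
          using order_tendstoD(2)[OF e0, of "pgauge x - 1"] by simp
        then have "\<forall>\<^sub>F n in sequentially. ramp (e n) (pgauge x) = 0"
        proof eventually_elim
          case (elim n)
          then show ?case using e(1)[of n] by (simp add: ramp_def field_simps max_def min_def)
        qed
        then show ?thesis using False by (simp add: E_eq tendsto_eventually)
      qed
    qed
    show "(\<lambda>x. indicator E x * divergence T x) \<in> borel_measurable lborel" by measurable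
    show "(\<lambda>x. ramp (e n) (pgauge x) * divergence T x) \<in> borel_measurable lborel" for n
      unfolding ramp_def by measurable
  qed
  have Sint: "integrable lborel (\<lambda>x. indicator (S n) x * homog T x)"
    and Sint_eq: "(LBINT x. indicator (S n) x * homog T x) = ((1 + e n) ^ 3 - 1) * I" for n
  proof -
    have i: "integrable lborel (\<lambda>x. indicator {x. pgauge x \<le> 1 + e n} x * homog T x)" "integrable lborel (\<lambda>x. indicator E x * homog T x)"
      using integrable_sublevel_homog[OF T, of "1 + e n"] integrable_sublevel_homog[OF T, of 1] by (simp_all add: E_eq)
    show "integrable lborel (\<lambda>x. indicator (S n) x * homog T x)"
      unfolding S_ind left_diff_distrib using i by (rule Bochner_Integration.integrable_diff)
    have "(LBINT x. indicator {x. pgauge x \<le> 1 + e n} x * homog T x) = (1 + e n) ^ 3 * I"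
      unfolding I_def using e(1)[of n] by (intro integral_sublevel_scale homog_scale homog_measurable T) auto
    then show "(LBINT x. indicator (S n) x * homog T x) = ((1 + e n) ^ 3 - 1) * I"
      unfolding S_ind left_diff_distrib using i by (subst Bochner_Integration.integral_diff) (auto simp: I_def)
  qed
  have Sm_eq: "measure lborel (S n) = ((1 + e n) ^ 3 - 1) * m" for n
  proof -
    have i: "integrable lborel (indicator {x. pgauge x \<le> t} :: _ \<Rightarrow> real)" for t
      using sublevel_finite by (intro integrable_real_indicator) auto
    have "(LBINT x. indicator {x. pgauge x \<le> 1 + e n} x * 1) = (1 + e n) ^ 3 * (LBINT x. indicator E x * 1)"
      using e(1)[of n] by (intro integral_sublevel_scale) auto
    then have "measure lborel {x. pgauge x \<le> 1 + e n} = (1 + e n) ^ 3 * m" by (simp add: m_def)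
    moreover have "measure lborel (S n) = (LBINT x. indicator {x. pgauge x \<le> 1 + e n} x - indicator E x)"
      unfolding S_ind[symmetric] by simp
    ultimately show ?thesis
      using i[of "1 + e n"] i[of 1] by (simp add: E_eq[symmetric] left_diff_distrib m_def)
  qed
  have Sfin: "emeasure lborel (S n) < \<infinity>" for n
    by (rule le_less_trans[OF emeasure_mono sublevel_finite[of "1 + e n"]]) (auto simp: S_def)
  have term_eq: "- ramp_grad (e n) x \<bullet> T x = (indicator (S n) x / e n) * (T x \<bullet> grad x)" for n x
    by (simp add: ramp_grad_def S_def inner_commute)
  let ?g = "\<lambda>n x. ramp_grad (e n) x \<bullet> T x" and ?h = "\<lambda>n x. (indicator (S n) x * homog T x) / e n"
  \<comment> \<open>On the shell \<open>x\<close> is within \<open>R * e n\<close> of its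
    projection, so the Lipschitz bound on \<open>T\<close> absorbs the division by
    \<open>e n\<close>.\<close>
  have near: "\<bar>- (?g n x) - ?h n x\<bar> \<le> L * R * A * indicator (S n) x" for n x
  proof (cases "x \<in> S n")
    case True
    then have g: "1 < pgauge x" "pgauge x \<le> 1 + e n" by (auto simp: S_def)
    have "x - radial x = (1 - 1 / pgauge x) *\<^sub>R (x - p)" by (simp add: radial_def algebra_simps)
    then have "norm (x - radial x) = (1 - 1 / pgauge x) * norm (x - p)" using g by simp
    also have "\<dots> \<le> (1 - 1 / pgauge x) * (R * pgauge x)" using g by (intro mult_left_mono R) auto
    also have "\<dots> = R * (pgauge x - 1)" using g by (simp add: field_simps)
    also have "\<dots> \<le> R * e n" using g R by simp
    finally have "norm (T x - T (radial x)) \<le> L * (R * e n)"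
      using L by (meson mult_left_mono order_trans)
    then have "\<bar>(T x - T (radial x)) \<bullet> grad x\<bar> \<le> (L * (R * e n)) * A"
      by (intro order_trans[OF Cauchy_Schwarz_ineq2] mult_mono norm_grad) (use L R e(1)[of n] in auto)
    then have "\<bar>(T x - T (radial x)) \<bullet> grad x\<bar> / e n \<le> L * R * A"
      using e(1)[of n] by (simp add: field_simps)
    moreover have "- (?g n x) - ?h n x = ((T x - T (radial x)) \<bullet> grad x) / e n"
      using term_eq[of n x] True by (simp add: homog_def inner_diff_left diff_divide_distrib)
    ultimately show ?thesis using True e(1)[of n] by (simp add: abs_divide)
  next
    case False
    then show ?thesis using term_eq[of n x] by simp
  qed
  have diff: "\<bar>- integral\<^sup>L lborel (?g n) - k n * I\<bar> \<le> L * R * A * m * (k n * e n)" for n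
  proof -
    have i1: "integrable lborel (?g n)" by (rule integral_ramp_divergence(2)[OF T e(1)])
    have i2: "integrable lborel (?h n)"
      using Sint[of n] by simp
    have "k n * I = integral\<^sup>L lborel (?h n)"
      using Sint_eq[of n] by (simp add: k_def)
    then have "- integral\<^sup>L lborel (?g n) - k n * I
      = (LBINT x. - (?g n x) - ?h n x)"
      using i1 i2 by simp
    also have "norm \<dots> \<le> (LBINT x. L * R * A * indicator (S n) x)"
    proof (rule Bochner_Integration.integral_norm_bound_integral)
      show "integrable lborel (\<lambda>x. - (?g n x) - ?h n x)"
        using i1 i2 by simp
      show "integrable lborel (\<lambda>x. L * R * A * indicator (S n) x :: real)"
        using Sfin[of n] by (intro integrable_mult_right integrable_real_indicator) auto
      show "norm (- (?g n x) - ?h n x) \<le> L * R * A * indicator (S n) x" for x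
        unfolding real_norm_def by (rule near)
    qed
    also have "\<dots> = L * R * A * m * (k n * e n)" using e(1)[of n] by (simp add: Sm_eq k_def)
    finally show ?thesis by simp
  qed
  have "(\<lambda>n. - integral\<^sup>L lborel (?g n) - k n * I) \<longlonglongrightarrow> 0"
  proof (rule Lim_null_comparison)
    show "\<forall>\<^sub>F n in sequentially. norm (- integral\<^sup>L lborel (?g n) - k n * I) \<le> L * R * A * m * (k n * e n)"
      using diff by simp
    show "(\<lambda>n. L * R * A * m * (k n * e n)) \<longlonglongrightarrow> 0"
      by (auto intro!: tendsto_eq_intros k3 e0)
  qed
  from tendsto_add[OF this tendsto_mult_right[OF k3, of I]]
  have "(\<lambda>n. - integral\<^sup>L lborel (?g n)) \<longlonglongrightarrow> 3 * I" by simp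
  then show ?thesis
    using LHS unfolding integral_ramp_divergence(1)[OF T e(1)] I_def by (rule LIMSEQ_unique[rotated])
qed

section \<open>Surface measure and reduced boundary\<close>

text \<open>The cone from \<open>p\<close> over a piece of a facet with area \<alpha> has height 1 /
  A, hence volume \<alpha> / (3 A). So 3 A times Lebesgue measure on \<open>E\<close>, projected to
  the boundary, is surface area.\<close>

definition surface :: "(real^3) measure" where
  "surface = distr (density lborel (\<lambda>x. ennreal (3 * A) * indicator E x)) borel radial"

definition normal :: "real^3 \<Rightarrow> real^3" where "normal x = (1 / A) *\<^sub>R grad x"

lemma sets_surface [simp, measurable_cong]: "sets surface = sets borel"
  by (simp add: surface_def)

lemma grad_radial: "grad (radial x) = grad x"
proof (cases "x = p")
  case False
  then show ?thesis using gauge_pos unfolding radial_def by (intro grad_scale) simp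
qed (simp add: radial_def)

lemma normal_measurable [measurable]: "normal \<in> borel_measurable borel"
  unfolding normal_def[abs_def] by measurable

lemma emeasure_surface:
  assumes [measurable]: "B \<in> sets borel"
  shows "emeasure surface B = ennreal (3 * A) * emeasure lborel (E \<inter> radial -` B)"
proof -
  have "radial -` B \<in> sets borel" using measurable_sets[OF radial_measurable assms] by simp
  moreover have "indicator E x * indicator (radial -` B) x = (indicator (E \<inter> radial -` B) x :: ennreal)" for x
    by (simp add: indicator_inter_arith)
  ultimately show ?thesis
    unfolding surface_def
    by (simp add: emeasure_distr emeasure_density mult.assoc nn_integral_cmult)
qed

lemma finite_surface: "finite_measure surface"
proof
  have "emeasure lborel E < \<infinity>" using sublevel_finite[of 1] by (simp add: E_eq)
  then show "emeasure surface (space surface) \<noteq> \<infinity>"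
    by (simp add: emeasure_surface surface_def[THEN arg_cong[where f = space]] ennreal_mult_eq_top_iff less_top)
qed

lemma gauss_green_surface: "gauss_green E surface normal"
proof -
  have AE1: "AE x in surface. norm (normal x) = 1"
    unfolding surface_def
  proof (subst AE_distr_iff)
    show "AE x in density lborel (\<lambda>x. ennreal (3 * A) * indicator E x). norm (normal (radial x)) = 1"
    proof (subst AE_density)
      show "AE x in lborel. 0 < ennreal (3 * A) * indicator E x \<longrightarrow> norm (normal (radial x)) = 1"
        using AE_active
      proof eventually_elim
        case (elim x)
        then obtain a where a: "active a x" by blast
        then have "norm (grad x) = A" using grad_active[OF a] norm_J by (simp add: active_def)
        then show ?case using A by (simp add: normal_def grad_radial)
      qed
    qed measurable
  qed measurable
  have "set_lebesgue_integral lebesgue E (divergence T) = (\<integral>x. T x \<bullet> normal x \<partial>surface)" if T: "test_field T" for T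
  proof -
    have [measurable]: "T \<in> borel_measurable borel" by (rule test_field_measurable[OF T])
    have "(\<integral>x. T x \<bullet> normal x \<partial>surface) = (\<integral>x. T (radial x) \<bullet> normal (radial x) \<partial>density lborel (\<lambda>x. ennreal (3 * A * indicator E x)))"
      unfolding surface_def by (subst integral_distr) (auto simp: ennreal_mult' ennreal_indicator A less_imp_le)
    also have "\<dots> = (LBINT x. (3 * A * indicator E x) *\<^sub>R (T (radial x) \<bullet> normal (radial x)))"
      using A by (intro integral_density) auto
    also have "\<dots> = (LBINT x. 3 * (indicator E x * homog T x))"
      using A by (intro Bochner_Integration.integral_cong) (auto simp: normal_def grad_radial homog_def)
    finally show ?thesis
      using divergence_theorem[OF T] by (simp add: set_integral_divergence[OF T E_measurable])
  qed
  then show ?thesis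
    unfolding gauss_green_def using AE1 finite_surface
    by (simp add: measurable_cong_sets[OF sets_surface refl])
qed

text \<open>Near a relative interior point of a facet only its normal is active, so the averages of
  \<open>normal\<close> over small balls are equal to \<open>a / A\<close>. What is left is that
  these balls have positive measure.\<close>

lemma facet_subset_reduced_boundary:
  assumes a: "a \<in> J" "a \<bullet> (x - p) = 1" and b: "\<And>b. b \<in> J - {a} \<Longrightarrow> b \<bullet> (x - p) < 1"
  shows "x \<in> reduced_boundary E"
proof -
  interpret finite_measure surface by (rule finite_surface)
  have act: "active a x" using a b by (auto simp: active_def)
  then have g: "pgauge x = 1" using a gauge_active by simp
  obtain d where d: "d > 0" "ball x d \<subseteq> {x. active a x}"
    using openE[OF open_active[of a], of x] act by blast
  have pos: "measure surface (ball x r) > 0" if "r > 0" for r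
  proof -
    \<comment> \<open>An open part of the cone over the ball inside \<open>E\<close>. The condition
      \<open>0 < pgauge y\<close> excludes \<open>p\<close>, where \<open>radial\<close> is
      discontinuous; the midpoint of \<open>p\<close> and \<open>x\<close> shows that the set is
      nonempty.\<close>
    define O' where "O' = {y. 0 < pgauge y} \<inter> radial -` ball x r \<inter> {y. pgauge y < 1}"
    have "open {y. 0 < pgauge y}" by (intro open_Collect_less continuous_on_gauge continuous_on_const)
    moreover have "continuous_on {y. 0 < pgauge y} radial"
      unfolding radial_def by (intro continuous_intros continuous_on_gauge) auto
    ultimately have "open ({y. 0 < pgauge y} \<inter> radial -` ball x r)"
      by (intro continuous_open_preimage) auto
    then have "open O'"
      unfolding O'_def by (rule open_Int) (intro open_Collect_less continuous_on_gauge continuous_on_const)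
    moreover have "p + (1/2) *\<^sub>R (x - p) \<in> O'"
      using that g radial_scale[of "1/2" x] by (simp add: O'_def gauge_scale radial_def)
    ultimately have "emeasure lborel O' > 0" by (intro emeasure_lborel_open_pos) auto
    also have "emeasure lborel O' \<le> emeasure lborel (E \<inter> radial -` ball x r)"
      using measurable_sets[OF radial_measurable, of "ball x r"] by (intro emeasure_mono) (auto simp: O'_def E_eq)
    finally have "emeasure surface (ball x r) > 0"
      using A by (simp add: emeasure_surface ennreal_zero_less_mult_iff)
    then show ?thesis by (simp add: emeasure_eq_measure)
  qed
  let ?q = "\<lambda>r. set_lebesgue_integral surface (ball x r) normal /\<^sub>R measure surface (ball x r)"
  have "?q r = (1 / A) *\<^sub>R a" if r: "0 < r" "r < d" for r
  proof -
    have nrm: "indicator (ball x r) y *\<^sub>R normal y = indicator (ball x r) y *\<^sub>R ((1 / A) *\<^sub>R a)" for y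
    proof (cases "y \<in> ball x r")
      case True
      then have "y \<in> {x. active a x}" using d(2) r by (intro subsetD[OF d(2)]) auto
      then have "active a y" by simp
      then show ?thesis by (simp add: normal_def grad_active)
    qed simp
    then have "set_lebesgue_integral surface (ball x r) normal = measure surface (ball x r) *\<^sub>R ((1 / A) *\<^sub>R a)"
    proof -
      have "(\<integral>y. indicator (ball x r) y *\<^sub>R c \<partial>surface) = measure surface (ball x r) *\<^sub>R c" for c :: "real^3"
        by (simp add: emeasure_eq_measure)
      then show ?thesis
        unfolding set_lebesgue_integral_def nrm by blast
    qed
    then show ?thesis using pos[OF r(1)] by simp
  qed
  then have "\<forall>\<^sub>F r in at_right 0. ?q r = (1 / A) *\<^sub>R a"
    using eventually_at_right_real[OF d(1)] by (auto elim!: eventually_mono)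
  then have "(?q \<longlongrightarrow> (1 / A) *\<^sub>R a) (at_right 0)"
    by (rule tendsto_eventually)
  moreover have "norm ((1 / A) *\<^sub>R a) = 1" using A norm_J[OF a(1)] by simp
  ultimately show ?thesis
    unfolding reduced_boundary_def using gauss_green_surface pos by blast
qed

end

section \<open>Areas in planes\<close>

lemma fst_snd_borel_measurable:
  "fst \<in> borel_measurable (borel :: (real \<times> real) measure)"
  "snd \<in> borel_measurable (borel :: (real \<times> real) measure)"
  by (intro borel_measurable_continuous_onI continuous_intros)+

text \<open>\<open>F\<close> is an antiderivative of the full width \<open>2 * w\<close>. The closed
  strip serves the upper bound for the competitor, the strict one the lower bound for open
  facets.\<close>

lemma emeasure_symmetric_strip:
  fixes w F :: "real \<Rightarrow> real"
  assumes [measurable]: "w \<in> borel_measurable borel" and "a \<le> b"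
    and w: "\<And>t. t \<in> {a..b} \<Longrightarrow> w t \<ge> 0"
    and F: "\<And>t. t \<in> {a..b} \<Longrightarrow> (F has_field_derivative 2 * w t) (at t)"
  shows "emeasure lborel {z \<in> {a..b} \<times> UNIV. \<bar>snd z\<bar> \<le> w (fst z)} = ennreal (F b - F a)"
    and "emeasure lborel {z \<in> {a..b} \<times> UNIV. \<bar>snd z\<bar> < w (fst z)} = ennreal (F b - F a)"
proof -
  let ?A = "{z \<in> {a..b} \<times> UNIV. \<bar>snd z\<bar> \<le> w (fst z)}" and ?B = "{z \<in> {a..b} \<times> UNIV. \<bar>snd z\<bar> < w (fst z)}"
  have int: "(\<integral>\<^sup>+t. ennreal (2 * w t) * indicator {a..b} t \<partial>lborel) = ennreal (F b - F a)"
    using w F \<open>a \<le> b\<close>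
    by (intro nn_integral_FTC_Icc) (auto intro: has_field_derivative_at_within)
  have "emeasure (lborel \<Otimes>\<^sub>M lborel) S = ennreal (F b - F a)"
    if m: "S \<in> sets (lborel \<Otimes>\<^sub>M lborel)" and S: "\<And>t. emeasure lborel (Pair t -` S) = ennreal (2 * w t) * indicator {a..b} t"
    for S :: "(real \<times> real) set"
    by (subst lborel.emeasure_pair_measure_alt[OF m]) (simp add: S int)
  note * = this[unfolded lborel_prod]
  have m: "?A \<in> sets borel"
    "?B \<in> sets borel"
  proof -
    have "?A = {z. a \<le> fst z \<and> fst z \<le> b \<and> \<bar>snd z\<bar> \<le> w (fst z)}"
      "?B = {z. a \<le> fst z \<and> fst z \<le> b \<and> \<bar>snd z\<bar> < w (fst z)}" by auto
    moreover note [measurable] = fst_snd_borel_measurable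
    have "{z. a \<le> fst z \<and> fst z \<le> b \<and> \<bar>snd z\<bar> \<le> w (fst z)} \<in> sets borel"
      "{z. a \<le> fst z \<and> fst z \<le> b \<and> \<bar>snd z\<bar> < w (fst z)} \<in> sets borel" by measurable
    ultimately show "?A \<in> sets borel"
      "?B \<in> sets borel" by simp_all
  qed
  show "emeasure lborel ?A = ennreal (F b - F a)"
  proof (rule *)
    fix t
    have "Pair t -` ?A = (if t \<in> {a..b} then {- w t..w t} else {})"
      by auto
    then show "emeasure lborel (Pair t -` ?A) = ennreal (2 * w t) * indicator {a..b} t"
      using w[of t] by (auto simp del: atLeastAtMost_iff)
  qed (use m in simp)
  show "emeasure lborel ?B = ennreal (F b - F a)"
  proof (rule *)
    fix t
    have "Pair t -` ?B = (if t \<in> {a..b} then {- w t<..<w t} else {})"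
      by auto
    then show "emeasure lborel (Pair t -` ?B) = ennreal (2 * w t) * indicator {a..b} t"
      using w[of t] by (auto simp del: atLeastAtMost_iff)
  qed (use m in simp)
qed

definition plane_map :: "'a::real_inner \<Rightarrow> 'a \<Rightarrow> 'a \<Rightarrow> real \<times> real \<Rightarrow> 'a" where
  "plane_map o' u v z = o' + fst z *\<^sub>R u + snd z *\<^sub>R v"

lemma hausdorff2_plane_map:
  fixes u v :: "'a::real_inner"
  assumes "norm u = 1" "norm v = 1" "u \<bullet> v = 0" "S \<in> sets borel"
  shows "hausdorff2 (plane_map o' u v ` S) = hausdorff2_square * emeasure lborel S"
proof -
  have "dist (plane_map o' u v x) (plane_map o' u v y) = 1 * dist x y" for x y
  proof -
    have "plane_map o' u v x - plane_map o' u v y = (fst x - fst y) *\<^sub>R u + (snd x - snd y) *\<^sub>R v"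
      by (simp add: plane_map_def algebra_simps)
    then have "(dist (plane_map o' u v x) (plane_map o' u v y))\<^sup>2 = (norm ((fst x - fst y) *\<^sub>R u + (snd x - snd y) *\<^sub>R v))\<^sup>2"
      by (simp add: dist_norm)
    also have "\<dots> = (norm ((fst x - fst y) *\<^sub>R u))\<^sup>2 + (norm ((snd x - snd y) *\<^sub>R v))\<^sup>2"
      using assms(3) by (intro norm_add_Pythagorean) (simp add: orthogonal_def)
    also have "\<dots> = (dist x y)\<^sup>2"
      using assms(1,2) by (simp add: dist_prod_def dist_real_def power_mult_distrib)
    finally show ?thesis by simp
  qed
  then have "hausdorff2 (plane_map o' u v ` S) = ennreal (1\<^sup>2) * hausdorff2 S"
    by (intro hausdorff2_similar_image) auto
  then show ?thesis using hausdorff2_eq_lborel[OF assms(4)] by simp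
qed

section \<open>The perimeter of rhombic dodecahedra\<close>

text \<open>An index stands for the normal \<open>s * e_i + t * e_j\<close>; its third entry is the
  coordinate that this normal does not involve.\<close>

definition facet_index :: "((3 \<times> 3 \<times> 3) \<times> real \<times> real) set" where
  "facet_index = {(1, 2, 3), (1, 3, 2), (2, 3, 1)} \<times> {1, -1} \<times> {1, -1}"

fun facet_normal :: "(3 \<times> 3 \<times> 3) \<times> real \<times> real \<Rightarrow> real^3" where
  "facet_normal ((i, j, k), s, t) = axis i s + axis j t"

text \<open>The relative interior of a rhombic facet: the bounds on \<open>x $ k\<close> make all
  other facet inequalities strict.\<close>

fun open_facet :: "(3 \<times> 3 \<times> 3) \<times> real \<times> real \<Rightarrow> (real^3) set" where
  "open_facet ((i, j, k), s, t) = {x. s * x $ i + t * x $ j = 1 \<and> \<bar>x $ k\<bar> < s * x $ i \<and> \<bar>x $ k\<bar> < t * x $ j}"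

lemma facet_normal_inner: "facet_normal ((i, j, k), s, t) \<bullet> x = s * x $ i + t * x $ j"
  by (simp add: inner_add_left inner_axis')

lemma finite_facet_index: "finite facet_index" "card facet_index = 12"
  by (simp_all add: facet_index_def card_cartesian_product)

lemma facet_index_distinct: "((i, j, k), s, t) \<in> facet_index \<Longrightarrow> i \<noteq> j \<and> i \<noteq> k \<and> j \<noteq> k \<and> s\<^sup>2 = 1 \<and> t\<^sup>2 = 1"
  by (auto simp: facet_index_def)

lemma open_facet_normal:
  assumes "\<phi> \<in> facet_index" "x \<in> open_facet \<phi>"
  shows "facet_normal \<phi> \<bullet> x = 1"
  using assms by (cases \<phi>) (auto simp: facet_normal_inner simp del: facet_normal.simps)

lemma open_facet_other:
  assumes "\<phi> \<in> facet_index" "\<psi> \<in> facet_index" "\<phi> \<noteq> \<psi>" "x \<in> open_facet \<phi>"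
  shows "facet_normal \<psi> \<bullet> x < 1"
  using assms unfolding facet_index_def
  by (auto simp: facet_normal_inner abs_if simp del: facet_normal.simps split: if_splits)

lemma open_facet_disjoint:
  assumes "\<phi> \<in> facet_index" "\<psi> \<in> facet_index" "\<phi> \<noteq> \<psi>"
  shows "open_facet \<phi> \<inter> open_facet \<psi> = {}"
  using open_facet_other[OF assms] open_facet_normal[OF assms(2)] by fastforce

lemma open_facet_measurable: "open_facet \<phi> \<in> sets borel"
  by (cases \<phi>) (auto intro!: measurable_sets_borel)

lemma DERIV_mult_abs: "((\<lambda>t::real. t * \<bar>t\<bar>) has_field_derivative 2 * \<bar>t\<bar>) (at t)"
proof -
  have "((\<lambda>t::real. (max 0 t)\<^sup>2 - (max 0 (- t))\<^sup>2) has_field_derivative 2 * max 0 t - 2 * max 0 (- t) * (- 1)) (at t)"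
    by (intro DERIV_diff DERIV_max_0_power2 DERIV_chain2[OF DERIV_max_0_power2] DERIV_minus DERIV_ident)
  moreover have "(\<lambda>t::real. (max 0 t)\<^sup>2 - (max 0 (- t))\<^sup>2) = (\<lambda>t. t * \<bar>t\<bar>)"
    by (auto simp: fun_eq_iff max_def power2_eq_square abs_if)
  moreover have "2 * max 0 t - 2 * max 0 (- t) * (- 1) = 2 * \<bar>t\<bar>" by (auto simp: max_def)
  ultimately show ?thesis by simp
qed

text \<open>The rhombus has diagonals of length sqrt 2, from \<open>s * e_i\<close> to
  \<open>t * e_j\<close>, and 1. The frame has its origin at the centre, \<open>u\<close> points
  along the long diagonal, \<open>b\<close> is half its length, and \<open>w r\<close> is the
  half-width at signed distance \<open>r\<close> from the centre.\<close>

lemma hausdorff2_open_facet: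
  assumes "\<phi> \<in> facet_index"
  shows "hausdorff2 (open_facet \<phi>) \<ge> hausdorff2_square * ennreal (sqrt 2 / 2)"
proof -
  obtain i j k s t where \<phi>: "\<phi> = ((i, j, k), s, t)" by (metis prod.collapse)
  have ijk: "i \<noteq> j" "i \<noteq> k" "j \<noteq> k" and st: "s\<^sup>2 = 1" "t\<^sup>2 = 1"
    using facet_index_distinct[of i j k s t] assms \<phi> by auto
  define o' u v where "o' = (1/2) *\<^sub>R (axis i s + axis j t)" and "u = (1 / sqrt 2) *\<^sub>R (axis i s - axis j t)"
    and "v = (axis k 1 :: real^3)"
  have uv: "norm u = 1" "norm v = 1" "u \<bullet> v = 0"
  proof -
    have "u \<bullet> u = 1"
      using ijk st by (simp add: u_def inner_diff_left inner_diff_right inner_axis_axis power2_eq_square field_simps)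
    then show "norm u = 1" by (simp add: norm_eq_1)
  qed (use ijk in \<open>simp_all add: u_def v_def inner_diff_left inner_axis_axis\<close>)
  define b where "b = 1 / sqrt 2"
  define w where "w r = 1/2 - \<bar>r\<bar> / sqrt 2" for r :: real
  define S where "S = {z \<in> {- b..b} \<times> UNIV. \<bar>snd z\<bar> < w (fst z)}"
  have bb: "b * b = 1/2" "b / sqrt 2 = 1/2" "b \<ge> 0" by (simp_all add: b_def)
  have "emeasure lborel S = ennreal ((b - b * \<bar>b\<bar> / sqrt 2) - (- b - (- b) * \<bar>- b\<bar> / sqrt 2))"
    unfolding S_def
  proof (rule emeasure_symmetric_strip(2))
    show "w r \<ge> 0" if "r \<in> {- b..b}" for r
    proof -
      have "\<bar>r\<bar> / sqrt 2 \<le> b / sqrt 2" using that by (intro divide_right_mono) auto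
      then show ?thesis unfolding w_def bb by simp
    qed
    show "((\<lambda>r. r - r * \<bar>r\<bar> / sqrt 2) has_field_derivative 2 * w r) (at r)" for r
      unfolding w_def by (rule derivative_eq_intros DERIV_mult_abs refl | simp add: field_simps)+
  qed (use bb in \<open>auto simp: w_def\<close>)
  also have "(b - b * \<bar>b\<bar> / sqrt 2) - (- b - (- b) * \<bar>- b\<bar> / sqrt 2) = sqrt 2 / 2"
  proof -
    have "(b - b * \<bar>b\<bar> / sqrt 2) - (- b - (- b) * \<bar>- b\<bar> / sqrt 2) = 2 * b - 2 * b * (b / sqrt 2)"
      using bb(3) by simp
    also have "\<dots> = b" unfolding bb by simp
    also have "\<dots> = sqrt 2 / 2" by (simp add: b_def field_simps)
    finally show ?thesis .
  qed
  finally have eS: "emeasure lborel S = ennreal (sqrt 2 / 2)" .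
  have "S \<in> sets borel"
  proof -
    have "S = {z. - b \<le> fst z \<and> fst z \<le> b \<and> \<bar>snd z\<bar> < w (fst z)}" by (auto simp: S_def)
    moreover note [measurable] = fst_snd_borel_measurable
    have "{z. - b \<le> fst z \<and> fst z \<le> b \<and> \<bar>snd z\<bar> < w (fst z)} \<in> sets borel" unfolding w_def by measurable
    ultimately show ?thesis by simp
  qed
  then have "hausdorff2_square * ennreal (sqrt 2 / 2) = hausdorff2 (plane_map o' u v ` S)"
    using hausdorff2_plane_map[OF uv] eS by simp
  also have "\<dots> \<le> hausdorff2 (open_facet \<phi>)"
  proof (rule hausdorff2_mono, rule image_subsetI)
    fix z assume z: "z \<in> S"
    let ?x = "plane_map o' u v z"
    define P where "P = fst z / sqrt 2"
    have comp: "?x $ i = s * (1/2 + P)" "?x $ j = t * (1/2 - P)" "?x $ k = snd z"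
      using ijk by (simp_all add: plane_map_def o'_def u_def v_def axis_def P_def field_simps)
    have "\<bar>snd z\<bar> < 1/2 - \<bar>P\<bar>" using z by (simp add: S_def w_def P_def)
    moreover have "s * ?x $ i = 1/2 + P" "t * ?x $ j = 1/2 - P"
      using st unfolding comp by (simp_all add: power2_eq_square flip: mult.assoc)
    moreover have "\<bar>snd z\<bar> < 1/2 + P" "\<bar>snd z\<bar> < 1/2 - P" using calculation(1) by linarith+
    ultimately show "?x \<in> open_facet \<phi>" by (simp add: \<phi> comp(3))
  qed
  finally show ?thesis .
qed

lemma hausdorff2_open_facets: "hausdorff2 (\<Union>\<phi>\<in>facet_index. open_facet \<phi>) \<ge> hausdorff2_square * ennreal (6 * sqrt 2)"
proof -
  have d: "disjoint_family_on open_facet facet_index"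
    using open_facet_disjoint by (auto simp: disjoint_family_on_def)
  have "hausdorff2_square * ennreal (6 * sqrt 2) = (\<Sum>\<phi>\<in>facet_index. hausdorff2_square * ennreal (sqrt 2 / 2))"
    by (simp add: finite_facet_index ennreal_mult' mult.left_commute) (simp flip: ennreal_mult' ennreal_numeral)
  also have "\<dots> \<le> (\<Sum>\<phi>\<in>facet_index. hausdorff2 (open_facet \<phi>))"
    by (intro sum_mono hausdorff2_open_facet)
  also have "\<dots> = (\<Sum>\<phi>\<in>facet_index. emeasure hausdorff2_measure (open_facet \<phi>))"
    by (simp add: emeasure_hausdorff2_measure open_facet_measurable)
  also have "\<dots> = emeasure hausdorff2_measure (\<Union>\<phi>\<in>facet_index. open_facet \<phi>)"
    using d open_facet_measurable finite_facet_index by (intro sum_emeasure) auto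
  also have "\<dots> = hausdorff2 (\<Union>\<phi>\<in>facet_index. open_facet \<phi>)"
    using open_facet_measurable finite_facet_index by (intro emeasure_hausdorff2_measure sets.finite_UN) auto
  finally show ?thesis .
qed

text \<open>For the inclusion of the polytope in the hull: the cube of half-side 1/2 is the hull of
  its eight vertices, and a point outside of it has a coordinate of modulus greater than 1/2, which
  places it in the pyramid over a face of the cube whose apex is an axis vertex.\<close>

lemma rhombic_dodecahedron_eq:
  "rhombic_dodecahedron = {x. \<forall>\<phi>\<in>facet_index. facet_normal \<phi> \<bullet> x \<le> 1}" (is "?R = ?P")
proof
  have P: "x \<in> ?P \<longleftrightarrow> \<bar>x $ 1\<bar> + \<bar>x $ 2\<bar> \<le> 1 \<and> \<bar>x $ 1\<bar> + \<bar>x $ 3\<bar> \<le> 1 \<and> \<bar>x $ 2\<bar> + \<bar>x $ 3\<bar> \<le> 1" for x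
    by (auto simp: facet_index_def facet_normal_inner abs_if simp del: facet_normal.simps)
  have "?P = (\<Inter>\<phi>\<in>facet_index. {x. facet_normal \<phi> \<bullet> x \<le> 1})" by auto
  then have "convex ?P" by (simp add: convex_INT convex_halfspace_le)
  moreover have "{axis i s |i s. s \<in> {1, -1}} \<union> {x. \<forall>i. x $ i \<in> {1/2, -1/2}} \<subseteq> ?P"
  proof
    fix x :: "real^3"
    assume "x \<in> {axis i s |i s. s \<in> {1, -1}} \<union> {x. \<forall>i. x $ i \<in> {1/2, -1/2}}"
    then consider i s where "x = axis i s" "s \<in> {1, -1}" | "\<forall>i. x $ i \<in> {1/2, -1/2}" by auto
    then show "x \<in> ?P"
    proof cases
      case 1
      then show ?thesis unfolding P using exhaust_3[of i] by (auto simp: axis_def)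
    next
      case 2
      then show ?thesis unfolding P by (auto simp: forall_3)
    qed
  qed
  ultimately show "?R \<subseteq> ?P" unfolding rhombic_dodecahedron_def by (rule hull_minimal[rotated])
  let ?V = "{x :: real^3. \<forall>i. x $ i \<in> {1/2, -1/2}}"
  have cube: "x \<in> ?R" if "\<And>i. \<bar>x $ i\<bar> \<le> 1/2" for x
  proof -
    let ?h = "(\<chi> i. 1/2) :: real^3"
    have "x $ i \<le> 1/2" "- x $ i \<le> 1/2" for i using that[of i] by (auto simp only: abs_le_iff)
    then have "0 \<le> x $ i + 1/2" "x $ i + 1/2 \<le> 1" for i by (smt (verit) field_sum_of_halves)+
    then have "x + ?h \<in> cbox 0 1" by (simp add: mem_box_cart)
    then have "x + ?h \<in> convex hull {x. \<forall>i. x $ i = 0 \<or> x $ i = 1}"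
      using unit_interval_convex_hull[where 'a = "real^3"]
      by (simp add: Cart_1 Basis_vec_def inner_axis)
    then have "x \<in> (+) (- ?h) ` (convex hull {x. \<forall>i. x $ i = 0 \<or> x $ i = 1})"
      by (intro image_eqI[of _ _ "x + ?h"]) auto
    then have "x \<in> convex hull ((+) (- ?h) ` {x. \<forall>i. x $ i = 0 \<or> x $ i = 1})"
      by (simp only: convex_hull_translation)
    moreover have "(+) (- ?h) ` {x. \<forall>i. x $ i = 0 \<or> x $ i = 1} \<subseteq> ?V"
      by (auto simp: image_iff)
    ultimately have "x \<in> convex hull ?V" by (rule subsetD[OF hull_mono, rotated])
    then show ?thesis
      unfolding rhombic_dodecahedron_def by (rule subsetD[OF hull_mono[OF Un_upper2]])
  qed
  show "?P \<subseteq> ?R"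
  proof
    fix x assume "x \<in> ?P"
    then have x: "\<bar>x $ i\<bar> + \<bar>x $ j\<bar> \<le> 1" if "i \<noteq> j" for i j
      using that exhaust_3[of i] exhaust_3[of j] unfolding P by auto
    show "x \<in> ?R"
    proof (cases "\<forall>i. \<bar>x $ i\<bar> \<le> 1/2")
      case False
      then obtain i where i: "\<bar>x $ i\<bar> > 1/2" unfolding not_all not_le by blast
      define s where "s = sgn (x $ i)"
      have s: "s \<in> {1, -1}" "x $ i = s * \<bar>x $ i\<bar>" using i by (auto simp: s_def sgn_if)
      have xi1: "\<bar>x $ i\<bar> \<le> 1" using x[of i "i + 1"] exhaust_3[of i] by auto
      show ?thesis
      proof (cases "\<bar>x $ i\<bar> = 1")
        case True
        have "x $ j = 0" if "j \<noteq> i" for j using x[of i j] that True by auto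
        then have "x = axis i s" using s True by (auto simp: vec_eq_iff axis_def)
        then show ?thesis unfolding rhombic_dodecahedron_def using s by (intro hull_inc) auto
      next
        case False
        define r where "r = \<bar>x $ i\<bar>"
        have r: "1/2 < r" "r < 1" "x $ i = s * r" using False xi1 i s by (auto simp: r_def)
        \<comment> \<open>The point where the ray from the apex \<open>axis i s\<close> through
          \<open>x\<close> meets the face of the cube in the plane where coordinate \<open>i\<close>
          is \<open>s / 2\<close>.\<close>
        define y where "y = (\<chi> j. if j = i then s / 2 else x $ j / (2 * (1 - r)))"
        have "\<bar>y $ j\<bar> \<le> 1/2" for j
        proof (cases "j = i")
          case True
          then show ?thesis using s by (auto simp: y_def)
        next
          case False
          then have "\<bar>x $ j\<bar> \<le> 1 - r" using x[of i j] by (simp add: r_def)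
          then show ?thesis using False r by (simp add: y_def field_simps)
        qed
        then have yR: "y \<in> ?R" by (rule cube)
        have aR: "axis i s \<in> ?R" unfolding rhombic_dodecahedron_def using s by (intro hull_inc) auto
        have "(2 * r - 1) *\<^sub>R axis i s + (2 * (1 - r)) *\<^sub>R y \<in> ?R"
          using r by (intro convexD[OF _ aR yR]) (auto simp: rhombic_dodecahedron_def convex_convex_hull)
        moreover have "(2 * r - 1) *\<^sub>R axis i s + (2 * (1 - r)) *\<^sub>R y = x"
          using r by (auto simp: vec_eq_iff y_def axis_def field_simps)
        ultimately show ?thesis by simp
      qed
    qed (use cube in blast)
  qed
qed


lemma bounded_vec3I:
  fixes S :: "(real^3) set"
  assumes "\<And>x i. x \<in> S \<Longrightarrow> \<bar>x $ i\<bar> \<le> 1"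
  shows "bounded S"
  unfolding bounded_iff
proof (intro exI ballI)
  fix x assume "x \<in> S"
  then have "(\<Sum>i\<in>UNIV. \<bar>x $ i\<bar>) \<le> (\<Sum>i\<in>(UNIV :: 3 set). 1)" by (intro sum_mono assms)
  then show "norm x \<le> 3" using norm_le_l1_cart[of x] by simp
qed

lemma rhombic_dodecahedron_bounded: "bounded rhombic_dodecahedron"
  unfolding rhombic_dodecahedron_def
proof (intro bounded_convex_hull bounded_vec3I)
  fix x :: "real^3" and i
  assume "x \<in> {axis i s |i s. s \<in> {1, -1}} \<union> {x. \<forall>i. x $ i \<in> {1/2, -1/2}}"
  then consider j s where "x = axis j s" "s = 1 \<or> s = -1" | "x $ i = 1/2 \<or> x $ i = -1/2" by auto
  then show "\<bar>x $ i\<bar> \<le> 1" by cases (auto simp: axis_def)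
qed

lemma facet_normal_norm: "\<phi> \<in> facet_index \<Longrightarrow> norm (facet_normal \<phi>) = sqrt 2"
  unfolding norm_eq_sqrt_inner
  by (auto simp: facet_index_def inner_add_left inner_add_right inner_axis_axis)

lemma facet_normal_minus:
  assumes "\<phi> \<in> facet_index"
  shows "- facet_normal \<phi> \<in> facet_normal ` facet_index"
proof -
  obtain i j k s t where \<phi>: "\<phi> = ((i, j, k), s, t)" by (metis prod.collapse)
  have "((i, j, k), - s, - t) \<in> facet_index" using assms \<phi> by (auto simp: facet_index_def)
  then have "facet_normal ((i, j, k), - s, - t) \<in> facet_normal ` facet_index" by (rule imageI)
  moreover have "facet_normal ((i, j, k), - s, - t) = - facet_normal \<phi>"
    by (simp add: \<phi> vec_eq_iff axis_def)
  ultimately show ?thesis by simp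
qed

declare facet_normal.simps [simp del]

text \<open>\<open>c\<close> is the dilation factor. Since \<open>D\<close> is closed, it contains
  the ball that it contains up to a null set. Opposite facets are \<open>sqrt 2 * c\<close> apart,
  so a ball of diameter \<open>2 * m\<close> fits only if \<open>sqrt 2 * m \<le> c\<close>. The
  perimeter is at least the area of the twelve open facets.\<close>

lemma similar_rhombic_dodecahedron_bounds:
  assumes "similar_sets rhombic_dodecahedron D" "m > 0" "D \<in> ball_fundamental_domains m G"
  obtains c where "sqrt 2 * m \<le> c" "hausdorff2_square * ennreal (c\<^sup>2 * (6 * sqrt 2)) \<le> Per D"
proof -
  obtain f c where c: "c > 0" and f: "\<And>x y. dist (f x) (f y) = c * dist x y"
    and D: "D = f ` rhombic_dodecahedron"
    using assms(1) by (auto simp: similar_sets_def)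
  \<comment> \<open>The linear part of the similarity: an isometry fixing the origin is
    orthogonal.\<close>
  define Q where "Q x = (1 / c) *\<^sub>R (f x - f 0)" for x
  have "dist (Q x) (Q y) = dist x y" for x y
  proof -
    have "Q x - Q y = (1 / c) *\<^sub>R (f x - f y)" by (simp add: Q_def algebra_simps)
    then show ?thesis using f[of x y] c by (simp add: dist_norm)
  qed
  then have Q: "orthogonal_transformation Q"
    unfolding orthogonal_transformation_isometry by (simp add: Q_def)
  have fQ: "f x = f 0 + c *\<^sub>R Q x" for x using c by (simp add: Q_def)
  define J where "J = (\<lambda>\<phi>. (1 / c) *\<^sub>R Q (facet_normal \<phi>)) ` facet_index"
  have inner: "(1 / c) *\<^sub>R Q a \<bullet> (f x - f 0) = a \<bullet> x" for a x
    using Q c by (simp add: fQ[of x] orthogonal_transformation_def)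
  have DJ: "D = {y. \<forall>a\<in>J. a \<bullet> (y - f 0) \<le> 1}"
  proof (intro set_eqI iffI)
    fix y assume "y \<in> D"
    then show "y \<in> {y. \<forall>a\<in>J. a \<bullet> (y - f 0) \<le> 1}"
      by (auto simp: D J_def inner rhombic_dodecahedron_eq simp del: inner_scaleR_left)
  next
    fix y assume y: "y \<in> {y. \<forall>a\<in>J. a \<bullet> (y - f 0) \<le> 1}"
    obtain x where x: "Q x = (1 / c) *\<^sub>R (y - f 0)"
      using orthogonal_transformation_surj[OF Q] by (metis surjD)
    then have "y = f x" using c by (simp add: fQ[of x])
    then show "y \<in> D"
      using y by (auto simp: D J_def inner rhombic_dodecahedron_eq simp del: inner_scaleR_left)
  qed
  have normJ: "norm a = sqrt 2 / c" if "a \<in> J" for a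
    using that Q c by (auto simp: J_def facet_normal_norm orthogonal_transformation_norm)
  have "bounded D"
  proof -
    obtain B where B: "\<And>x. x \<in> rhombic_dodecahedron \<Longrightarrow> norm x \<le> B"
      using rhombic_dodecahedron_bounded by (auto simp: bounded_iff)
    have "dist (f 0) y \<le> c * B" if "y \<in> D" for y
      using that B c f[of 0] by (auto simp: D)
    then show ?thesis unfolding bounded_def by blast
  qed
  interpret equidistant_polytope J "f 0" "sqrt 2 / c"
  proof
    show "finite J" unfolding J_def using finite_facet_index by simp
    show "J \<noteq> {}" by (simp add: J_def facet_index_def)
    show "bounded {x. \<forall>a\<in>J. a \<bullet> (x - f 0) \<le> 1}" using \<open>bounded D\<close> unfolding DJ .
  qed (use c normJ in auto)
  have DE: "D = E" by (simp add: DJ E_def)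
  obtain y where y: "ball y m - D \<in> null_sets lebesgue"
    using assms(3) by (auto simp: ball_fundamental_domains_def)
  have "closed D"
    unfolding DE E_eq by (intro closed_Collect_le continuous_on_gauge continuous_on_const)
  then have ball: "ball y m \<subseteq> D"
  proof -
    have "open (ball y m - D)" using \<open>closed D\<close> by (intro open_Diff) auto
    moreover from this y have "emeasure lborel (ball y m - D) = 0" by (simp add: null_sets_def)
    ultimately have "ball y m - D = {}"
      using emeasure_lborel_open_pos[of "ball y m - D"] by (metis less_irrefl)
    then show ?thesis by blast
  qed
  \<comment> \<open>The ball is open, so points on its boundary sphere are approached through radii
    \<open>t < m\<close>.\<close>
  have "t \<le> c / sqrt 2" if t: "0 < t" "t < m" for t
  proof -
    define \<phi> where "\<phi> = ((1 :: 3, 2 :: 3, 3 :: 3), 1 :: real, 1 :: real)"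
    define a where "a = (1 / c) *\<^sub>R Q (facet_normal \<phi>)"
    have \<phi>: "\<phi> \<in> facet_index" by (simp add: \<phi>_def facet_index_def)
    have a: "a \<in> J" using \<phi> by (auto simp: J_def a_def)
    have "- a \<in> J"
    proof -
      obtain \<psi> where "\<psi> \<in> facet_index" "- facet_normal \<phi> = facet_normal \<psi>" using facet_normal_minus[OF \<phi>] by auto
      moreover have "- a = (1 / c) *\<^sub>R Q (- facet_normal \<phi>)"
        using linear_neg[OF orthogonal_transformation_linear[OF Q]] by (simp add: a_def)
      ultimately show ?thesis by (auto simp: J_def)
    qed
    define z where "z = (t / norm a) *\<^sub>R a"
    have na: "norm a > 0" using normJ[OF a] c by simp
    have "norm z = t" using na t by (simp add: z_def)
    then have "y + z \<in> D" "y - z \<in> D" using ball t by (auto simp: subset_iff dist_norm)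
    then have "a \<bullet> (y + z - f 0) \<le> 1" "- a \<bullet> (y - z - f 0) \<le> 1"
      using a \<open>- a \<in> J\<close> unfolding DJ by blast+
    then have "a \<bullet> z \<le> 1" by (simp add: inner_diff_right inner_add_right)
    moreover have "a \<bullet> z = t * norm a" using na by (simp add: z_def dot_square_norm power2_eq_square)
    ultimately show ?thesis using normJ[OF a] c by (simp add: field_simps)
  qed
  then have "m \<le> c / sqrt 2" using assms(2) by (meson dense_le_bounded)
  then have "m * sqrt 2 \<le> c" by (simp add: pos_le_divide_eq)
  then have 1: "sqrt 2 * m \<le> c" by (simp add: mult.commute)
  have "f ` (\<Union>\<phi>\<in>facet_index. open_facet \<phi>) \<subseteq> reduced_boundary D"
  proof safe
    fix x \<phi> assume \<phi>: "\<phi> \<in> facet_index" "x \<in> open_facet \<phi>"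
    let ?a = "(1 / c) *\<^sub>R Q (facet_normal \<phi>)"
    show "f x \<in> reduced_boundary D"
      unfolding DE
    proof (rule facet_subset_reduced_boundary)
      show "?a \<in> J" using \<phi> by (auto simp: J_def)
      show "?a \<bullet> (f x - f 0) = 1"
        unfolding inner by (rule open_facet_normal[OF \<phi>])
      fix b assume "b \<in> J - {?a}"
      then obtain \<psi> where \<psi>: "\<psi> \<in> facet_index" "\<psi> \<noteq> \<phi>" "b = (1 / c) *\<^sub>R Q (facet_normal \<psi>)"
        unfolding J_def by blast
      show "b \<bullet> (f x - f 0) < 1"
        unfolding \<psi>(3) inner using open_facet_other[OF \<phi>(1) \<psi>(1) _ \<phi>(2)] \<psi>(2) by metis
    qed
  qed
  then have "hausdorff2 (f ` (\<Union>\<phi>\<in>facet_index. open_facet \<phi>)) \<le> hausdorff2 (reduced_boundary D)"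
    by (rule hausdorff2_mono)
  also have "\<dots> \<le> Per D" by (simp add: Per_def)
  finally have "ennreal (c\<^sup>2) * hausdorff2 (\<Union>\<phi>\<in>facet_index. open_facet \<phi>) \<le> Per D"
    unfolding hausdorff2_similar_image[OF c f] .
  moreover have "hausdorff2_square * ennreal (c\<^sup>2 * (6 * sqrt 2)) = ennreal (c\<^sup>2) * (hausdorff2_square * ennreal (6 * sqrt 2))"
    by (simp add: ennreal_mult mult.left_commute)
  moreover have "\<dots> \<le> ennreal (c\<^sup>2) * hausdorff2 (\<Union>\<phi>\<in>facet_index. open_facet \<phi>)"
    by (intro mult_left_mono hausdorff2_open_facets) simp
  ultimately show ?thesis using 1 by (intro that[of c]) auto
qed

section \<open>The competitor\<close>

text \<open>In the cube of half-side \<open>1/4\<close> around each vertex of degree four, the apex of the cone is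
  replaced by a horizontal square of half-side \<open>1/84\<close>. The ratio \<open>1/21\<close> makes the inclined faces
  follow the Pythagorean triple \<open>20, 21, 29\<close>. With \<open>profile c = 1 - c\<close> the set \<open>competitor\<close> would be
  the rhombic dodecahedron.\<close>

definition profile :: "real \<Rightarrow> real" where
  "profile c = 1 - c - max 0 (1/4 - c) / 21 + max 0 (c - 3/4) / 21"

definition competitor :: "(real^3) set" where
  "competitor = {x. \<bar>x $ 3\<bar> \<le> 1 \<and> \<bar>x $ 1\<bar> \<le> profile \<bar>x $ 3\<bar> \<and> \<bar>x $ 2\<bar> \<le> profile \<bar>x $ 3\<bar> \<and> \<bar>x $ 1\<bar> + \<bar>x $ 2\<bar> \<le> 1}"

text \<open>An open subset. The shell \<open>competitor - competitor_core\<close> contains the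
  frontier, and overlaps of distinct lattice translates lie in it; a single covering by plane pieces
  shows that it is null and bounds its area.\<close>

definition competitor_core :: "(real^3) set" where
  "competitor_core = {x. \<bar>x $ 3\<bar> < 1 \<and> \<bar>x $ 1\<bar> < profile \<bar>x $ 3\<bar> \<and> \<bar>x $ 2\<bar> < profile \<bar>x $ 3\<bar> \<and> \<bar>x $ 1\<bar> + \<bar>x $ 2\<bar> < 1}"

definition fcc :: "(real^3) set" where
  "fcc = {z. (\<forall>i. z $ i \<in> \<int>) \<and> (\<exists>n::int. z $ 1 + z $ 2 + z $ 3 = 2 * real_of_int n)}"

lemma profile_cases:
  "c \<le> 1/4 \<Longrightarrow> profile c = 83/84 - 20/21 * c"
  "1/4 \<le> c \<Longrightarrow> c \<le> 3/4 \<Longrightarrow> profile c = 1 - c"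
  "3/4 \<le> c \<Longrightarrow> profile c = 27/28 - 20/21 * c"
  by (simp_all add: profile_def field_simps)

text \<open>A side face at height \<open>c\<close> is, seen from the neighbouring cell, a face at
  height \<open>1 - c\<close>. The equation says that what is removed at the four vertices with
  \<open>x $ 3 = 0\<close> is added at the two poles.\<close>

lemma profile_flip: "profile (1 - c) = 1 - profile c"
  by (simp add: profile_def)

lemma profile_antimono: "c \<le> d \<Longrightarrow> profile d \<le> profile c"
  by (auto simp: profile_def max_def field_simps)

lemma profile_bounds:
  "0 \<le> c \<Longrightarrow> profile c < 1" "c \<le> 1/2 \<Longrightarrow> 1/2 \<le> profile c" "1/2 \<le> c \<Longrightarrow> profile c \<le> 1/2"
  by (auto simp: profile_def max_def field_simps)

lemma continuous_on_profile: "continuous_on S (\<lambda>x. profile \<bar>x $ 3\<bar>)" for S :: "(real^3) set"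
  unfolding profile_def by (intro continuous_intros) auto

lemma closed_competitor: "closed competitor"
proof -
  have "competitor = {x. \<bar>x $ 3\<bar> \<le> 1} \<inter> {x. \<bar>x $ 1\<bar> \<le> profile \<bar>x $ 3\<bar>} \<inter> {x. \<bar>x $ 2\<bar> \<le> profile \<bar>x $ 3\<bar>} \<inter> {x. \<bar>x $ 1\<bar> + \<bar>x $ 2\<bar> \<le> 1}"
    by (auto simp: competitor_def)
  also have "closed \<dots>"
    by (intro closed_Int closed_Collect_le continuous_on_profile continuous_intros)
  finally show ?thesis .
qed

lemma open_competitor_core: "open competitor_core"
proof -
  have "competitor_core = {x. \<bar>x $ 3\<bar> < 1} \<inter> {x. \<bar>x $ 1\<bar> < profile \<bar>x $ 3\<bar>} \<inter> {x. \<bar>x $ 2\<bar> < profile \<bar>x $ 3\<bar>} \<inter> {x. \<bar>x $ 1\<bar> + \<bar>x $ 2\<bar> < 1}"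
    by (auto simp: competitor_core_def)
  also have "open \<dots>"
    by (intro open_Int open_Collect_less continuous_on_profile continuous_intros)
  finally show ?thesis .
qed

lemma competitor_le_1: "x \<in> competitor \<Longrightarrow> \<bar>x $ i\<bar> \<le> 1"
  using exhaust_3[of i] by (auto simp: competitor_def)

lemma bounded_competitor: "bounded competitor"
  by (intro bounded_vec3I competitor_le_1)

section \<open>Tiling by lattice translates\<close>

text \<open>With \<open>n\<close> the nearest integer point, \<open>f\<close> lies in the cube of
  half-side 1/2, which \<open>competitor\<close> contains. If the coordinates of \<open>n\<close>
  have odd sum, a neighbour of \<open>n\<close> is used: along axis 3 if the profile allows it,
  otherwise along the axis of the larger of the first two moduli, where \<open>profile_flip\<close>
  turns the failed inequality into the required one.\<close>

lemma fcc_covers: "\<exists>g\<in>fcc. x - g \<in> competitor"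
proof -
  define n where "n = (\<chi> i. real_of_int (round (x $ i)))"
  define f where "f = x - n"
  have f: "\<bar>f $ i\<bar> \<le> 1/2" for i
    using of_int_round_abs_le[of "x $ i"] by (simp add: f_def n_def abs_minus_commute)
  have n: "n $ i \<in> \<int>" for i by (simp add: n_def)
  define N where "N = round (x $ 1) + round (x $ 2) + round (x $ 3)"
  have N: "n $ 1 + n $ 2 + n $ 3 = real_of_int N" by (simp add: n_def N_def)
  show ?thesis
  proof (cases "even N")
    case True
    then have "n \<in> fcc" using n N by (auto simp: fcc_def elim!: evenE)
    moreover have "x - n \<in> competitor"
      using f[of 1] f[of 2] f[of 3] profile_bounds(2)[of "\<bar>f $ 3\<bar>"] by (simp add: competitor_def f_def)
    ultimately show ?thesis by blast
  next
    case False
    \<comment> \<open>The sign is 1 also at 0, so \<open>si i\<close> is always odd and adding it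
      changes the parity of the sum.\<close>
    define si where "si i = (if f $ i \<ge> 0 then 1 else -1 :: int)" for i
    define \<sigma> where "\<sigma> i = real_of_int (si i)" for i
    have \<sigma>: "\<bar>f $ i - \<sigma> i\<bar> = 1 - \<bar>f $ i\<bar>" "\<sigma> i \<in> \<int>" for i
      using f[of i] by (auto simp: \<sigma>_def si_def abs_if)
    have g: "n + axis i (\<sigma> i) \<in> fcc" for i
    proof -
      have "even (N + si i)" using False by (simp add: si_def)
      then obtain k where "N + si i = 2 * k" by (elim evenE)
      then have "real_of_int (N + si i) = real_of_int (2 * k)" by (rule arg_cong)
      then have "real_of_int N + \<sigma> i = 2 * real_of_int k" by (simp add: \<sigma>_def)
      then have "(n + axis i (\<sigma> i)) $ 1 + (n + axis i (\<sigma> i)) $ 2 + (n + axis i (\<sigma> i)) $ 3 = 2 * real_of_int k"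
        using exhaust_3[of i] N by (auto simp: axis_def)
      moreover have "(n + axis i (\<sigma> i)) $ l \<in> \<int>" for l
        using n[of l] \<sigma>(2)[of i] by (auto simp: axis_def)
      ultimately show ?thesis by (auto simp: fcc_def)
    qed
    have eq: "x - (n + axis i (\<sigma> i)) = f - axis i (\<sigma> i)" for i by (simp add: f_def algebra_simps)
    show ?thesis
    proof (cases "\<bar>f $ 1\<bar> \<le> profile (1 - \<bar>f $ 3\<bar>) \<and> \<bar>f $ 2\<bar> \<le> profile (1 - \<bar>f $ 3\<bar>)")
      case True
      then have "f - axis 3 (\<sigma> 3) \<in> competitor"
        using \<sigma>(1)[of 3] f[of 1] f[of 2] f[of 3] by (simp add: competitor_def axis_def)
      then show ?thesis using g[of 3] eq[of 3] by metis
    next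
      case False
      note F = False
      show ?thesis
      proof (cases "\<bar>f $ 2\<bar> \<le> \<bar>f $ 1\<bar>")
        case True
        then have "f - axis 1 (\<sigma> 1) \<in> competitor"
          using F \<sigma>(1)[of 1] f[of 1] f[of 2] f[of 3] profile_flip[of "\<bar>f $ 3\<bar>"] profile_bounds(2)[of "\<bar>f $ 3\<bar>"]
          by (simp add: competitor_def axis_def)
        then show ?thesis using g[of 1] eq[of 1] by metis
      next
        case False
        then have "f - axis 2 (\<sigma> 2) \<in> competitor"
          using F \<sigma>(1)[of 2] f[of 1] f[of 2] f[of 3] profile_flip[of "\<bar>f $ 3\<bar>"] profile_bounds(2)[of "\<bar>f $ 3\<bar>"]
          by (simp add: competitor_def axis_def) linarith
        then show ?thesis using g[of 2] eq[of 2] by metis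
      qed
    qed
  qed
qed

lemma Ints_le_1_cases: "(a::real) \<in> \<int> \<Longrightarrow> \<bar>a\<bar> < 2 \<Longrightarrow> a = -1 \<or> a = 0 \<or> a = 1"
proof -
  assume "a \<in> \<int>" "\<bar>a\<bar> < 2"
  then obtain z where z: "a = real_of_int z" by (auto elim: Ints_cases)
  then have "-2 < z" "z < 2" using \<open>\<bar>a\<bar> < 2\<close> by linarith+
  then have "z = -1 \<or> z = 0 \<or> z = 1" by arith
  then show ?thesis using z by auto
qed

text \<open>The key is the symmetry \<open>profile c + profile (1 - c) = 1\<close>.\<close>

lemma competitor_core_translates:
  assumes x: "x \<in> competitor_core" and z: "x - g \<in> competitor" and g: "g \<in> fcc"
  shows "g = 0"
proof -
  have x': "\<bar>x $ 3\<bar> < 1" "\<bar>x $ 1\<bar> < profile \<bar>x $ 3\<bar>" "\<bar>x $ 2\<bar> < profile \<bar>x $ 3\<bar>" "\<bar>x $ 1\<bar> + \<bar>x $ 2\<bar> < 1"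
    using x by (auto simp: competitor_core_def)
  have z': "\<bar>x $ 3 - g $ 3\<bar> \<le> 1" "\<bar>x $ 1 - g $ 1\<bar> \<le> profile \<bar>x $ 3 - g $ 3\<bar>"
    "\<bar>x $ 2 - g $ 2\<bar> \<le> profile \<bar>x $ 3 - g $ 3\<bar>" "\<bar>x $ 1 - g $ 1\<bar> + \<bar>x $ 2 - g $ 2\<bar> \<le> 1"
    using z by (auto simp: competitor_def)
  have xi: "\<bar>x $ i\<bar> < 1" for i
    using x' exhaust_3[of i] profile_bounds(1)[of "\<bar>x $ 3\<bar>"] by auto
  have zi: "\<bar>x $ i - g $ i\<bar> \<le> 1" for i using competitor_le_1[OF z, of i] by simp
  have "\<bar>g $ i\<bar> < 2" for i using xi[of i] zi[of i] by linarith
  then have gi: "g $ i = -1 \<or> g $ i = 0 \<or> g $ i = 1" for i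
    using g by (intro Ints_le_1_cases) (auto simp: fcc_def)
  obtain k where k: "g $ 1 + g $ 2 + g $ 3 = 2 * real_of_int k" using g by (auto simp: fcc_def)
  \<comment> \<open>The entries of \<open>g\<close> are -1, 0 or 1 and have even sum, so a nonzero
    \<open>g\<close> would have exactly two nonzero entries. The pair of the first two coordinates
    and the pairs involving the third are excluded separately.\<close>
  have no1: "g $ 1 = 0 \<or> g $ 2 = 0"
  proof (rule ccontr)
    assume "\<not> ?thesis"
    then have "\<bar>g $ 1\<bar> = 1" "\<bar>g $ 2\<bar> = 1" using gi[of 1] gi[of 2] by auto
    then show False using x'(4) z'(4) by (smt (verit))
  qed
  have no2: "g $ i = 0 \<or> g $ 3 = 0" if i: "i = 1 \<or> i = 2" for i
  proof (rule ccontr)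
    assume "\<not> ?thesis"
    then have "\<bar>g $ i\<bar> = 1" "\<bar>g $ 3\<bar> = 1" using gi[of i] gi[of 3] by auto
    then have a: "\<bar>x $ i\<bar> + \<bar>x $ i - g $ i\<bar> \<ge> 1" "\<bar>x $ 3 - g $ 3\<bar> \<ge> 1 - \<bar>x $ 3\<bar>" by linarith+
    have "profile \<bar>x $ 3 - g $ 3\<bar> \<le> 1 - profile \<bar>x $ 3\<bar>"
      using profile_antimono[OF a(2)] by (simp add: profile_flip)
    moreover have "\<bar>x $ i\<bar> < profile \<bar>x $ 3\<bar>" "\<bar>x $ i - g $ i\<bar> \<le> profile \<bar>x $ 3 - g $ 3\<bar>"
      using i x' z' by auto
    ultimately show False using a(1) by linarith
  qed
  have "g $ 1 + g $ 2 + g $ 3 \<noteq> 1" "g $ 1 + g $ 2 + g $ 3 \<noteq> -1"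
  proof -
    have "2 * k \<noteq> 1" "2 * k \<noteq> -1" by presburger+
    then have "real_of_int (2 * k) \<noteq> real_of_int 1" "real_of_int (2 * k) \<noteq> real_of_int (-1)"
      unfolding of_int_eq_iff .
    then show "g $ 1 + g $ 2 + g $ 3 \<noteq> 1" "g $ 1 + g $ 2 + g $ 3 \<noteq> -1" using k by simp_all
  qed
  then have "g $ 1 = 0 \<and> g $ 2 = 0 \<and> g $ 3 = 0"
    using gi[of 1] gi[of 2] gi[of 3] no1 no2[of 1] no2[of 2] by auto
  then show ?thesis by (simp add: vec_eq_iff forall_3)
qed

text \<open>The inscribed ball of the dodecahedron has radius 1 / sqrt 2 < 3/4. The profile is below
  \<open>1 - c\<close> only for \<open>c < 1/4\<close>, and there it still exceeds 3/4.\<close>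

lemma competitor_contains_ball: "norm x \<le> 1 / sqrt 2 \<Longrightarrow> x \<in> competitor"
proof -
  assume "norm x \<le> 1 / sqrt 2"
  then have "(norm x)\<^sup>2 \<le> (1 / sqrt 2)\<^sup>2" by (intro power_mono) auto
  moreover have "(norm x)\<^sup>2 = (x $ 1)\<^sup>2 + (x $ 2)\<^sup>2 + (x $ 3)\<^sup>2"
    unfolding power2_norm_eq_inner by (simp add: inner_vec_def sum_3 power2_eq_square)
  ultimately have x: "(x $ 1)\<^sup>2 + (x $ 2)\<^sup>2 + (x $ 3)\<^sup>2 \<le> 1/2"
    by (simp add: power_divide)
  have pos: "0 \<le> (x $ i)\<^sup>2" for i by simp
  have sum: "\<bar>a\<bar> + \<bar>b\<bar> \<le> 1" if "a\<^sup>2 + b\<^sup>2 \<le> 1/2" for a b :: real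
  proof -
    have "(\<bar>a\<bar> + \<bar>b\<bar>)\<^sup>2 \<le> 2 * (a\<^sup>2 + b\<^sup>2)"
      using zero_le_power2[of "\<bar>a\<bar> - \<bar>b\<bar>"] by (simp add: power2_eq_square algebra_simps)
    then have "(\<bar>a\<bar> + \<bar>b\<bar>)\<^sup>2 \<le> 1\<^sup>2" using that by simp
    then show ?thesis by (rule power2_le_imp_le) simp
  qed
  have small: "\<bar>a\<bar> \<le> 3/4" if "a\<^sup>2 \<le> 1/2" for a :: real
    using that by (intro power2_le_imp_le[of "\<bar>a\<bar>" "3/4"]) (auto simp: power2_eq_square)
  have prof: "a \<le> profile c" if "a + c \<le> 1" "a \<le> 3/4" "0 \<le> c" for a c
    using that by (auto simp: profile_def max_def field_simps)
  have "\<bar>x $ i\<bar> \<le> profile \<bar>x $ 3\<bar>" if "i = 1 \<or> i = 2" for i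
  proof -
    have "(x $ 1)\<^sup>2 + (x $ 3)\<^sup>2 \<le> 1/2" "(x $ 2)\<^sup>2 + (x $ 3)\<^sup>2 \<le> 1/2"
      using x pos[of 1] pos[of 2] by linarith+
    then have "(x $ i)\<^sup>2 + (x $ 3)\<^sup>2 \<le> 1/2" using that by metis
    moreover from this have "(x $ i)\<^sup>2 \<le> 1/2" using pos[of 3] by linarith
    ultimately show ?thesis using sum small by (intro prof) auto
  qed
  moreover have "\<bar>x $ 1\<bar> + \<bar>x $ 2\<bar> \<le> 1"
  proof (rule sum)
    show "(x $ 1)\<^sup>2 + (x $ 2)\<^sup>2 \<le> 1/2" using x pos[of 3] by linarith
  qed
  moreover have "\<bar>x $ 3\<bar> \<le> 1"
  proof -
    have "(x $ 3)\<^sup>2 \<le> 1/2" using x pos[of 1] pos[of 2] by linarith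
    from small[OF this] show ?thesis by simp
  qed
  ultimately show ?thesis by (simp add: competitor_def)
qed

section \<open>Area of the boundary of the competitor\<close>

text \<open>Coordinates are a length along the axis of symmetry and a signed offset from it.
  \<open>region1\<close> is an inclined trapezoid beside a square, with slant height 29/84 and
  half-widths from 1/84 to 1/4. \<open>region2\<close> is half a rhombus without its tip of length
  sqrt 2 / 4 at the vertex of degree four, unchanged from the dodecahedron. \<open>region3\<close>
  is the tip of an upright rhombus, cut back by sqrt 2 / 84. \<open>region4\<close> is the
  square.\<close>

definition region1 :: "(real \<times> real) set" where
  "region1 = {z \<in> {0..29/84} \<times> UNIV. \<bar>snd z\<bar> \<le> 1/84 + 20/29 * fst z}"
definition region2 :: "(real \<times> real) set" where
  "region2 = {z \<in> {sqrt 2 / 4..sqrt 2 / 2} \<times> UNIV. \<bar>snd z\<bar> \<le> fst z / sqrt 2}"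
definition region3 :: "(real \<times> real) set" where
  "region3 = {z \<in> {sqrt 2 / 84..sqrt 2 / 4} \<times> UNIV. \<bar>snd z\<bar> \<le> 21/20 * (fst z / sqrt 2 - 1/84)}"
definition region4 :: "(real \<times> real) set" where
  "region4 = {z \<in> {- 1/84..1/84} \<times> UNIV. \<bar>snd z\<bar> \<le> 1/84}"

lemma strip_measurable:
  fixes a b :: real and w :: "real \<Rightarrow> real"
  assumes [measurable]: "w \<in> borel_measurable borel"
  shows "{z \<in> {a..b} \<times> UNIV. \<bar>snd z\<bar> \<le> w (fst z)} \<in> sets borel"
proof -
  note [measurable] = fst_snd_borel_measurable
  have "{z. a \<le> fst z \<and> fst z \<le> b \<and> \<bar>snd z\<bar> \<le> w (fst z)} \<in> sets borel" by measurable
  moreover have "{z \<in> {a..b} \<times> UNIV. \<bar>snd z\<bar> \<le> w (fst z)} = {z. a \<le> fst z \<and> fst z \<le> b \<and> \<bar>snd z\<bar> \<le> w (fst z)}"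
    by auto
  ultimately show ?thesis by simp
qed

lemma regions_measurable:
  "region1 \<in> sets borel" "region2 \<in> sets borel" "region3 \<in> sets borel" "region4 \<in> sets borel"
  unfolding region1_def region2_def region3_def region4_def by (rule strip_measurable; measurable)+

lemma emeasure_region1: "emeasure lborel region1 = ennreal (638/7056)"
  unfolding region1_def
  by (subst emeasure_symmetric_strip(1)[where F = "\<lambda>p. p / 42 + 20/29 * p\<^sup>2"])
    (auto intro!: derivative_eq_intros simp: power2_eq_square)

lemma emeasure_region2: "emeasure lborel region2 = ennreal (3 * sqrt 2 / 16)"
  unfolding region2_def
  by (subst emeasure_symmetric_strip(1)[where F = "\<lambda>p. p\<^sup>2 / sqrt 2"])
    (auto intro!: derivative_eq_intros simp: power_divide real_div_sqrt field_simps)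

lemma emeasure_region3: "emeasure lborel region3 = ennreal (420 * sqrt 2 / 7056)"
proof -
  have "sqrt 2 / 84 \<le> sqrt 2 / 4" by simp
  have "emeasure lborel region3 = ennreal (21/20 * ((sqrt 2 / 4)\<^sup>2 / sqrt 2 - (sqrt 2 / 4) / 42) - 21/20 * ((sqrt 2 / 84)\<^sup>2 / sqrt 2 - (sqrt 2 / 84) / 42))"
    unfolding region3_def
  proof (rule emeasure_symmetric_strip(1))
    fix t assume "t \<in> {sqrt 2 / 84..sqrt 2 / 4}"
    then have "sqrt 2 / 84 / sqrt 2 \<le> t / sqrt 2" by (intro divide_right_mono) auto
    then show "0 \<le> 21/20 * (t / sqrt 2 - 1/84)" by simp
    show "((\<lambda>p. 21/20 * (p\<^sup>2 / sqrt 2 - p / 42)) has_real_derivative 2 * (21/20 * (t / sqrt 2 - 1/84))) (at t)"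
      by (auto intro!: derivative_eq_intros simp: field_simps)
  qed auto
  also have "21/20 * ((sqrt 2 / 4)\<^sup>2 / sqrt 2 - (sqrt 2 / 4) / 42) - 21/20 * ((sqrt 2 / 84)\<^sup>2 / sqrt 2 - (sqrt 2 / 84) / 42) = 420 * sqrt 2 / 7056"
    by (simp add: power2_eq_square field_simps)
  finally show ?thesis .
qed

lemma emeasure_region4: "emeasure lborel region4 = ennreal (4/7056)"
  unfolding region4_def
  by (subst emeasure_symmetric_strip(1)[where F = "\<lambda>p. p / 42"])
    (auto intro!: derivative_eq_intros)

definition piece_index :: "((3 \<times> 3) \<times> real \<times> real) set" where
  "piece_index = {(1, 2), (2, 1)} \<times> {1, -1} \<times> {1, -1}"

text \<open>\<open>s\<close> is the sign of coordinate \<open>i\<close>; \<open>t\<close> is the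
  sign of coordinate 3 in the first four sets and of coordinate \<open>j\<close> in the last two.
  The first two are the inclined faces near the plane \<open>x $ 3 = 0\<close> and near a pole, the
  next two the unchanged rest of that side rhombus, the last two one half of an upright rhombus. The
  eight indices account for all 24 half rhombi.\<close>

fun pieces :: "(3 \<times> 3) \<times> real \<times> real \<Rightarrow> (real^3) set" where
  "pieces ((i, j), s, t) =
    plane_map (axis i (83/84 * s)) (axis i (- 20/29 * s) + axis 3 (21/29 * t)) (axis j 1) ` region1 \<union>
    plane_map (axis 3 t + axis i (s / 84)) (axis i (20/29 * s) - axis 3 (21/29 * t)) (axis j 1) ` region1 \<union>
    plane_map (axis i s) ((1 / sqrt 2) *\<^sub>R (axis 3 t - axis i s)) (axis j 1) ` region2 \<union>
    plane_map (axis 3 t) ((1 / sqrt 2) *\<^sub>R (axis i s - axis 3 t)) (axis j 1) ` region2 \<union>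
    plane_map (axis i s) ((1 / sqrt 2) *\<^sub>R (axis j t - axis i s)) (axis 3 1) ` region2 \<union>
    plane_map (axis i s) ((1 / sqrt 2) *\<^sub>R (axis j t - axis i s)) (axis 3 1) ` region3"

definition caps :: "real \<Rightarrow> (real^3) set" where
  "caps s = plane_map (axis 3 s) (axis 1 1) (axis 2 1) ` region4"

lemma piece_index_cases:
  assumes "((i, j), s, t) \<in> piece_index"
  shows "i \<noteq> j" "i \<noteq> 3" "j \<noteq> 3" "s * s = 1" "t * t = 1" "s = 1 \<or> s = -1" "t = 1 \<or> t = -1"
  using assms by (auto simp: piece_index_def)

lemma piece_index_UNIV: "((i, j), s, t) \<in> piece_index \<Longrightarrow> k = i \<or> k = j \<or> k = 3"
  using exhaust_3[of k] by (auto simp: piece_index_def)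

lemma hausdorff2_pieces:
  assumes "\<phi> \<in> piece_index"
  shows "hausdorff2 (pieces \<phi>) \<le> hausdorff2_square * ennreal (2 * (638/7056) + 3 * (3 * sqrt 2 / 16) + 420 * sqrt 2 / 7056)"
proof -
  obtain i j s t where \<phi>: "\<phi> = ((i, j), s, t)" by (metis prod.collapse)
  note ij = piece_index_cases[OF assms[unfolded \<phi>]]
  let ?K = hausdorff2_square
  have ax: "norm (axis j 1 :: real^3) = 1" for j by simp
  have n1: "norm (axis i (- 20/29 * s) + axis 3 (21/29 * t) :: real^3) = 1"
    "norm (axis i (20/29 * s) - axis 3 (21/29 * t) :: real^3) = 1"
    using ij by (simp_all add: norm_eq_1 inner_add_left inner_add_right inner_diff_left inner_diff_right inner_axis_axis field_simps)
  have n2: "norm ((1 / sqrt 2) *\<^sub>R (axis k a - axis l b) :: real^3) = 1" if "k \<noteq> l" "a * a = 1" "b * b = 1" for k l a b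
    using that by (simp add: norm_eq_1 inner_diff_left inner_diff_right inner_axis_axis field_simps)
  have H1: "hausdorff2 (plane_map o' u v ` region1) = ?K * ennreal (638/7056)"
    and H2: "hausdorff2 (plane_map o' u v ` region2) = ?K * ennreal (3 * sqrt 2 / 16)"
    and H3: "hausdorff2 (plane_map o' u v ` region3) = ?K * ennreal (420 * sqrt 2 / 7056)"
    if "norm u = 1" "norm v = 1" "u \<bullet> v = 0" for o' u v :: "real^3"
    using that by (simp_all add: hausdorff2_plane_map regions_measurable emeasure_region1 emeasure_region2 emeasure_region3)
  have "hausdorff2 (pieces \<phi>) \<le> ?K * ennreal (638/7056) + ?K * ennreal (638/7056)
      + ?K * ennreal (3 * sqrt 2 / 16) + ?K * ennreal (3 * sqrt 2 / 16) + ?K * ennreal (3 * sqrt 2 / 16)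
      + ?K * ennreal (420 * sqrt 2 / 7056)"
    unfolding \<phi> pieces.simps
    by (intro order_trans[OF hausdorff2_Un_le] add_mono order_eq_refl H1 H2 H3 n1 n2 ax;
        use ij in \<open>simp add: inner_add_left inner_diff_left inner_axis_axis\<close>)
  also have "\<dots> = ?K * ennreal (2 * (638/7056) + 3 * (3 * sqrt 2 / 16) + 420 * sqrt 2 / 7056)"
    by (simp flip: distrib_left ennreal_plus)
  finally show ?thesis .
qed

lemma hausdorff2_caps: "s * s = 1 \<Longrightarrow> hausdorff2 (caps s) = hausdorff2_square * ennreal (4/7056)"
  unfolding caps_def
  by (simp add: hausdorff2_plane_map regions_measurable emeasure_region4 inner_axis_axis)

lemma sign_abs: obtains s :: real where "s = 1 \<or> s = -1" "a = s * \<bar>a\<bar>"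
  by (metis abs_if minus_minus mult_1 mult_minus1)

text \<open>A point of the shell satisfies one of the defining inequalities with equality, and
  symmetry reduces it to the moduli of the coordinates. A covering is enough, as overlapping pieces
  do no harm to an upper bound.\<close>

lemma competitor_shell_cover:
  "competitor - competitor_core \<subseteq> (\<Union>s\<in>{1, -1}. caps s) \<union> (\<Union>\<phi>\<in>piece_index. pieces \<phi>)"
proof
  fix x assume x: "x \<in> competitor - competitor_core"
  define c where "c = \<bar>x $ 3\<bar>"
  have c: "0 \<le> c" "c \<le> 1" "\<bar>x $ 1\<bar> \<le> profile c" "\<bar>x $ 2\<bar> \<le> profile c" "\<bar>x $ 1\<bar> + \<bar>x $ 2\<bar> \<le> 1"
    using x by (auto simp: competitor_def c_def)
  obtain s1 where s1: "s1 = 1 \<or> s1 = -1" "x $ 1 = s1 * \<bar>x $ 1\<bar>" by (rule sign_abs)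
  obtain s2 where s2: "s2 = 1 \<or> s2 = -1" "x $ 2 = s2 * \<bar>x $ 2\<bar>" by (rule sign_abs)
  obtain s3 where s3': "s3 = 1 \<or> s3 = -1" "x $ 3 = s3 * \<bar>x $ 3\<bar>" by (rule sign_abs)
  then have s3: "s3 = 1 \<or> s3 = -1" "x $ 3 = s3 * c" unfolding c_def by blast+
  \<comment> \<open>Points of the side faces. The second bound on \<open>x $ j\<close> expresses
    that the first two moduli sum to at most 1. The lower two ranges of \<open>c\<close> are
    parametrised from the plane \<open>x $ 3 = 0\<close>, the upper two from the pole.\<close>
  have side: "x \<in> pieces ((i, j), s, s3)"
    if \<phi>: "((i, j), s, s3) \<in> piece_index" and xi: "x $ i = s * profile c" and xj: "\<bar>x $ j\<bar> \<le> profile c" "\<bar>x $ j\<bar> \<le> 1 - profile c"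
    for i j s
  proof -
    note ij = piece_index_cases[OF \<phi>]
    have eqI: "x = y" if "x $ i = y $ i" "x $ j = y $ j" "x $ 3 = y $ 3" for y
      unfolding vec_eq_iff
    proof
      fix l
      show "x $ l = y $ l" using that piece_index_UNIV[OF \<phi>, of l] by auto
    qed
    consider "c \<le> 1/4" | "1/4 \<le> c" "c \<le> 1/2" | "1/2 \<le> c" "c \<le> 3/4" | "3/4 \<le> c" by linarith
    then show ?thesis
    proof cases
      case 1
      \<comment> \<open>The factor 29/21 converts height into length along the face, which recedes
        by 20 for every 21 of height.\<close>
      have "x = plane_map (axis i (83/84 * s)) (axis i (- 20/29 * s) + axis 3 (21/29 * s3)) (axis j 1) (29/21 * c, x $ j)"
        by (rule eqI) (use ij xi s3(2) profile_cases(1)[OF 1] in \<open>simp_all add: plane_map_def axis_def algebra_simps\<close>)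
      moreover have "(29/21 * c, x $ j) \<in> region1"
        using 1 c xj profile_cases(1)[OF 1] by (simp add: region1_def)
      ultimately show ?thesis unfolding pieces.simps by blast
    next
      case 2
      have pc: "profile c = 1 - c" using 2 by (intro profile_cases(2)) auto
      have "x = plane_map (axis i s) ((1 / sqrt 2) *\<^sub>R (axis 3 s3 - axis i s)) (axis j 1) (sqrt 2 * c, x $ j)"
        by (rule eqI) (use ij xi s3(2) pc in \<open>simp_all add: plane_map_def axis_def algebra_simps\<close>)
      moreover have "(sqrt 2 * c, x $ j) \<in> region2"
        using 2 xj pc by (simp add: region2_def)
      ultimately show ?thesis unfolding pieces.simps by blast
    next
      case 3
      have pc: "profile c = 1 - c" using 3 by (intro profile_cases(2)) auto
      have "x = plane_map (axis 3 s3) ((1 / sqrt 2) *\<^sub>R (axis i s - axis 3 s3)) (axis j 1) (sqrt 2 * (1 - c), x $ j)"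
        by (rule eqI) (use ij xi s3(2) pc in \<open>simp_all add: plane_map_def axis_def algebra_simps\<close>)
      moreover have "(sqrt 2 * (1 - c), x $ j) \<in> region2"
      proof -
        have "sqrt 2 * (1/4) \<le> sqrt 2 * (1 - c)" "sqrt 2 * (1 - c) \<le> sqrt 2 * (1/2)"
          using 3 by (intro mult_left_mono; simp)+
        then show ?thesis using xj pc by (simp add: region2_def)
      qed
      ultimately show ?thesis unfolding pieces.simps by blast
    next
      case 4
      have "x = plane_map (axis 3 s3 + axis i (s / 84)) (axis i (20/29 * s) - axis 3 (21/29 * s3)) (axis j 1) (29/21 * (1 - c), x $ j)"
        by (rule eqI) (use ij xi s3(2) profile_cases(3)[OF 4] in \<open>simp_all add: plane_map_def axis_def field_simps\<close>)
      moreover have "(29/21 * (1 - c), x $ j) \<in> region1"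
        using 4 c xj profile_cases(3)[OF 4] by (simp add: region1_def field_simps)
      ultimately show ?thesis unfolding pieces.simps by blast
    qed
  qed
  \<comment> \<open>Points of the upright facets. \<open>d\<close> is the smaller of the first two
    moduli, so the nearest vertex of degree four in the facet plane is on axis
    \<open>i\<close>.\<close>
  have edge: "x \<in> pieces ((i, j), s, t)"
    if \<phi>: "((i, j), s, t) \<in> piece_index" and xi: "x $ i = s * (1 - d)" and xj: "x $ j = t * d"
      and d: "0 \<le> d" "d \<le> 1/2" and pc: "1 - d \<le> profile c"
    for i j s t d
  proof -
    note ij = piece_index_cases[OF \<phi>]
    have eqI: "x = y" if "x $ i = y $ i" "x $ j = y $ j" "x $ 3 = y $ 3" for y
      unfolding vec_eq_iff
    proof
      fix l
      show "x $ l = y $ l" using that piece_index_UNIV[OF \<phi>, of l] by auto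
    qed
    have eq: "x = plane_map (axis i s) ((1 / sqrt 2) *\<^sub>R (axis j t - axis i s)) (axis 3 1) (sqrt 2 * d, x $ 3)"
      by (rule eqI) (use ij xi xj in \<open>simp_all add: plane_map_def axis_def algebra_simps\<close>)
    have "c \<le> 3/4" using pc d c profile_cases(3)[of c] by force
    then have cd: "c \<le> d" using pc profile_cases(1,2)[of c] c by (cases "c \<le> 1/4") auto
    show ?thesis
    proof (cases "1/4 \<le> d")
      case True
      then have "(sqrt 2 * d, x $ 3) \<in> region2" using cd d by (simp add: region2_def c_def)
      then show ?thesis using eq unfolding pieces.simps by blast
    next
      case False
      then have "1 - d \<le> 83/84 - 20/21 * c" using cd pc profile_cases(1)[of c] by simp
      moreover from this have "sqrt 2 * (1/84) \<le> sqrt 2 * d" using c by (intro mult_left_mono) auto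
      ultimately have "(sqrt 2 * d, x $ 3) \<in> region3" using False by (simp add: region3_def c_def)
      then show ?thesis using eq unfolding pieces.simps by blast
    qed
  qed
  consider "c = 1" | "\<bar>x $ 1\<bar> = profile c" | "\<bar>x $ 2\<bar> = profile c" | "\<bar>x $ 1\<bar> + \<bar>x $ 2\<bar> = 1"
    using x c unfolding competitor_core_def c_def by force
  then show "x \<in> (\<Union>s\<in>{1, -1}. caps s) \<union> (\<Union>\<phi>\<in>piece_index. pieces \<phi>)"
  proof cases
    case 1
    then have "(x $ 1, x $ 2) \<in> region4" using c by (auto simp: region4_def profile_def abs_le_iff)
    moreover have "x = plane_map (axis 3 s3) (axis 1 1) (axis 2 1) (x $ 1, x $ 2)"
      using 1 s3 by (simp add: plane_map_def vec_eq_iff forall_3 axis_def)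
    ultimately have "x \<in> caps s3" unfolding caps_def by blast
    then show ?thesis using s3(1) by blast
  next
    case 2
    have \<phi>: "((1, 2), s1, s3) \<in> piece_index" using s1(1) s3(1) by (auto simp: piece_index_def)
    have "x \<in> pieces ((1, 2), s1, s3)" using 2 s1(2) c by (intro side[OF \<phi>]) auto
    then show ?thesis using \<phi> by blast
  next
    case 3
    have \<phi>: "((2, 1), s2, s3) \<in> piece_index" using s2(1) s3(1) by (auto simp: piece_index_def)
    have "x \<in> pieces ((2, 1), s2, s3)" using 3 s2(2) c by (intro side[OF \<phi>]) auto
    then show ?thesis using \<phi> by blast
  next
    case 4
    show ?thesis
    proof (cases "\<bar>x $ 2\<bar> \<le> 1/2")
      case True
      have \<phi>: "((1, 2), s1, s2) \<in> piece_index" using s1(1) s2(1) by (auto simp: piece_index_def)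
      have "\<bar>x $ 1\<bar> = 1 - \<bar>x $ 2\<bar>" using 4 by simp
      then have "x \<in> pieces ((1, 2), s1, s2)" using True s1(2) s2(2) c by (intro edge[OF \<phi>, of "\<bar>x $ 2\<bar>"]) auto
      then show ?thesis using \<phi> by blast
    next
      case False
      have \<phi>: "((2, 1), s2, s1) \<in> piece_index" using s1(1) s2(1) by (auto simp: piece_index_def)
      have "\<bar>x $ 2\<bar> = 1 - \<bar>x $ 1\<bar>" using 4 by simp
      then have "x \<in> pieces ((2, 1), s2, s1)" using False s1(2) s2(2) c by (intro edge[OF \<phi>, of "\<bar>x $ 1\<bar>"]) auto
      then show ?thesis using \<phi> by blast
    qed
  qed
qed

lemma negligible_plane_map: "negligible (plane_map o' u v ` S)" for o' u v :: "real^3"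
proof -
  have "plane_map o' u v z \<in> (+) o' ` span {u, v}" for z
  proof -
    have "fst z *\<^sub>R u + snd z *\<^sub>R v \<in> span {u, v}"
      by (intro span_add span_scale span_base) auto
    then show ?thesis unfolding plane_map_def add.assoc by (rule imageI)
  qed
  then have "plane_map o' u v ` S \<subseteq> (+) o' ` span {u, v}" by blast
  moreover have "dim (span {u, v}) < DIM(real^3)"
  proof -
    have "dim {u, v} \<le> card {u, v}" by (rule dim_le_card') simp
    also have "\<dots> \<le> 2" by (simp add: card_insert_if)
    finally show ?thesis by simp
  qed
  then have "negligible ((+) o' ` span {u, v})"
    by (intro negligible_translation negligible_lowdim)
  ultimately show ?thesis by (rule negligible_subset[rotated])
qed

lemma negligible_competitor_shell: "negligible (competitor - competitor_core)"
proof (rule negligible_subset[OF _ competitor_shell_cover])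
  have caps: "negligible (caps s)" for s
    unfolding caps_def by (rule negligible_plane_map)
  have pieces: "negligible (pieces \<phi>)" for \<phi>
    by (induction \<phi> rule: pieces.induct)
      (unfold pieces.simps, intro negligible_Un negligible_plane_map)
  have "finite piece_index" by (simp add: piece_index_def)
  then have "negligible (\<Union>(pieces ` piece_index))" by (intro negligible_Union) (auto intro: pieces)
  moreover have "negligible (\<Union>(caps ` {1, -1}))" by (intro negligible_Union) (auto intro: caps)
  ultimately show "negligible ((\<Union>s\<in>{1, -1}. caps s) \<union> (\<Union>\<phi>\<in>piece_index. pieces \<phi>))"
    by (intro negligible_Un)
qed

text \<open>The denominator is 84^2. 10216 = 2 * 4 + 16 * 638 comes from the two squares and the
  inclined trapezoids, 3360 = 8 * 420 from the shortened tips, and 9/2 = 24 * 3/16 from the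
  unchanged parts of the rhombi.\<close>

definition competitor_area :: real where
  "competitor_area = 10216/7056 + sqrt 2 * (3360/7056 + 9/2)"

lemma hausdorff2_competitor_shell:
  "hausdorff2 (competitor - competitor_core) \<le> hausdorff2_square * ennreal competitor_area"
proof -
  let ?K = hausdorff2_square
  let ?a = "2 * (638/7056) + 3 * (3 * sqrt 2 / 16) + 420 * sqrt 2 / 7056"
  have fin: "finite piece_index" "card piece_index = 8"
    by (simp_all add: piece_index_def card_cartesian_product)
  have "hausdorff2 (competitor - competitor_core) \<le> hausdorff2 (\<Union>s\<in>{1, -1}. caps s) + hausdorff2 (\<Union>\<phi>\<in>piece_index. pieces \<phi>)"
    by (rule order_trans[OF hausdorff2_mono[OF competitor_shell_cover] hausdorff2_Un_le])
  also have "\<dots> \<le> (\<Sum>s\<in>{1, -1::real}. ?K * ennreal (4/7056)) + (\<Sum>\<phi>\<in>piece_index. ?K * ennreal ?a)"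
    using fin hausdorff2_pieces
    by (intro add_mono order_trans[OF hausdorff2_finite_UN_le] sum_mono) (auto simp: hausdorff2_caps)
  also have "\<dots> = ?K * ennreal competitor_area"
  proof -
    have "(\<Sum>s\<in>{1, -1::real}. ?K * ennreal (4/7056)) = ?K * ennreal (2 * (4/7056))"
      by (simp add: mult_2 flip: distrib_left ennreal_plus)
    moreover have "(\<Sum>\<phi>\<in>piece_index. ?K * ennreal ?a) = ?K * ennreal (8 * ?a)"
      by (subst ennreal_mult) (auto simp: fin mult.left_commute)
    ultimately have "(\<Sum>s\<in>{1, -1::real}. ?K * ennreal (4/7056)) + (\<Sum>\<phi>\<in>piece_index. ?K * ennreal ?a)
      = ?K * ennreal (2 * (4/7056) + 8 * ?a)"
      by (simp only: ennreal_plus flip: distrib_left) (subst ennreal_plus, auto)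
    also have "2 * (4/7056) + 8 * ?a = competitor_area"
      by (simp add: competitor_area_def algebra_simps)
    finally show ?thesis .
  qed
  finally show ?thesis .
qed

lemma competitor_area_less: "competitor_area < 6 * sqrt 2" "0 \<le> competitor_area"
proof -
  \<comment> \<open>Solving the claim for sqrt 2 gives exactly this fraction, 10216 / 7224 with 7224
    = 3/2 * 7056 - 3360. The margin is narrow: 1277^2 = 1630729 against 2 * 903^2 = 1630818.\<close>
  have "1277 / 903 < sqrt 2" by (rule real_less_rsqrt) (simp add: power2_eq_square)
  then show "competitor_area < 6 * sqrt 2" by (simp add: competitor_area_def algebra_simps)
qed (simp add: competitor_area_def)

section \<open>Perimeter of the competitor\<close>

text \<open>\<open>competitor\<close> is not convex, since \<open>profile\<close> has a convex kink
  at 3/4; hence the weaker property. For \<open>c \<ge> 3/4\<close> the affine function 27/28 -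
  20/21 c equals \<open>profile\<close>, and it bounds \<open>profile\<close> from below everywhere.
  For smaller \<open>c\<close> the profile is the minimum of two affine functions, and this minimum
  also never exceeds \<open>profile\<close>. Affine bounds survive the passage to convex
  combinations.\<close>

lemma competitor_starlike:
  assumes x: "x \<in> competitor" and w: "norm w \<le> 1/4" and t: "0 \<le> t" "t \<le> 1"
  shows "(1 - t) *\<^sub>R x + t *\<^sub>R w \<in> competitor"
proof -
  let ?y = "(1 - t) *\<^sub>R x + t *\<^sub>R w"
  have mono: "(1 - t) * a + t * b \<le> (1 - t) * a' + t * b'" if "a \<le> a'" "b \<le> b'" for a b a' b'
    using that t by (intro add_mono mult_left_mono) auto
  have y: "\<bar>?y $ i\<bar> \<le> (1 - t) * \<bar>x $ i\<bar> + t * (1/4)" for i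
  proof -
    have "\<bar>?y $ i\<bar> \<le> (1 - t) * \<bar>x $ i\<bar> + t * \<bar>w $ i\<bar>"
      using t abs_triangle_ineq[of "(1 - t) * x $ i" "t * w $ i"] by (simp add: abs_mult)
    also have "\<dots> \<le> (1 - t) * \<bar>x $ i\<bar> + t * (1/4)"
      using component_le_norm_cart[of w i] w by (intro mono) auto
    finally show ?thesis .
  qed
  define c where "c = \<bar>x $ 3\<bar>"
  define d where "d = (1 - t) * c + t * (1/4)"
  have line: "(1 - t) * a + t * (1/4) \<le> \<alpha> - \<beta> * d"
    if "a \<le> \<alpha> - \<beta> * c" "1/4 \<le> \<alpha> - \<beta> * (1/4)" for a \<alpha> \<beta>
  proof -
    have "(1 - t) * a + t * (1/4) \<le> (1 - t) * (\<alpha> - \<beta> * c) + t * (\<alpha> - \<beta> * (1/4))" by (intro mono that)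
    also have "\<dots> = \<alpha> - \<beta> * d" by (simp add: d_def algebra_simps)
    finally show ?thesis .
  qed
  have prof: "(1 - t) * a + t * (1/4) \<le> profile d" if "a \<le> profile c" for a
  proof (cases "3/4 \<le> c")
    case True
    have "(1 - t) * a + t * (1/4) \<le> 27/28 - 20/21 * d"
      using that profile_cases(3)[OF True] by (intro line) auto
    then show ?thesis by (auto simp: profile_def max_def field_simps)
  next
    case False
    then have "a \<le> 1 - 1 * c" "a \<le> 83/84 - 20/21 * c"
      using that by (auto simp: profile_def max_def field_simps split: if_splits)
    then have "(1 - t) * a + t * (1/4) \<le> 1 - 1 * d" "(1 - t) * a + t * (1/4) \<le> 83/84 - 20/21 * d"
      by (intro line; simp)+
    then show ?thesis by (auto simp: profile_def max_def field_simps)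
  qed
  have x': "c \<le> 1" "\<bar>x $ 1\<bar> \<le> profile c" "\<bar>x $ 2\<bar> \<le> profile c" "\<bar>x $ 1\<bar> + \<bar>x $ 2\<bar> \<le> 1"
    using x by (auto simp: competitor_def c_def)
  have "\<bar>?y $ 3\<bar> \<le> d" using y[of 3] by (simp add: d_def c_def)
  then have "profile d \<le> profile \<bar>?y $ 3\<bar>" by (rule profile_antimono)
  then have "\<bar>?y $ 1\<bar> \<le> profile \<bar>?y $ 3\<bar>" "\<bar>?y $ 2\<bar> \<le> profile \<bar>?y $ 3\<bar>"
    using y[of 1] prof[OF x'(2)] y[of 2] prof[OF x'(3)] by linarith+
  moreover have "\<bar>?y $ 3\<bar> \<le> 1"
    using \<open>\<bar>?y $ 3\<bar> \<le> d\<close> mono[OF x'(1), of "1/4" 1] by (simp add: d_def)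
  moreover have "\<bar>?y $ 1\<bar> + \<bar>?y $ 2\<bar> \<le> 1"
  proof -
    have "\<bar>?y $ 1\<bar> + \<bar>?y $ 2\<bar> \<le> (1 - t) * (\<bar>x $ 1\<bar> + \<bar>x $ 2\<bar>) + t * (1/2)"
      using y[of 1] y[of 2] by (simp add: algebra_simps)
    also have "\<dots> \<le> (1 - t) * 1 + t * 1" by (intro mono x') simp
    finally show ?thesis by simp
  qed
  ultimately show ?thesis by (simp only: competitor_def mem_Collect_eq)
qed

lemma lipschitz_shift_competitor:
  assumes k: "k > 0"
  shows "lipschitz_shift ((*\<^sub>R) k ` competitor)"
proof (rule lipschitz_shift_starlike)
  show "compact ((*\<^sub>R) k ` competitor)"
    using bounded_competitor closed_competitor by (intro compact_scaling) (simp add: compact_eq_bounded_closed)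
  fix y w :: "real^3" and t :: real
  assume y: "y \<in> (*\<^sub>R) k ` competitor" and w: "norm w \<le> k * (1/4)" and t: "0 \<le> t" "t \<le> 1"
  obtain x where x: "x \<in> competitor" "y = k *\<^sub>R x" using y by blast
  have "norm ((1 / k) *\<^sub>R w) \<le> 1/4" using w k by (simp add: field_simps)
  from competitor_starlike[OF x(1) this t]
  have "k *\<^sub>R ((1 - t) *\<^sub>R x + t *\<^sub>R (1 / k) *\<^sub>R w) \<in> (*\<^sub>R) k ` competitor" by (rule imageI)
  then show "(1 - t) *\<^sub>R y + t *\<^sub>R w \<in> (*\<^sub>R) k ` competitor"
    using k by (simp add: x(2) scaleR_add_right mult.commute)
qed (use k in simp)

text \<open>Star-shapedness rules out the default value infinity of \<open>Per\<close>; the reduced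
  boundary then lies in the frontier, which is part of the scaled shell.\<close>

lemma Per_competitor:
  assumes "k > 0"
  shows "Per ((*\<^sub>R) k ` competitor) \<le> hausdorff2_square * ennreal (k\<^sup>2 * competitor_area)"
proof -
  let ?D = "(*\<^sub>R) k ` competitor" and ?O = "(*\<^sub>R) k ` competitor_core"
    and ?S = "(*\<^sub>R) k ` (competitor - competitor_core)"
  have cl: "closed ?D" by (rule closed_scaling[OF closed_competitor])
  have op: "open ?O" using assms by (intro open_scaling open_competitor_core) auto
  have "?O \<subseteq> ?D" by (auto simp: competitor_core_def competitor_def)
  then have "?O \<subseteq> interior ?D" using op by (rule interior_maximal)
  then have "frontier ?D \<subseteq> ?D - ?O" using cl by (auto simp: frontier_def)
  also have "\<dots> \<subseteq> ?S" by blast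
  finally have fr: "frontier ?D \<subseteq> ?S" .
  have "Per ?D = hausdorff2 (reduced_boundary ?D)"
    using lipschitz_shift_finite_perimeter[OF lipschitz_shift_competitor[OF assms]] by (simp add: Per_def)
  also have "\<dots> \<le> hausdorff2 (?S)"
    using reduced_boundary_subset_frontier[of ?D] cl fr by (intro hausdorff2_mono) auto
  also have "\<dots> = ennreal (k\<^sup>2) * hausdorff2 (competitor - competitor_core)"
    using assms by (intro hausdorff2_similar_image) (auto simp: dist_norm simp flip: scaleR_diff_right)
  also have "\<dots> \<le> ennreal (k\<^sup>2) * (hausdorff2_square * ennreal competitor_area)"
    by (intro mult_left_mono hausdorff2_competitor_shell) simp
  also have "\<dots> = hausdorff2_square * ennreal (k\<^sup>2 * competitor_area)"
    using competitor_area_less(2) by (simp add: ennreal_mult mult.left_commute)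
  finally show ?thesis .
qed

section \<open>The face-centered cubic lattice\<close>

text \<open>An integer and its square have the same parity, so the squared norm is a positive even
  integer.\<close>

lemma fcc_norm:
  assumes "z \<in> fcc" "z \<noteq> 0"
  shows "sqrt 2 \<le> norm z"
proof -
  have "\<forall>i. \<exists>n. z $ i = real_of_int n" using assms(1) by (auto simp: fcc_def elim!: Ints_cases)
  then obtain n where n: "\<And>i. z $ i = real_of_int (n i)" by metis
  obtain k where "z $ 1 + z $ 2 + z $ 3 = 2 * real_of_int k" using assms(1) by (auto simp: fcc_def)
  then have "real_of_int (n 1 + n 2 + n 3) = real_of_int (2 * k)" by (simp add: n)
  then have "n 1 + n 2 + n 3 = 2 * k" by (simp only: of_int_eq_iff)
  then have "even (n 1 + n 2 + n 3)" by simp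
  then have ev: "even ((n 1)\<^sup>2 + (n 2)\<^sup>2 + (n 3)\<^sup>2)" by simp
  have "\<not> (n 1 = 0 \<and> n 2 = 0 \<and> n 3 = 0)" using assms(2) n by (auto simp: vec_eq_iff forall_3)
  then have "(n 1)\<^sup>2 + (n 2)\<^sup>2 + (n 3)\<^sup>2 > 0"
    by (metis add_nonneg_nonneg add_pos_nonneg add_nonneg_pos zero_less_power2 zero_le_power2)
  moreover obtain p where "(n 1)\<^sup>2 + (n 2)\<^sup>2 + (n 3)\<^sup>2 = 2 * p" using ev by (elim evenE)
  ultimately have "2 \<le> (n 1)\<^sup>2 + (n 2)\<^sup>2 + (n 3)\<^sup>2" by simp
  then have "real_of_int 2 \<le> real_of_int ((n 1)\<^sup>2 + (n 2)\<^sup>2 + (n 3)\<^sup>2)" by (simp only: of_int_le_iff)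
  moreover have "z \<bullet> z = real_of_int ((n 1)\<^sup>2 + (n 2)\<^sup>2 + (n 3)\<^sup>2)"
    by (simp add: inner_vec_def sum_3 n power2_eq_square)
  ultimately show ?thesis unfolding norm_eq_sqrt_inner by simp
qed

lemma fcc_group: "0 \<in> fcc" "x \<in> fcc \<Longrightarrow> y \<in> fcc \<Longrightarrow> x + y \<in> fcc" "x \<in> fcc \<Longrightarrow> - x \<in> fcc"
proof -
  show "0 \<in> fcc" by (auto simp: fcc_def intro: exI[of _ 0])
  assume x: "x \<in> fcc"
  then obtain k where k: "x $ 1 + x $ 2 + x $ 3 = 2 * real_of_int k" by (auto simp: fcc_def)
  show "- x \<in> fcc" using x k by (auto simp: fcc_def intro!: exI[of _ "- k"])
  assume y: "y \<in> fcc"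
  then obtain l where l: "y $ 1 + y $ 2 + y $ 3 = 2 * real_of_int l" by (auto simp: fcc_def)
  have "(x + y) $ 1 + (x + y) $ 2 + (x + y) $ 3 = 2 * real_of_int (k + l)"
    using k l by simp
  moreover have "(x + y) $ i \<in> \<int>" for i using x y by (auto simp: fcc_def)
  ultimately show "x + y \<in> fcc" unfolding fcc_def by blast
qed

text \<open>The minimal norm \<open>k * sqrt 2\<close>, attained at multiples of
  \<open>e_1 + e_2\<close>, gives both discreteness and the inradius. The rank is full because
  \<open>2 * e_i\<close> lies in \<open>fcc\<close>.\<close>

lemma scaled_fcc_lattice:
  assumes k: "k > 0"
  shows "(*\<^sub>R) k ` fcc \<in> lattices_of_inradius (k / sqrt 2)"
proof -
  let ?G = "(*\<^sub>R) k ` fcc"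
  have norm_G: "k * sqrt 2 \<le> norm g" if "g \<in> ?G" "g \<noteq> 0" for g
    using that fcc_norm k by (auto intro!: mult_left_mono)
  have add: "x + y \<in> ?G" if "x \<in> ?G" "y \<in> ?G" for x y
    using that fcc_group(2) by (auto simp flip: scaleR_add_right)
  have neg: "- x \<in> ?G" if "x \<in> ?G" for x
    using that fcc_group(3) by (auto simp flip: scaleR_minus_right)
  have "discrete ?G"
  proof (rule discreteI)
    fix x assume x: "x \<in> ?G"
    have "ball x (k * sqrt 2) \<inter> ?G = {x}"
    proof -
      have "y = x" if "y \<in> ball x (k * sqrt 2)" "y \<in> ?G" for y
      proof (rule ccontr)
        assume "y \<noteq> x"
        then have "k * sqrt 2 \<le> norm (x + - y)" using add[OF x neg[OF that(2)]] by (intro norm_G) auto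
        then show False using that(1) by (simp add: dist_norm)
      qed
      moreover have "x \<in> ball x (k * sqrt 2) \<inter> ?G" using x k by simp
      ultimately show ?thesis by blast
    qed
    then show "x isolated_in ?G" unfolding isolated_in_def using x by (metis open_ball)
  qed
  moreover have "dim ?G = 3"
  proof -
    have "axis i 1 \<in> span ?G" for i
    proof -
      have "axis i 2 \<in> fcc" using exhaust_3[of i] unfolding fcc_def
        by (auto simp: axis_def intro!: exI[of _ 1])
      then have "k *\<^sub>R axis i 2 \<in> span ?G" by (intro span_base imageI)
      then have "(1 / (2 * k)) *\<^sub>R (k *\<^sub>R axis i 2) \<in> span ?G" by (rule span_scale)
      moreover have "(1 / (2 * k)) *\<^sub>R (k *\<^sub>R axis i 2) = (axis i 1 :: real^3)"
        using k by (simp add: vec_eq_iff axis_def)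
      ultimately show ?thesis by simp
    qed
    then have "Basis \<subseteq> span ?G" by (auto simp: Basis_vec_def)
    then have "span ?G = UNIV" by (metis span_Basis span_mono span_span top.extremum_unique)
    then show ?thesis using dim_eq_full[of ?G] by simp
  qed
  ultimately have "lattice3 ?G"
    unfolding lattice3_def using add neg fcc_group(1) by (auto intro!: image_eqI[of 0 _ 0])
  moreover have "inradius ?G = k / sqrt 2"
  proof -
    have "axis 1 1 + axis 2 1 \<in> fcc" by (auto simp: fcc_def axis_def intro!: exI[of _ 1])
    moreover have nrm: "norm (axis 1 1 + axis 2 1 :: real^3) = sqrt 2"
      by (simp add: norm_eq_sqrt_inner inner_add_left inner_add_right inner_axis_axis)
    ultimately have "k * sqrt 2 \<in> norm ` (?G - {0})"
      using k by (intro image_eqI[of _ _ "k *\<^sub>R (axis 1 1 + axis 2 1)"]) auto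
    then have "(INF g\<in>?G - {0}. norm g) = k * sqrt 2"
      using norm_G by (intro cInf_eq_minimum) auto
    then show ?thesis unfolding inradius_def using k by (simp add: real_div_sqrt field_simps)
  qed
  ultimately show ?thesis by (simp add: lattices_of_inradius_def)
qed

text \<open>Overlaps of \<open>competitor\<close> with its translates lie in the scaled shell and
  are therefore null, while the covering is exact. The ball condition is met with centre 0.\<close>

lemma scaled_competitor_domain:
  assumes k: "k > 0"
  shows "(*\<^sub>R) k ` competitor \<in> ball_fundamental_domains (k / sqrt 2) ((*\<^sub>R) k ` fcc)"
proof -
  let ?D = "(*\<^sub>R) k ` competitor" and ?I = "\<lambda>g. (\<lambda>x. x + g) ` (*\<^sub>R) k ` competitor \<inter> (*\<^sub>R) k ` competitor"
    and ?S = "(*\<^sub>R) k ` (competitor - competitor_core)"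
  have "closed ?D" by (rule closed_scaling[OF closed_competitor])
  then have "?D \<in> sets lebesgue" by (simp add: borel_closed)
  moreover have "?I g \<in> null_sets lebesgue" if g: "g \<in> (*\<^sub>R) k ` fcc - {0}" for g
  proof -
    obtain h where h: "h \<in> fcc" "g = k *\<^sub>R h" "h \<noteq> 0" using g by auto
    have "negligible (?S)"
      by (intro negligible_differentiable_image_negligible negligible_competitor_shell)
        (auto intro!: derivative_intros)
    moreover have "?I g \<subseteq> ?S"
    proof
      fix y assume "y \<in> ?I g"
      then obtain x x' where x: "x \<in> competitor" "y = k *\<^sub>R x" and x': "x' \<in> competitor" "y = k *\<^sub>R x' + g" by auto
      then have "k *\<^sub>R (x - h) = k *\<^sub>R x'" by (simp add: h(2) algebra_simps)
      then have "x - h = x'" using k by simp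
      then have "x \<notin> competitor_core" using competitor_core_translates[of x h] h x'(1) by auto
      then show "y \<in> ?S" using x by blast
    qed
    ultimately show ?thesis using negligible_subset by (auto simp: negligible_iff_null_sets)
  qed
  moreover have cov: "UNIV - (\<Union>g\<in>(*\<^sub>R) k ` fcc. (\<lambda>x. x + g) ` ?D) \<in> null_sets lebesgue"
  proof -
    have "y \<in> (\<Union>g\<in>(*\<^sub>R) k ` fcc. (\<lambda>x. x + g) ` ?D)" for y
    proof -
      obtain h where h: "h \<in> fcc" "(1 / k) *\<^sub>R y - h \<in> competitor" using fcc_covers by blast
      have "y = k *\<^sub>R ((1 / k) *\<^sub>R y - h) + k *\<^sub>R h" using k by (simp add: algebra_simps)
      then show ?thesis using h by blast
    qed
    then have "UNIV - (\<Union>g\<in>(*\<^sub>R) k ` fcc. (\<lambda>x. x + g) ` ?D) = {}" by blast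
    then show ?thesis by (simp only: null_sets.empty_sets)
  qed
  have in_D: "y \<in> ?D" if "norm y \<le> k / sqrt 2" for y
  proof -
    have "norm ((1 / k) *\<^sub>R y) \<le> 1 / sqrt 2" using that k by (simp add: field_simps)
    then have "(1 / k) *\<^sub>R y \<in> competitor" by (rule competitor_contains_ball)
    moreover have "y = k *\<^sub>R ((1 / k) *\<^sub>R y)" using k by simp
    ultimately show ?thesis by blast
  qed
  have "ball 0 (k / sqrt 2) \<subseteq> ?D"
    by (intro subsetI in_D) simp
  then have "ball 0 (k / sqrt 2) - ?D = {}" by blast
  then have "ball 0 (k / sqrt 2) - ?D \<in> null_sets lebesgue" by (simp only: null_sets.empty_sets)
  moreover have "0 \<in> ?D" using k by (intro in_D) simp
  ultimately show ?thesis
    unfolding ball_fundamental_domains_def fundamental_domains_def mem_Collect_eq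
    using cov by (intro conjI ballI bexI[of _ 0]) (simp_all only:)
qed

theorem proposition5p1:
  fixes m :: real and D :: "(real^3) set"
  assumes "m > 0" and "similar_sets rhombic_dodecahedron D"
  shows "\<not> isoperimetric_solution m D"
proof
  assume sol: "isoperimetric_solution m D"
  then obtain G where "D \<in> ball_fundamental_domains m G" by (auto simp: isoperimetric_solution_def)
  then obtain c where c: "sqrt 2 * m \<le> c" "hausdorff2_square * ennreal (c\<^sup>2 * (6 * sqrt 2)) \<le> Per D"
    using similar_rhombic_dodecahedron_bounds[OF assms(2,1)] by blast
  \<comment> \<open>At this scale the lattice \<open>fcc\<close> has inradius \<open>m\<close>.
    Since \<open>k \<le> c\<close>, the dodecahedron \<open>D\<close> is at least as large as the
    one that the competitor modifies.\<close>
  define k where "k = sqrt 2 * m"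
  have k: "k > 0" "k / sqrt 2 = m" using assms(1) by (simp_all add: k_def)
  have "k\<^sup>2 * competitor_area < k\<^sup>2 * (6 * sqrt 2)"
    using k(1) competitor_area_less(1) by simp
  also have "\<dots> \<le> c\<^sup>2 * (6 * sqrt 2)"
    using c(1) k(1) by (intro mult_right_mono power_mono) (auto simp: k_def)
  finally have "ennreal (k\<^sup>2 * competitor_area) < ennreal (c\<^sup>2 * (6 * sqrt 2))"
    using competitor_area_less(2) by (subst ennreal_less_iff) auto
  then have "hausdorff2_square * ennreal (k\<^sup>2 * competitor_area) < hausdorff2_square * ennreal (c\<^sup>2 * (6 * sqrt 2))"
    using hausdorff2_square_pos hausdorff2_square_finite by (intro ennreal_mult_strict_left_mono) auto
  then have "Per ((*\<^sub>R) k ` competitor) < Per D"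
    using Per_competitor[OF k(1)] c(2) by (meson le_less_trans less_le_trans)
  moreover have "Per D \<le> Per ((*\<^sub>R) k ` competitor)"
    using sol scaled_fcc_lattice[OF k(1)] scaled_competitor_domain[OF k(1)]
    unfolding k(2) isoperimetric_solution_def by (auto intro: INF_lower2)
  ultimately show False by simp
qed

end
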